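(* Let $P\in\mathbb{R}[x,y]$ be a nonzero polynomial with $\deg P\le 2$. Then for every $n\ge\deg P$ the following property holds: for every real sequence $\beta\equiv\beta^{(2n)}=\{\beta_{ij}\}_{i,j\ge0,\,i+j\le 2n}$ with $\beta_{00}>0$, $\beta$ has a representing measure supported in $\mathcal{Z}(P)$ if and only if $\mathcal{M}(n)(\beta)$ is positive semi-definite, recursively generated, $P(X,Y)=0$ in $\mathcal{C}_{\mathcal{M}(n)}$, and $\operatorname{rank}\mathcal{M}(n)\le\operatorname{card}\mathcal{V}(\mathcal{M}(n))$.
   Context: A representing measure for $\beta=\beta^{(2n)}$ is a positive Borel measure $\mu$ on $\mathbb{R}^2$ with convergent moments such that $\beta_{ij}=\int y^ix^j\,d\mu$ for $i,j\ge0$, $i+j\le 2n$. For a polynomial $p$, $\mathcal{Z}(p):=\{(x,y)\in\mathbb{R}^2:p(x,y)=0\}$; "supported in $\mathcal{Z}(P)$" means $\operatorname{supp}\mu\subseteq\mathcal{Z}(P)$. $\mathbb{R}_n[x,y]$ is the space of real polynomials of degree at most $n$. The moment matrix $\mathcal{M}(n)\equiv\mathcal{M}(n)(\beta)$ is the real symmetric matrix of size $(n+1)(n+2)/2$ with rows and columns indexed by $1,X,Y,X^2,YX,Y^2,\dots,X^n,YX^{n-1},\dots,Y^n$, whose entry in row $Y^iX^j$, column $Y^kX^\ell$ is $\beta_{i+k,j+\ell}$. $\mathcal{C}_{\mathcal{M}(n)}$ is its column space. For $p(x,y)=\sum a_{ij}y^ix^j\in\mathbb{R}_n[x,y]$,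 $p(X,Y):=\sum a_{ij}Y^iX^j\in\mathcal{C}_{\mathcal{M}(n)}$, where $Y^iX^j$ denotes the corresponding column. $\mathcal{M}(n)$ is recursively generated if whenever $p,q,pq\in\mathbb{R}_n[x,y]$ and $p(X,Y)=0$, then $(pq)(X,Y)=0$. The variety is $\mathcal{V}(\mathcal{M}(n)):=\bigcap\{\mathcal{Z}(p):p\in\mathbb{R}_n[x,y],\ p(X,Y)=0\}$. *)

theory Defs
  imports "HOL-Analysis.Analysis" "Jordan_Normal_Form.DL_Rank"
begin

section \<open>Bivariate polynomials\<close>

text \<open>
  A polynomial \<open>p = \<Sum> a\<^sub>i\<^sub>j y\<^sup>i x\<^sup>j\<close> is an element of \<open>\<real>[x][y]\<close>: the outer variable is \<open>y\<close>, the inner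
  variable is \<open>x\<close>, and \<open>a\<^sub>i\<^sub>j = coeff (coeff p i) j\<close>.
\<close>
type_synonym bipoly = "real poly poly"

definition bicoeff :: "bipoly \<Rightarrow> nat \<Rightarrow> nat \<Rightarrow> real" where
  "bicoeff p i j = coeff (coeff p i) j"

definition bieval :: "bipoly \<Rightarrow> real \<Rightarrow> real \<Rightarrow> real" where
  "bieval p x y = poly (poly p [:y:]) x"

text \<open>The total degree; the zero polynomial gets total degree \<open>0\<close>, so that it lies in every \<open>\<real>\<^sub>n[x,y]\<close>.\<close>
definition total_degree :: "bipoly \<Rightarrow> nat" where
  "total_degree p = Max (insert 0 {i + j | i j. bicoeff p i j \<noteq> 0})"

definition polys_upto :: "nat \<Rightarrow> bipoly set" where
  "polys_upto n = {p. total_degree p \<le> n}"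

definition zero_set :: "bipoly \<Rightarrow> (real \<times> real) set" where
  "zero_set p = {(x, y). bieval p x y = 0}"

lemma finite_bicoeff_degrees: "finite {i + j | i j. bicoeff p i j \<noteq> 0}"
proof (rule finite_subset)
  show "{i + j | i j. bicoeff p i j \<noteq> 0}
    \<subseteq> (\<Union>i\<le>degree p. (\<lambda>j. i + j) ` {..degree (coeff p i)})"
  proof
    fix d assume "d \<in> {i + j | i j. bicoeff p i j \<noteq> 0}"
    then obtain i j where d: "d = i + j" and nz: "coeff (coeff p i) j \<noteq> 0"
      by (auto simp: bicoeff_def)
    from nz have "coeff p i \<noteq> 0" by auto
    then have "i \<le> degree p" by (rule le_degree)
    moreover have "j \<le> degree (coeff p i)" using nz by (rule le_degree)
    ultimately show "d \<in> (\<Union>i\<le>degree p. (\<lambda>j. i + j) ` {..degree (coeff p i)})"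
      using d by blast
  qed
qed auto

lemma total_degree_le_iff:
  "total_degree p \<le> n \<longleftrightarrow> (\<forall>i j. bicoeff p i j \<noteq> 0 \<longrightarrow> i + j \<le> n)"
  unfolding total_degree_def using finite_bicoeff_degrees[of p] by auto

lemma bieval_altdef:
  "bieval p x y = (\<Sum>i\<le>degree p. \<Sum>j\<le>degree (coeff p i). bicoeff p i j * y ^ i * x ^ j)"
proof -
  have "bieval p x y = (\<Sum>i\<le>degree p. poly (coeff p i) x * y ^ i)"
    by (simp add: bieval_def poly_altdef[of p] poly_sum)
  also have "\<dots> = (\<Sum>i\<le>degree p. \<Sum>j\<le>degree (coeff p i). bicoeff p i j * y ^ i * x ^ j)"
    by (simp add: poly_altdef bicoeff_def sum_distrib_right sum_distrib_left mult_ac)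
  finally show ?thesis .
qed


section \<open>Representing measures\<close>

text \<open>
  A sequence \<open>\<beta>\<^sup>(\<^sup>2\<^sup>n\<^sup>)\<close> is a total function \<open>\<beta>\<close> of which only the values \<open>\<beta> i j\<close> with \<open>i + j \<le> 2n\<close>
  are ever used; \<open>i\<close> is the exponent of \<open>y\<close> and \<open>j\<close> that of \<open>x\<close>.
\<close>
definition representing_measure ::
    "nat \<Rightarrow> (nat \<Rightarrow> nat \<Rightarrow> real) \<Rightarrow> (real \<times> real) measure \<Rightarrow> bool" where
  "representing_measure n \<beta> \<mu> \<longleftrightarrow>
     sets \<mu> = sets borel \<and>
     (\<forall>i j. i + j \<le> 2 * n \<longrightarrow>
        integrable \<mu> (\<lambda>(x, y). y ^ i * x ^ j) \<and>
        \<beta> i j = (LINT (x, y)|\<mu>. y ^ i * x ^ j))"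

definition measure_support :: "'a::topological_space measure \<Rightarrow> 'a set" where
  "measure_support \<mu> = {z. \<forall>U. open U \<and> z \<in> U \<longrightarrow> emeasure \<mu> U > 0}"


section \<open>Moment matrices\<close>

definition mm_size :: "nat \<Rightarrow> nat" where
  "mm_size n = (n + 1) * (n + 2) div 2"

text \<open>
  The monomials \<open>1, X, Y, X\<^sup>2, YX, Y\<^sup>2, \<dots>, X\<^sup>n, YX\<^sup>n\<^sup>-\<^sup>1, \<dots>, Y\<^sup>n\<close>, with \<open>(i, j)\<close> standing for \<open>Y\<^sup>iX\<^sup>j\<close>.
\<close>
definition monomials :: "nat \<Rightarrow> (nat \<times> nat) list" where
  "monomials n = concat (map (\<lambda>d. map (\<lambda>i. (i, d - i)) [0..<d + 1]) [0..<n + 1])"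

lemma length_monomials: "length (monomials n) = mm_size n"
proof (induction n)
  case 0
  show ?case by (simp add: monomials_def mm_size_def)
next
  case (Suc n)
  have "length (monomials (Suc n)) = length (monomials n) + (n + 2)"
    by (simp add: monomials_def)
  with Suc show ?case by (simp add: mm_size_def)
qed

lemma set_monomials: "set (monomials n) = {(i, j). i + j \<le> n}"
proof -
  have "(i, j) \<in> set (monomials n)" if "i + j \<le> n" for i j
  proof -
    have "(i, j) \<in> set (map (\<lambda>k. (k, (i + j) - k)) [0..<i + j + 1])"
      by (simp add: image_iff del: upt_Suc)
    moreover have "i + j \<in> set [0..<n + 1]"
      using that by auto
    ultimately show ?thesis
      unfolding monomials_def set_concat list.set_map image_image by (rule UN_I[rotated])
  qed
  moreover have "i + j \<le> n" if "(i, j) \<in> set (monomials n)" for i j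
    using that by (auto simp: monomials_def simp del: upt_Suc)
  ultimately show ?thesis by auto
qed

definition moment_matrix :: "nat \<Rightarrow> (nat \<Rightarrow> nat \<Rightarrow> real) \<Rightarrow> real mat" where
  "moment_matrix n \<beta> = Matrix.mat (mm_size n) (mm_size n)
     (\<lambda>(r, c). let (i, j) = monomials n ! r; (k, l) = monomials n ! c in \<beta> (i + k) (j + l))"

text \<open>
  The element \<open>p(X,Y) = \<Sum> a\<^sub>i\<^sub>j Y\<^sup>iX\<^sup>j\<close> of the column space, where \<open>Y\<^sup>iX\<^sup>j\<close> is a column of the moment
  matrix. Meaningful only for \<open>p \<in> polys_upto n\<close>.
\<close>
definition column_eval :: "nat \<Rightarrow> (nat \<Rightarrow> nat \<Rightarrow> real) \<Rightarrow> bipoly \<Rightarrow> real vec" where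
  "column_eval n \<beta> p = finsum_vec TYPE(real) (mm_size n)
     (\<lambda>c. (case monomials n ! c of (i, j) \<Rightarrow> bicoeff p i j) \<cdot>\<^sub>v Matrix.col (moment_matrix n \<beta>) c)
     {0..<mm_size n}"

definition column_relation :: "nat \<Rightarrow> (nat \<Rightarrow> nat \<Rightarrow> real) \<Rightarrow> bipoly \<Rightarrow> bool" where
  "column_relation n \<beta> p \<longleftrightarrow> column_eval n \<beta> p = 0\<^sub>v (mm_size n)"

definition positive_semidefinite :: "real mat \<Rightarrow> bool" where
  "positive_semidefinite A \<longleftrightarrow>
     square_mat A \<and> transpose_mat A = A \<and> (\<forall>v \<in> carrier_vec (dim_row A). scalar_prod v (A *\<^sub>v v) \<ge> 0)"

definition recursively_generated :: "nat \<Rightarrow> (nat \<Rightarrow> nat \<Rightarrow> real) \<Rightarrow> bool" where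
  "recursively_generated n \<beta> \<longleftrightarrow>
     (\<forall>p q. p \<in> polys_upto n \<and> q \<in> polys_upto n \<and> p * q \<in> polys_upto n \<and> column_relation n \<beta> p
        \<longrightarrow> column_relation n \<beta> (p * q))"

definition moment_rank :: "nat \<Rightarrow> (nat \<Rightarrow> nat \<Rightarrow> real) \<Rightarrow> nat" where
  "moment_rank n \<beta> = vec_space.rank (mm_size n) (moment_matrix n \<beta>)"

definition moment_variety :: "nat \<Rightarrow> (nat \<Rightarrow> nat \<Rightarrow> real) \<Rightarrow> (real \<times> real) set" where
  "moment_variety n \<beta> = \<Inter> {zero_set p | p. p \<in> polys_upto n \<and> column_relation n \<beta> p}"

end

theory Submission
  imports Defs "HOL-Computational_Algebra.Fundamental_Theorem_Algebra"
begin

text \<open>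
  Let \<open>L\<close> be the Riesz functional of \<open>\<beta>\<close> and \<open>V\<close> the variety of the moment matrix. By separating \<open>L\<close>
  from the convex cone spanned by the evaluations at points of \<open>V\<close>, it is enough to show that every
  polynomial \<open>f\<close> of degree at most \<open>2n\<close> that is nonnegative on \<open>V\<close> coincides, up to a polynomial which
  vanishes on \<open>V\<close> and is annihilated by \<open>L\<close>, with a sum of squares of polynomials of degree at most \<open>n\<close>.
  On a line or a smooth conic a rational parametrization turns \<open>f\<close> into a univariate polynomial: if \<open>V\<close> is
  infinite it is nonnegative, hence a sum of two squares; if \<open>V\<close> is finite, the rank condition makes the
  kernel of the moment matrix consist of all polynomials of degree at most \<open>n\<close> that vanish on \<open>V\<close>, and
  interpolation of the square root of \<open>f\<close> does the job. On a pair of lines the two univariate problems are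
  glued at the common point of the lines, which lies at infinity when they are parallel. All remaining
  curves of degree at most two with a point in \<open>V\<close> reduce to these cases.
\<close>

section \<open>Univariate real polynomials\<close>

text \<open>The cone spanned by the evaluations at points of an unbounded variety need not be
  closed, so a separating polynomial \<open>f\<close> only satisfies \<open>L f \<le> 0\<close>.
  What excludes it is strictness: if \<open>f\<close> agrees with a sum of squares and
  \<open>L f = 0\<close>, then \<open>L\<close> annihilates every square, the squared polynomials
  lie in the kernel of the moment matrix, and \<open>f\<close> vanishes on the variety.

  Degrees are the main obstacle. A product with a kernel element is annihilated only if the other
  factor has degree at most \<open>n\<close>, while relations are needed up to total degree
  \<open>2 * n\<close>. Either recursive generation redistributes the degrees, or a univariate
  cofactor is cut into two pieces that fit.

  The rank condition speaks about finite varieties only. The delicate case is a pair of lines of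
  which one lies in the variety while the other meets it in finitely many points: these points are
  recovered as roots of a kernel polynomial of least degree, by the argument that shows orthogonal
  polynomials to have simple real roots.\<close>

lemma real_poly_factor:
  fixes p :: "real poly"
  assumes "degree p > 0"
  shows "(\<exists>r. [:-r, 1:] dvd p) \<or> (\<exists>a b. b \<noteq> 0 \<and> [:a^2 + b^2, -2 * a, 1:] dvd p)"
proof -
  let ?C = "map_poly complex_of_real"
  have C_mult: "?C (q * r) = ?C q * ?C r" for q r
    by (rule poly_eqI) (simp add: coeff_map_poly coeff_mult)
  have C_add: "?C (q + r) = ?C q + ?C r" for q r
    by (rule poly_eqI) (simp add: coeff_map_poly)
  have C_poly: "poly (?C q) (of_real x) = of_real (poly q x)" for q x
    by (induction q) (simp_all add: map_poly_pCons)
  have "\<not> constant (poly (?C p))"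
    using assms by (simp add: constant_degree degree_map_poly)
  then obtain z where z: "poly (?C p) z = 0"
    using fundamental_theorem_of_algebra by blast
  show ?thesis
  proof (cases "Im z = 0")
    case True
    then have "z = of_real (Re z)" by (simp add: complex_eq_iff)
    then have "complex_of_real (poly p (Re z)) = 0"
      using z by (metis C_poly)
    then show ?thesis by (auto simp: poly_eq_0_iff_dvd)
  next
    case False
    define a b where "a = Re z" and "b = Im z"
    define Q where "Q = [:a^2 + b^2, -2 * a, 1:]"
    have Q0: "poly (?C Q) z = 0"
      by (simp add: Q_def map_poly_pCons complex_eq_iff a_def b_def power2_eq_square algebra_simps)
    \<comment> \<open>The remainder is real of degree below 2 and still vanishes at the nonreal
      \<open>z\<close>, which forces it to be zero.\<close>
    define r where "r = p mod Q"
    have "degree r < 2"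
      using degree_mod_less[of Q p] by (auto simp: r_def Q_def)
    then obtain c0 c1 where r: "r = [:c0, c1:]"
      by (metis One_nat_def Suc_1 coeff_pCons_0 degree_0 degree_pCons_eq_if less_Suc0 less_antisym
          not_less_eq pCons_cases degree_eq_zeroE)
    have "p = Q * (p div Q) + r" by (simp add: r_def)
    then have "poly (?C p) z = poly (?C Q) z * poly (?C (p div Q)) z + poly (?C r) z"
      by (metis C_add C_mult poly_add poly_mult)
    then have "poly (?C r) z = 0" using z Q0 by simp
    then have "complex_of_real c0 + z * complex_of_real c1 = 0"
      by (simp add: r map_poly_pCons)
    then have "c1 = 0" "c0 = 0" using False by (auto simp: complex_eq_iff)
    then have "Q dvd p" using r by (simp add: r_def mod_eq_0_iff_dvd)
    then show ?thesis using False unfolding Q_def b_def by blast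
  qed
qed

lemma poly_nonneg_cofinite:
  fixes p :: "real poly"
  assumes "finite S" and "\<And>x. x \<notin> S \<Longrightarrow> poly p x \<ge> 0"
  shows "poly p x \<ge> 0"
proof (rule ccontr)
  let ?U = "{x. poly p x < 0}"
  assume "\<not> poly p x \<ge> 0"
  then have "?U \<noteq> {}" by (auto simp: not_le)
  moreover have "open ?U" by (intro open_Collect_less continuous_intros)
  moreover have "finite ?U" using assms by (auto intro: finite_subset[of _ S] simp: not_le[symmetric])
  ultimately show False using finite_imp_not_open by blast
qed

text \<open>A real root of a nonnegative polynomial is a minimum, hence double, and contributes a
  square; a pair of conjugate roots contributes a sum of two squares, and products of such sums are
  again of this form. The degree bounds are what later keeps the squared polynomials within degree
  \<open>n\<close>.\<close>

lemma nonneg_poly_two_squares: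
  fixes p :: "real poly"
  assumes "\<And>x. poly p x \<ge> 0"
  shows "\<exists>g h. p = g^2 + h^2 \<and> 2 * degree g \<le> degree p \<and> 2 * degree h \<le> degree p"
  using assms
proof (induction "degree p" arbitrary: p rule: less_induct)
  case less
  show ?case
  proof (cases "degree p = 0")
    case True
    then obtain c where c: "p = [:c:]" by (rule degree_eq_zeroE)
    with less.prems[of 0] have "c \<ge> 0" by simp
    then have "p = [:sqrt c:]^2 + 0^2" by (simp add: c power2_eq_square)
    then show ?thesis by (metis degree_0 degree_pCons_0 le0 mult_0_right)
  next
    case False
    then have p0: "p \<noteq> 0" by auto
    from real_poly_factor False consider r where "[:-r, 1:] dvd p"
      | a b where "b \<noteq> 0" "[:a^2 + b^2, -2 * a, 1:] dvd p" by blast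
    then show ?thesis
    proof cases
      case 1
      then obtain q where q: "p = [:-r, 1:] * q" by (metis dvdE)
      have "DERIV (poly p) r :> poly (pderiv p) r" by (rule poly_DERIV)
      then have "poly (pderiv p) r = 0"
        by (rule DERIV_local_min[where d = 1]) (use less.prems in \<open>auto simp: q\<close>)
      then have "poly q r = 0" unfolding q pderiv_mult by (simp add: pderiv_pCons)
      then obtain s where s: "q = [:-r, 1:] * s" by (metis dvdE poly_eq_0_iff_dvd)
      have ps: "p = [:-r, 1:]^2 * s" unfolding q s power2_eq_square by (rule mult.assoc[symmetric])
      have s0: "s \<noteq> 0" using p0 ps by auto
      then have deg: "degree p = 2 + degree s" unfolding ps
        by (subst degree_mult_eq) (auto simp: degree_power_eq)
      have "poly s x \<ge> 0" for x
      proof (rule poly_nonneg_cofinite[of "{r}"])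
        fix x assume "x \<notin> {r}"
        then have "(x - r)^2 > 0" by simp
        moreover have "(x - r)^2 * poly s x \<ge> 0"
          using less.prems[of x] by (simp add: ps power2_eq_square algebra_simps)
        ultimately show "poly s x \<ge> 0" by (simp add: zero_le_mult_iff)
      qed auto
      with less.hyps[of s] deg obtain g h where gh: "s = g^2 + h^2"
        "2 * degree g \<le> degree s" "2 * degree h \<le> degree s" by auto
      have "p = ([:-r, 1:] * g)^2 + ([:-r, 1:] * h)^2"
        unfolding ps gh(1) by (simp only: power_mult_distrib distrib_left)
      moreover have "degree ([:-r, 1:] * g) \<le> 1 + degree g" "degree ([:-r, 1:] * h) \<le> 1 + degree h"
        by (rule degree_mult_le[THEN order_trans], simp)+
      ultimately show ?thesis using gh deg
        by (intro exI[of _ "[:-r, 1:] * g"] exI[of _ "[:-r, 1:] * h"]) auto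
    next
      case 2
      then obtain q where q: "p = [:a^2 + b^2, -2 * a, 1:] * q" by (metis dvdE)
      have q0: "q \<noteq> 0" using p0 q by auto
      have deg: "degree p = 2 + degree q" unfolding q
        using q0 by (subst degree_mult_eq) auto
      have "poly q x \<ge> 0" for x
      proof -
        have "(x - a)^2 + b^2 > 0" using 2(1) by (simp add: add_nonneg_pos)
        moreover have "((x - a)^2 + b^2) * poly q x \<ge> 0"
          using less.prems[of x] by (simp add: q power2_eq_square algebra_simps)
        ultimately show ?thesis by (simp add: zero_le_mult_iff)
      qed
      with less.hyps[of q] deg obtain g h where gh: "q = g^2 + h^2"
        "2 * degree g \<le> degree q" "2 * degree h \<le> degree q" by auto
      \<comment> \<open>Brahmagupta's identity multiplies the two sums of two squares.\<close>
      define u v where "u = [:-a, 1:]" and "v = [:b:]"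
      have "[:a^2 + b^2, -2 * a, 1:] = u^2 + v^2" by (simp add: u_def v_def power2_eq_square)
      then have "p = (u * g + v * h)^2 + (u * h - v * g)^2"
        by (simp only: q gh(1)) (simp add: power2_eq_square algebra_simps)
      moreover have "degree (u * g) \<le> 1 + degree g" "degree (u * h) \<le> 1 + degree h"
        "degree (v * g) \<le> 0 + degree g" "degree (v * h) \<le> 0 + degree h"
        by (rule degree_mult_le[THEN order_trans], simp add: u_def v_def)+
      then have "degree (u * g + v * h) \<le> 1 + degree q div 2" "degree (u * h - v * g) \<le> 1 + degree q div 2"
        using gh(2,3) by (auto intro!: degree_add_le degree_diff_le)
      ultimately show ?thesis using deg by (intro exI[of _ "u * g + v * h"] exI[of _ "u * h - v * g"]) auto
    qed
  qed
qed

section \<open>Root polynomials, interpolation and divisibility\<close>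

definition root_poly :: "real set \<Rightarrow> real poly" where
  "root_poly S = (\<Prod>r\<in>S. [:-r, 1:])"

lemma degree_root_poly [simp]: "degree (root_poly S) = card S"
  unfolding root_poly_def by (cases "finite S") (simp_all add: degree_prod_eq_sum_degree)

lemma root_poly_neq_0 [simp]: "root_poly S \<noteq> 0"
  unfolding root_poly_def by (cases "finite S") auto

lemma poly_root_poly_eq_0_iff [simp]: "finite S \<Longrightarrow> poly (root_poly S) x = 0 \<longleftrightarrow> x \<in> S"
  unfolding root_poly_def by (auto simp: poly_prod)

lemma root_poly_dvd:
  assumes "finite S" "\<And>r. r \<in> S \<Longrightarrow> poly p r = 0"
  shows "root_poly S dvd p"
  using assms
proof (induction S arbitrary: p rule: finite_induct)
  case empty
  then show ?case by (simp add: root_poly_def)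
next
  case (insert r S)
  have "poly p r = 0" using insert.prems by simp
  then obtain q where q: "p = [:-r, 1:] * q" by (metis dvdE poly_eq_0_iff_dvd)
  have "poly q s = 0" if "s \<in> S" for s
    using insert.prems[of s] insert.hyps that by (auto simp: q)
  then have "root_poly S dvd q" by (rule insert.IH)
  then have "[:-r, 1:] * root_poly S dvd p" unfolding q by (rule mult_dvd_mono[OF dvd_refl])
  then show ?case using insert.hyps unfolding root_poly_def by (metis prod.insert)
qed

text \<open>Newton interpolation: a new node is served by a multiple of the root polynomial of the
  old nodes, which leaves the old values alone.\<close>

lemma poly_interpolation:
  fixes y :: "real \<Rightarrow> real"
  assumes "finite S" "card S \<le> Suc m"
  shows "\<exists>h. degree h \<le> m \<and> (\<forall>r\<in>S. poly h r = y r)"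
proof -
  have "\<exists>h. degree h \<le> card S - 1 \<and> (\<forall>r\<in>S. poly h r = y r)"
    using assms(1)
  proof (induction S rule: finite_induct)
    case empty
    show ?case by (intro exI[of _ 0]) auto
  next
    case (insert r S)
    then obtain h where h: "degree h \<le> card S - 1" "\<forall>r\<in>S. poly h r = y r" by auto
    define c where "c = (y r - poly h r) / poly (root_poly S) r"
    have "degree (h + Polynomial.smult c (root_poly S)) \<le> card S"
      using h(1) by (intro degree_add_le) (auto intro: order_trans[OF degree_smult_le])
    moreover have "poly (h + Polynomial.smult c (root_poly S)) s = y s" if "s \<in> insert r S" for s
      using that insert.hyps h(2) by (auto simp: c_def)
    ultimately show ?case using insert.hyps by (intro exI[of _ "h + Polynomial.smult c (root_poly S)"]) auto
  qed
  then obtain h where "degree h \<le> card S - 1" "\<forall>r\<in>S. poly h r = y r" by blast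
  then show ?thesis using assms(2) by (intro exI[of _ h]) auto
qed

text \<open>Excluding repeated and nonreal roots makes \<open>G\<close> a product of distinct real
  linear factors, which are peeled off one at a time.\<close>

lemma real_rooted_dvd:
  fixes G p :: "real poly"
  assumes "G \<noteq> 0"
    and "\<And>r. \<not> [:-r, 1:]^2 dvd G"
    and "\<And>a b. b \<noteq> 0 \<Longrightarrow> \<not> [:a^2 + b^2, -2 * a, 1:] dvd G"
    and "\<And>r. poly G r = 0 \<Longrightarrow> poly p r = 0"
  shows "G dvd p"
  using assms
proof (induction "degree G" arbitrary: G p rule: less_induct)
  case less
  show ?case
  proof (cases "degree G = 0")
    case True
    then show ?thesis using less.prems(1) is_unit_iff_degree unit_imp_dvd by blast
  next
    case False
    then obtain r where r: "[:-r, 1:] dvd G" using real_poly_factor less.prems(3) by blast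
    then obtain H where H: "G = [:-r, 1:] * H" by (metis dvdE)
    have "poly G r = 0" by (simp add: H)
    then obtain q where q: "p = [:-r, 1:] * q"
      using less.prems(4) by (metis dvdE poly_eq_0_iff_dvd)
    have H0: "H \<noteq> 0" using less.prems(1) H by auto
    have Hr: "poly H r \<noteq> 0"
    proof
      assume "poly H r = 0"
      then have "[:-r, 1:] dvd H" by (simp only: poly_eq_0_iff_dvd)
      then have "[:-r, 1:] * [:-r, 1:] dvd [:-r, 1:] * H" by (rule mult_dvd_mono[OF dvd_refl])
      then show False using less.prems(2)[of r] unfolding H power2_eq_square by blast
    qed
    have "H dvd q"
    proof (rule less.hyps)
      show "degree H < degree G" using H0 unfolding H by (subst degree_mult_eq) auto
      show "\<not> [:-s, 1:]^2 dvd H" for s using less.prems(2)[of s] unfolding H by (metis dvd_mult)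
      show "\<not> [:a^2 + b^2, -2 * a, 1:] dvd H" if "b \<noteq> 0" for a b
        using less.prems(3)[OF that, of a] unfolding H by (metis dvd_mult)
      show "poly q s = 0" if "poly H s = 0" for s
        using less.prems(4)[of s] that Hr by (auto simp: H q)
    qed (fact H0)
    then show ?thesis unfolding H q by (rule mult_dvd_mono[OF dvd_refl])
  qed
qed

text \<open>Kernel elements may be multiplied only by factors up to a fixed degree \<open>N\<close>.
  A cofactor of larger degree is cut into a low part and a high part; in the high part the power of
  the variable is the multiplier and \<open>hi\<close> joins the kernel element.\<close>

lemma poly_split_at:
  fixes q :: "'a::comm_ring_1 poly"
  assumes "degree q \<le> N + k"
  obtains lo hi where "q = lo + monom 1 N * hi" "degree lo \<le> N" "degree hi \<le> k"
proof
  show "q = poly_cutoff N q + monom 1 N * poly_shift N q"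
    by (rule poly_eqI) (simp add: coeff_poly_cutoff coeff_monom_mult coeff_poly_shift)
  show "degree (poly_cutoff N q) \<le> N"
    by (rule degree_le) (simp add: coeff_poly_cutoff)
  show "degree (poly_shift N q) \<le> k"
    using assms by (intro degree_le) (auto simp: coeff_poly_shift intro!: coeff_eq_0)
qed

section \<open>Bivariate polynomials of bounded degree\<close>

definition cst :: "real \<Rightarrow> bipoly" where "cst c = [:[:c:]:]"
definition vx :: bipoly where "vx = [:[:0, 1:]:]"
definition vy :: bipoly where "vy = [:0, 1:]"

lemma bieval_simps [simp]:
  "bieval (p + q) x y = bieval p x y + bieval q x y"
  "bieval (p - q) x y = bieval p x y - bieval q x y"
  "bieval (- p) x y = - bieval p x y"
  "bieval (p * q) x y = bieval p x y * bieval q x y"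
  "bieval (p ^ k) x y = bieval p x y ^ k"
  "bieval 0 x y = 0" "bieval 1 x y = 1"
  "bieval (cst c) x y = c" "bieval vx x y = x" "bieval vy x y = y"
  by (simp_all add: bieval_def cst_def vx_def vy_def)

lemma bieval_sum [simp]: "bieval (sum f A) x y = (\<Sum>i\<in>A. bieval (f i) x y)"
  by (simp add: bieval_def poly_sum)

lemma bieval_ext:
  assumes "\<And>x y. bieval p x y = bieval q x y"
  shows "p = q"
proof -
  have *: "r = 0" if "\<And>x y. bieval r x y = 0" for r :: bipoly
  proof (rule ccontr)
    assume "r \<noteq> 0"
    define c where "c = lead_coeff r"
    have "c \<noteq> 0" using \<open>r \<noteq> 0\<close> by (simp add: c_def)
    \<comment> \<open>At such an \<open>x\<close> the specialised polynomial in \<open>y\<close>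
      keeps its leading term, so it cannot vanish identically.\<close>
    then obtain x where x: "poly c x \<noteq> 0" using poly_all_0_iff_0 by blast
    let ?s = "map_poly (\<lambda>a. poly a x) r"
    have "poly ?s y = bieval r x y" for y
      unfolding bieval_def by (induction r) (auto simp: map_poly_pCons)
    then have "?s = 0" using that poly_all_0_iff_0 by metis
    then have "coeff ?s (degree r) = 0" by simp
    then show False using x by (simp add: coeff_map_poly c_def)
  qed
  show ?thesis using *[of "p - q"] assms by simp
qed

lemma bicoeff_simps [simp]:
  "bicoeff (p + q) i j = bicoeff p i j + bicoeff q i j"
  "bicoeff (p - q) i j = bicoeff p i j - bicoeff q i j"
  "bicoeff (- p) i j = - bicoeff p i j"
  "bicoeff 0 i j = 0"
  "bicoeff (cst c * p) i j = c * bicoeff p i j"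
  by (simp_all add: bicoeff_def cst_def)

lemma bicoeff_sum [simp]: "bicoeff (sum f A) i j = (\<Sum>k\<in>A. bicoeff (f k) i j)"
  by (simp add: bicoeff_def coeff_sum)

text \<open>Unlike \<open>polys_upto\<close>, the strict bound can express with \<open>k = 0\<close>
  that only the zero polynomial is allowed; this is needed for quotients when a constant is divided
  by an affine form.\<close>

definition polys_below :: "nat \<Rightarrow> bipoly set" where
  "polys_below k = {p. \<forall>i j. k \<le> i + j \<longrightarrow> bicoeff p i j = 0}"

lemma polys_upto_eq: "polys_upto n = polys_below (Suc n)"
  unfolding polys_upto_def polys_below_def total_degree_le_iff by (auto simp: not_le[symmetric] Suc_le_eq)

lemma polys_below_0: "polys_below 0 = {0}"
  by (auto simp: polys_below_def bicoeff_def intro!: poly_eqI)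

lemma polys_below_mono: "p \<in> polys_below k \<Longrightarrow> k \<le> m \<Longrightarrow> p \<in> polys_below m"
  by (auto simp: polys_below_def)

lemma polys_below_zero [simp, intro]: "0 \<in> polys_below k"
  by (simp add: polys_below_def)

lemma polys_below_add [intro]: "p \<in> polys_below k \<Longrightarrow> q \<in> polys_below k \<Longrightarrow> p + q \<in> polys_below k"
  and polys_below_diff [intro]: "p \<in> polys_below k \<Longrightarrow> q \<in> polys_below k \<Longrightarrow> p - q \<in> polys_below k"
  and polys_below_uminus [intro]: "p \<in> polys_below k \<Longrightarrow> - p \<in> polys_below k"
  and polys_below_cmult [intro]: "p \<in> polys_below k \<Longrightarrow> cst c * p \<in> polys_below k"
  by (simp_all add: polys_below_def)

lemma polys_below_sum [intro]: "(\<And>i. i \<in> A \<Longrightarrow> f i \<in> polys_below k) \<Longrightarrow> sum f A \<in> polys_below k"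
  by (simp add: polys_below_def)

text \<open>The first factor has degree at most \<open>k\<close>, the second degree strictly below
  \<open>m\<close>; the asymmetric form covers a zero factor, \<open>m = 0\<close>, without a case
  distinction.\<close>

lemma polys_below_mult:
  assumes "p \<in> polys_below (Suc k)" "q \<in> polys_below m" "k + m \<le> l"
  shows "p * q \<in> polys_below l"
  unfolding polys_below_def
proof (intro CollectI allI impI)
  fix i j assume ij: "l \<le> i + j"
  have "bicoeff p a b * bicoeff q (i - a) (j - b) = 0" if "a \<le> i" "b \<le> j" for a b
  proof (cases "Suc k \<le> a + b")
    case True
    then show ?thesis using assms(1) by (simp add: polys_below_def)
  next
    case False
    then have "m \<le> (i - a) + (j - b)" using that ij assms(3) by linarith
    then show ?thesis using assms(2) by (simp add: polys_below_def)
  qed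
  then show "bicoeff (p * q) i j = 0"
    unfolding bicoeff_def coeff_mult coeff_sum by (intro sum.neutral ballI) simp
qed

lemma polys_below_cst [simp, intro]: "cst c \<in> polys_below (Suc k)"
  by (auto simp: polys_below_def bicoeff_def cst_def coeff_pCons split: nat.split)

lemma polys_below_one [simp, intro]: "1 \<in> polys_below (Suc k)"
  using polys_below_cst[of 1] by (simp add: cst_def one_pCons)

lemma polys_below_vx [simp, intro]: "vx \<in> polys_below (Suc (Suc k))"
  by (auto simp: polys_below_def bicoeff_def vx_def coeff_pCons split: nat.split)

lemma polys_below_vy [simp, intro]: "vy \<in> polys_below (Suc (Suc k))"
  by (auto simp: polys_below_def bicoeff_def vy_def coeff_pCons split: nat.split)

lemma polys_below_affine_mult:
  "a \<in> polys_below 2 \<Longrightarrow> p \<in> polys_below k \<Longrightarrow> a * p \<in> polys_below (Suc k)"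
  by (rule polys_below_mult[of a 1 p k]) (auto simp: numeral_2_eq_2)

lemma polys_below_affine_power: "a \<in> polys_below 2 \<Longrightarrow> k \<le> m \<Longrightarrow> a ^ k \<in> polys_below (Suc m)"
proof -
  assume a: "a \<in> polys_below 2"
  have "a ^ k \<in> polys_below (Suc k)" by (induction k) (auto intro: polys_below_affine_mult a)
  then show "k \<le> m \<Longrightarrow> ?thesis" by (rule polys_below_mono) simp
qed

text \<open>Splitting off one variable is the step behind the inductions on the degree.\<close>

lemma polys_below_Suc_cases:
  assumes "p \<in> polys_below (Suc k)"
  obtains c p1 p2 where "p = cst c + vx * p1 + vy * p2" "p1 \<in> polys_below k" "p2 \<in> polys_below k"
proof -
  obtain a p2 where p: "p = pCons a p2" by (cases p)
  obtain c b where a: "a = pCons c b" by (cases a)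
  have "p = cst c + vx * [:b:] + vy * p2" by (simp add: p a cst_def vx_def vy_def)
  moreover have "[:b:] \<in> polys_below k"
    unfolding polys_below_def
  proof (intro CollectI allI impI)
    fix i j assume "k \<le> i + j"
    then show "bicoeff [:b:] i j = 0"
      using assms[unfolded polys_below_def, THEN CollectD, rule_format, of 0 "Suc j"]
      by (cases i) (auto simp: bicoeff_def p a)
  qed
  moreover have "p2 \<in> polys_below k"
    unfolding polys_below_def
  proof (intro CollectI allI impI)
    fix i j assume "k \<le> i + j"
    then show "bicoeff p2 i j = 0"
      using assms[unfolded polys_below_def, THEN CollectD, rule_format, of "Suc i" j]
      by (auto simp: bicoeff_def p a)
  qed
  ultimately show ?thesis by (rule that)
qed

lemma bipoly_const: "p \<in> polys_below 1 \<Longrightarrow> \<exists>c. p = cst c"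
proof -
  assume "p \<in> polys_below 1"
  then obtain c p1 p2 where "p = cst c + vx * p1 + vy * p2" "p1 \<in> polys_below 0" "p2 \<in> polys_below 0"
    by (auto elim: polys_below_Suc_cases)
  then show ?thesis by (auto simp: polys_below_0)
qed

text \<open>The forms \<open>a\<close>, \<open>b\<close>, \<open>c\<close> act as homogeneous
  coordinates: since even the constant 1 is a combination of them, every term can give up one of
  them as a factor.\<close>

lemma polys_below_frame_cases:
  assumes p: "p \<in> polys_below (Suc (Suc k))"
    and fr: "1 = cst a0 * a + cst b0 * b + cst c0 * c"
      "vx = cst a1 * a + cst b1 * b + cst c1 * c" "vy = cst a2 * a + cst b2 * b + cst c2 * c"
  obtains p1 p2 p3 where "p = a * p1 + b * p2 + c * p3"
    "p1 \<in> polys_below (Suc k)" "p2 \<in> polys_below (Suc k)" "p3 \<in> polys_below (Suc k)"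
proof -
  obtain d q1 q2 where q: "p = cst d + vx * q1 + vy * q2"
    "q1 \<in> polys_below (Suc k)" "q2 \<in> polys_below (Suc k)"
    using p by (rule polys_below_Suc_cases)
  have "p = 1 * cst d + vx * q1 + vy * q2" using q(1) by simp
  also have "\<dots> = a * (cst a0 * cst d + cst a1 * q1 + cst a2 * q2)
      + b * (cst b0 * cst d + cst b1 * q1 + cst b2 * q2) + c * (cst c0 * cst d + cst c1 * q1 + cst c2 * q2)"
    unfolding fr(2,3) by (subst fr(1)) (simp only: algebra_simps)
  finally show ?thesis by (rule that) (use q(2,3) in auto)
qed

text \<open>The homogenisation \<open>a^k * u(c / a)\<close> of a polynomial \<open>u\<close> of
  degree at most \<open>k\<close>, written without division.\<close>

definition homog :: "nat \<Rightarrow> real poly \<Rightarrow> bipoly \<Rightarrow> bipoly \<Rightarrow> bipoly" where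
  "homog k u a c = (\<Sum>s\<le>k. cst (coeff u s) * (a ^ (k - s) * c ^ s))"

lemma cst_add: "cst (c + d) = cst c + cst d" and cst_mult: "cst (c * d) = cst c * cst d"
  and cst_0 [simp]: "cst 0 = 0" and cst_1: "cst 1 = 1"
  by (simp_all add: cst_def one_pCons)

lemma homog_in [intro]: "a \<in> polys_below 2 \<Longrightarrow> c \<in> polys_below 2 \<Longrightarrow> k \<le> m \<Longrightarrow> homog k u a c \<in> polys_below (Suc m)"
  unfolding homog_def
proof (intro polys_below_sum polys_below_cmult)
  fix s assume "a \<in> polys_below 2" "c \<in> polys_below 2" "k \<le> m" "s \<in> {..k}"
  then show "a ^ (k - s) * c ^ s \<in> polys_below (Suc m)"
    by (intro polys_below_mult[of _ "k - s" _ "Suc s"] polys_below_affine_power) auto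
qed

lemma homog_add: "homog k (u + v) a c = homog k u a c + homog k v a c"
  by (simp add: homog_def cst_add distrib_right sum.distrib)

lemma homog_Suc: "degree u \<le> k \<Longrightarrow> homog (Suc k) u a c = a * homog k u a c"
  by (auto simp: homog_def sum_distrib_left coeff_eq_0 Suc_diff_le mult_ac intro!: sum.cong)

lemma homog_pCons: "homog (Suc k) (pCons 0 u) a c = c * homog k u a c"
  unfolding homog_def sum.atMost_Suc_shift by (auto simp: sum_distrib_left mult_ac intro!: sum.cong)

lemma bieval_homog:
  assumes "degree u \<le> k" "bieval a x y \<noteq> 0"
  shows "bieval (homog k u a c) x y = bieval a x y ^ k * poly u (bieval c x y / bieval a x y)"
proof -
  have "poly u t = (\<Sum>s\<le>k. coeff u s * t ^ s)" for t
    using assms(1) by (auto simp: poly_altdef intro!: sum.mono_neutral_left intro: le_degree)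
  then show ?thesis
    unfolding homog_def using assms(2)
    by (auto simp: sum_distrib_left power_divide power_diff field_simps intro!: sum.cong)
qed

text \<open>Every monomial of degree at most \<open>k + l\<close> factors into monomials of degrees
  at most \<open>k\<close> and \<open>l\<close>; the induction moves one variable at a time out of
  \<open>p\<close> into the first factor.\<close>

lemma linear_vanish_products:
  fixes T :: "bipoly \<Rightarrow> real"
  assumes "\<And>p q. T (p + q) = T p + T q"
    and "\<And>p q. p \<in> polys_below (Suc k) \<Longrightarrow> q \<in> polys_below (Suc l) \<Longrightarrow> T (p * q) = 0"
    and "p \<in> polys_below (Suc (k + l))"
  shows "T p = 0"
  using assms
proof (induction k arbitrary: T p)
  case 0
  then show ?case using "0.prems"(2)[of 1 p] by simp
next
  case (Suc k)
  obtain c p1 p2 where p: "p = cst c + vx * p1 + vy * p2"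
    "p1 \<in> polys_below (Suc (k + l))" "p2 \<in> polys_below (Suc (k + l))"
    using Suc.prems(3) by (auto elim: polys_below_Suc_cases)
  have "T (v * r) = 0" if "v \<in> polys_below 2" "r \<in> polys_below (Suc (k + l))" for v r
  proof (rule Suc.IH[of "\<lambda>r. T (v * r)", OF _ _ that(2)])
    show "T (v * (q * r)) = 0" if "q \<in> polys_below (Suc k)" "r \<in> polys_below (Suc l)" for q r
      using Suc.prems(2)[of "v * q" r] that polys_below_affine_mult[OF \<open>v \<in> polys_below 2\<close>] by (simp add: mult_ac)
  qed (simp add: Suc.prems(1) distrib_left)
  moreover have "vx \<in> polys_below 2" "vy \<in> polys_below 2" by (auto simp: numeral_2_eq_2)
  moreover have "T (cst c) = 0" using Suc.prems(2)[of "cst c" 1] by simp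
  ultimately show ?case using p by (simp add: Suc.prems(1))
qed

section \<open>Atomic representations of strictly positive functionals\<close>

text \<open>The finite-dimensional Hahn-Banach theorem: the functional is extended one coordinate at
  a time.\<close>

lemma dominated_linear_functional:
  fixes p :: "(nat \<Rightarrow> real) \<Rightarrow> real"
  assumes add: "\<And>x y. p (\<lambda>i. x i + y i) \<le> p x + p y"
    and scale: "\<And>s x. s > 0 \<Longrightarrow> p (\<lambda>i. s * x i) \<le> s * p x"
  shows "\<exists>c. \<forall>x. (\<forall>i\<ge>N. x i = 0) \<longrightarrow> (\<Sum>i<N. c i * x i) \<le> p x"
proof (induction N)
  case 0
  have "p (\<lambda>i. 0) \<ge> 0" using scale[of 2 "\<lambda>i. 0"] by simp
  then have "0 \<le> p x" if "\<forall>i. x i = 0" for x using that by (metis ext)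
  then show ?case by simp
next
  case (Suc N)
  then obtain c where c: "\<And>x. (\<forall>i\<ge>N. x i = 0) \<Longrightarrow> (\<Sum>i<N. c i * x i) \<le> p x" by blast
  define X where "X = {x :: nat \<Rightarrow> real. \<forall>i\<ge>N. x i = 0}"
  define e where "e = (\<lambda>i. if i = N then 1 else 0 :: real)"
  \<comment> \<open>\<open>A\<close> holds the lower bounds for the value of the extension at the
    new unit vector \<open>e\<close>. Each lies below every upper bound, so \<open>Sup A\<close> is
    an admissible value.\<close>
  define A where "A = (\<lambda>x. (\<Sum>i<N. c i * x i) - p (\<lambda>i. x i - e i)) ` X"
  have bound: "(\<Sum>i<N. c i * x i) - p (\<lambda>i. x i - e i) \<le> p (\<lambda>i. y i + e i) - (\<Sum>i<N. c i * y i)"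
    if "x \<in> X" "y \<in> X" for x y
  proof -
    have "(\<Sum>i<N. c i * (x i + y i)) \<le> p (\<lambda>i. x i + y i)"
      using c[of "\<lambda>i. x i + y i"] that by (simp add: X_def)
    also have "\<dots> \<le> p (\<lambda>i. x i - e i) + p (\<lambda>i. y i + e i)"
      using add[of "\<lambda>i. x i - e i" "\<lambda>i. y i + e i"] by simp
    finally show ?thesis by (simp add: distrib_left sum.distrib)
  qed
  have X0: "(\<lambda>i. 0) \<in> X" by (simp add: X_def)
  have bdd: "bdd_above A" using bound[OF _ X0] by (auto simp: A_def intro!: bdd_aboveI)
  have lower: "(\<Sum>i<N. c i * x i) - p (\<lambda>i. x i - e i) \<le> Sup A" if "x \<in> X" for x
    using that bdd by (auto simp: A_def intro!: cSup_upper)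
  have upper: "Sup A \<le> p (\<lambda>i. y i + e i) - (\<Sum>i<N. c i * y i)" if "y \<in> X" for y
    using bound[OF _ that] X0 by (intro cSup_least) (auto simp: A_def)
  have "(\<Sum>i<Suc N. (c(N := Sup A)) i * x i) \<le> p x" if x: "\<forall>i\<ge>Suc N. x i = 0" for x
  proof -
    define t where "t = x N"
    define x' where "x' = x(N := 0)"
    have x'X: "x' \<in> X" using x by (simp add: X_def x'_def)
    have sX: "(\<lambda>i. s * x' i) \<in> X" for s using x'X by (simp add: X_def)
    have xe: "x = (\<lambda>i. x' i + t * e i)" by (auto simp: x'_def t_def e_def)
    have S: "(\<Sum>i<Suc N. (c(N := Sup A)) i * x i) = (\<Sum>i<N. c i * x' i) + t * Sup A"
      by (simp add: x'_def t_def mult.commute)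
    \<comment> \<open>For nonzero \<open>t\<close> the vector is rescaled to last coordinate 1 or
      -1, where the upper or the lower bound applies.\<close>
    consider "t = 0" | "t > 0" | "t < 0" by linarith
    then show ?thesis
    proof cases
      case 1
      then have "x = x'" using xe by simp
      then show ?thesis using c[of x'] x'X 1 S by (simp add: X_def)
    next
      case 2
      have "p (\<lambda>i. (1 / t) * x' i + e i) \<le> (1 / t) * p x"
        using scale[of "1 / t" x] 2 by (simp add: xe distrib_left)
      then have "t * p (\<lambda>i. (1 / t) * x' i + e i) \<le> p x" using 2 by (simp add: field_simps)
      moreover have "t * Sup A \<le> t * (p (\<lambda>i. (1 / t) * x' i + e i) - (\<Sum>i<N. c i * ((1 / t) * x' i)))"
        using upper[OF sX[of "1 / t"]] 2 by (intro mult_left_mono) auto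
      moreover have "t * (\<Sum>i<N. c i * ((1 / t) * x' i)) = (\<Sum>i<N. c i * x' i)"
        using 2 by (simp add: sum_distrib_left)
      ultimately show ?thesis unfolding S by (simp add: right_diff_distrib)
    next
      case 3
      define s where "s = - t"
      have s: "s > 0" using 3 by (simp add: s_def)
      have "p (\<lambda>i. (1 / s) * x' i - e i) \<le> (1 / s) * p x"
        using scale[of "1 / s" x] s by (simp add: xe distrib_left s_def)
      then have "s * p (\<lambda>i. (1 / s) * x' i - e i) \<le> p x" using s by (simp add: field_simps)
      moreover have "s * ((\<Sum>i<N. c i * ((1 / s) * x' i)) - p (\<lambda>i. (1 / s) * x' i - e i)) \<le> s * Sup A"
        using lower[OF sX[of "1 / s"]] s by (intro mult_left_mono) auto
      moreover have "s * (\<Sum>i<N. c i * ((1 / s) * x' i)) = (\<Sum>i<N. c i * x' i)"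
        using s by (simp add: sum_distrib_left)
      ultimately show ?thesis unfolding S by (simp add: right_diff_distrib s_def)
    qed
  qed
  then show ?case by blast
qed

section \<open>Evaluations, the monomial basis and linear functionals\<close>

definition ev :: "bipoly \<Rightarrow> real \<times> real \<Rightarrow> real" where
  "ev p z = bieval p (fst z) (snd z)"

lemma ev_simps [simp]:
  "ev (p + q) z = ev p z + ev q z" "ev (p - q) z = ev p z - ev q z" "ev (- p) z = - ev p z"
  "ev (p * q) z = ev p z * ev q z" "ev (p ^ k) z = ev p z ^ k" "ev 0 z = 0" "ev 1 z = 1"
  "ev (cst c) z = c" "ev (sum f A) z = (\<Sum>i\<in>A. ev (f i) z)"
  "ev vx z = fst z" "ev vy z = snd z"
  by (simp_all add: ev_def)

lemma zero_set_eq: "zero_set p = {z. ev p z = 0}"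
  by (auto simp: zero_set_def ev_def)

lemma ev_ext: "(\<And>z. ev p z = ev q z) \<Longrightarrow> p = q"
  by (rule bieval_ext) (metis ev_def fst_conv snd_conv)

definition monomial :: "nat \<times> nat \<Rightarrow> bipoly" where
  "monomial z = vy ^ fst z * vx ^ snd z"

lemma bicoeff_monomial: "bicoeff (monomial z) i j = (if z = (i, j) then 1 else 0)"
proof -
  have X: "bicoeff (vx * q) i j = (case j of 0 \<Rightarrow> 0 | Suc j' \<Rightarrow> bicoeff q i j')" for q i j
    by (simp add: bicoeff_def vx_def coeff_pCons split: nat.split)
  have Y: "bicoeff (vy * q) i j = (case i of 0 \<Rightarrow> 0 | Suc i' \<Rightarrow> bicoeff q i' j)" for q i j
    by (simp add: bicoeff_def vy_def coeff_pCons split: nat.split)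
  have one: "bicoeff 1 i j = (if i = 0 \<and> j = 0 then 1 else 0)" for i j
    by (simp add: bicoeff_def)
  have bx: "bicoeff (vx ^ m) i j = (if i = 0 \<and> j = m then 1 else 0)" for m i j
    by (induction m arbitrary: j) (auto simp: X one split: nat.split)
  have byx: "bicoeff (vy ^ l * vx ^ m) i j = (if i = l \<and> j = m then 1 else 0)" for l m i j
    by (induction l arbitrary: i) (auto simp: Y bx mult.assoc split: nat.split)
  show ?thesis by (cases z) (auto simp: monomial_def byx)
qed

lemma monomial_in_polys_upto: "fst z + snd z \<le> k \<Longrightarrow> monomial z \<in> polys_upto k"
  by (auto simp: polys_upto_eq polys_below_def bicoeff_monomial)

lemma bipoly_monomial_sum:
  assumes "p \<in> polys_upto k"
  shows "p = (\<Sum>z\<in>set (monomials k). cst (bicoeff p (fst z) (snd z)) * monomial z)"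
proof -
  have *: "bicoeff p i j = (\<Sum>z\<in>set (monomials k). bicoeff p (fst z) (snd z) * (if z = (i, j) then 1 else 0))" for i j
  proof -
    have "(\<Sum>z\<in>set (monomials k). bicoeff p (fst z) (snd z) * (if z = (i, j) then 1 else 0))
        = (\<Sum>z\<in>set (monomials k). if z = (i, j) then bicoeff p i j else 0)"
      by (intro sum.cong) auto
    also have "\<dots> = (if (i, j) \<in> set (monomials k) then bicoeff p i j else 0)"
      by (subst sum.delta) auto
    also have "\<dots> = bicoeff p i j"
      using assms by (auto simp: set_monomials polys_upto_def total_degree_le_iff)
    finally show ?thesis by simp
  qed
  have b': "bicoeff p i j = bicoeff (\<Sum>z\<in>set (monomials k). cst (bicoeff p (fst z) (snd z)) * monomial z) i j" for i j
    unfolding bicoeff_sum bicoeff_simps bicoeff_monomial by (rule *)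
  show ?thesis unfolding bicoeff_def by (rule poly_eqI, rule poly_eqI) (rule b'[unfolded bicoeff_def])
qed

definition linear_functional :: "(bipoly \<Rightarrow> real) \<Rightarrow> bool" where
  "linear_functional L \<longleftrightarrow> (\<forall>p q. L (p + q) = L p + L q) \<and> (\<forall>c p. L (cst c * p) = c * L p)"

lemma linear_functionalD:
  assumes "linear_functional L"
  shows "L (p + q) = L p + L q" "L (cst c * p) = c * L p" "L 0 = 0" "L (- p) = - L p"
    "L (p - q) = L p - L q" "L (sum f A) = (\<Sum>i\<in>A. L (f i))"
proof -
  show add: "L (p + q) = L p + L q" for p q using assms by (simp add: linear_functional_def)
  show cm: "L (cst c * p) = c * L p" for c p using assms by (simp add: linear_functional_def)
  show z: "L 0 = 0" using add[of 0 0] by simp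
  show m: "L (- p) = - L p" for p using add[of p "- p"] z by simp
  show "L (p - q) = L p - L q" using add[of p "- q"] m by simp
  show "L (sum f A) = (\<Sum>i\<in>A. L (f i))"
    by (induction A rule: infinite_finite_induct) (simp_all add: z add)
qed

text \<open>Nodes in \<open>V\<close> with a dual family turn restrictions to \<open>V\<close> into
  vectors of length \<open>d\<close>. A node is added only where a polynomial of the finite list is
  not yet reproduced, so \<open>V\<close> may be infinite.\<close>

lemma evaluation_nodes:
  assumes "set fs \<subseteq> polys_below k"
  shows "\<exists>(d::nat) v h. (\<forall>i<d. v i \<in> V \<and> h i \<in> polys_below k) \<and>
    (\<forall>i<d. \<forall>j<d. ev (h i) (v j) = (if i = j then 1 else 0)) \<and>
    (\<forall>f\<in>set fs. \<forall>z\<in>V. ev f z = (\<Sum>i<d. ev f (v i) * ev (h i) z))"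
  using assms
proof (induction fs)
  case Nil
  show ?case by (rule exI[of _ 0]) auto
next
  case (Cons f fs)
  then have "set fs \<subseteq> polys_below k" by simp
  from Cons.IH[OF this] obtain d :: nat and v h where *: "(\<forall>i<d. v i \<in> V \<and> h i \<in> polys_below k) \<and>
    (\<forall>i<d. \<forall>j<d. ev (h i) (v j) = (if i = j then 1 else 0)) \<and>
    (\<forall>f\<in>set fs. \<forall>z\<in>V. ev f z = (\<Sum>i<d. ev f (v i) * ev (h i) z))" by (elim exE) (rule that)
  have v: "v i \<in> V" and h: "h i \<in> polys_below k" if "i < d" for i using * that by blast+
  have d: "ev (h i) (v j) = (if i = j then 1 else 0)" if "i < d" "j < d" for i j using * that by blast
  have fs: "ev f z = (\<Sum>i<d. ev f (v i) * ev (h i) z)" if "f \<in> set fs" "z \<in> V" for f z using * that by blast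
  \<comment> \<open>The part of \<open>f\<close> not reproduced by the nodes found so far; it
    vanishes at all of them.\<close>
  define g where "g = f - (\<Sum>i<d. cst (ev f (v i)) * h i)"
  have gk: "g \<in> polys_below k" unfolding g_def using Cons.prems h by auto
  have g0: "ev g (v j) = 0" if "j < d" for j
  proof -
    have "(\<Sum>i<d. ev f (v i) * ev (h i) (v j)) = (\<Sum>i<d. if i = j then ev f (v i) else 0)"
      using that by (intro sum.cong) (auto simp: d)
    also have "\<dots> = ev f (v j)" using that by simp
    finally show ?thesis by (simp add: g_def)
  qed
  show ?case
  proof (cases "\<forall>z\<in>V. ev g z = 0")
    case True
    then have "ev f z = (\<Sum>i<d. ev f (v i) * ev (h i) z)" if "z \<in> V" for z
      using that by (simp add: g_def)
    then have "\<forall>f\<in>set (f # fs). \<forall>z\<in>V. ev f z = (\<Sum>i<d. ev f (v i) * ev (h i) z)"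
      using fs unfolding list.set by blast
    then show ?thesis using v h d by (intro exI[of _ d] exI[of _ v] exI[of _ h] conjI) blast+
  next
    case False
    then obtain w where w: "w \<in> V" "ev g w \<noteq> 0" by auto
    define H where "H = cst (1 / ev g w) * g"
    define v' where "v' = v(d := w)"
    \<comment> \<open>The multiple of \<open>H\<close> makes the old dual polynomials vanish at the
      new node \<open>w\<close>.\<close>
    define h' where "h' = (\<lambda>i. if i = d then H else h i - cst (ev (h i) w) * H)"
    have Hw: "ev H w = 1" "\<And>j. j < d \<Longrightarrow> ev H (v j) = 0" using w g0 by (auto simp: H_def)
    have Hk: "H \<in> polys_below k" using gk by (auto simp: H_def)
    \<comment> \<open>One computation for both kinds of polynomials: \<open>c = 0\<close> for those
      reproduced before, \<open>c = ev g w\<close> for \<open>f\<close> itself.\<close>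
    have rep: "ev F z = (\<Sum>i<Suc d. ev F (v' i) * ev (h' i) z)"
      if F: "ev F z = (\<Sum>i<d. ev F (v i) * ev (h i) z) + c * ev H z"
        "ev F w = (\<Sum>i<d. ev F (v i) * ev (h i) w) + c * ev H w" for F z c
    proof -
      have "(\<Sum>i<Suc d. ev F (v' i) * ev (h' i) z)
          = (\<Sum>i<d. ev F (v i) * (ev (h i) z - ev (h i) w * ev H z)) + ev F w * ev H z"
        by (simp add: v'_def h'_def)
      also have "\<dots> = (\<Sum>i<d. ev F (v i) * ev (h i) z) + (ev F w - (\<Sum>i<d. ev F (v i) * ev (h i) w)) * ev H z"
        by (simp add: right_diff_distrib left_diff_distrib sum_subtractf sum_distrib_left mult_ac)
      also have "\<dots> = ev F z" using F Hw by simp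
      finally show ?thesis by simp
    qed
    have "ev F z = (\<Sum>i<Suc d. ev F (v' i) * ev (h' i) z)" if "F \<in> set (f # fs)" "z \<in> V" for F z
    proof (cases "F \<in> set fs")
      case True
      show ?thesis
        by (rule rep[of _ _ 0]; unfold mult_zero_left add_0_right; rule fs[OF True]) (fact w that)+
    next
      case False
      then have "F = f" using that by simp
      have "ev g y = ev f y - (\<Sum>i<d. ev f (v i) * ev (h i) y)" for y by (simp add: g_def)
      then have *: "ev f y = (\<Sum>i<d. ev f (v i) * ev (h i) y) + ev g w * ev H y" for y
        using w by (simp add: H_def)
      show ?thesis unfolding \<open>F = f\<close> by (rule rep) (rule *)+
    qed
    moreover have "\<forall>i<Suc d. v' i \<in> V \<and> h' i \<in> polys_below k"
      using v h w Hk by (auto simp: v'_def h'_def less_Suc_eq)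
    moreover have "\<forall>i<Suc d. \<forall>j<Suc d. ev (h' i) (v' j) = (if i = j then 1 else 0)"
      using d Hw by (auto simp: v'_def h'_def less_Suc_eq)
    ultimately show ?thesis
      by (intro exI[of _ "Suc d"] exI[of _ v'] exI[of _ h'] conjI) blast+
  qed
qed

text \<open>The separation takes place in the finite-dimensional space of restrictions to
  \<open>V\<close>, with the constant vector 1 as an order unit that supplies both the gauge and the
  normalisation. The equality clause in \<open>pos\<close> compensates for the inequality not being
  strict.\<close>

theorem atomic_representation:
  assumes L: "linear_functional L"
    and pos: "\<And>f. f \<in> polys_upto k \<Longrightarrow> (\<And>z. z \<in> V \<Longrightarrow> ev f z \<ge> 0) \<Longrightarrow>
      L f \<ge> 0 \<and> (L f = 0 \<longrightarrow> (\<forall>z\<in>V. ev f z = 0))"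
  shows "\<exists>xs. (\<forall>(w, z)\<in>set xs. w \<ge> 0 \<and> z \<in> V) \<and>
    (\<forall>f\<in>polys_upto k. L f = (\<Sum>(w, z)\<leftarrow>xs. w * ev f z))"
proof -
  note L = linear_functionalD[OF L]
  have "monomial z \<in> polys_upto k" if "z \<in> set (monomials k)" for z
    using that by (intro monomial_in_polys_upto) (auto simp: set_monomials)
  then have "set (map monomial (monomials k)) \<subseteq> polys_below (Suc k)" by (auto simp: polys_upto_eq)
  from evaluation_nodes[OF this, of V]
  obtain d :: nat and v h where *: "(\<forall>i<d. v i \<in> V \<and> h i \<in> polys_below (Suc k)) \<and>
    (\<forall>i<d. \<forall>j<d. ev (h i) (v j) = (if i = j then 1 else 0)) \<and>
    (\<forall>f\<in>set (map monomial (monomials k)). \<forall>z\<in>V. ev f z = (\<Sum>i<d. ev f (v i) * ev (h i) z))"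
    by (elim exE) (rule that)
  have v: "v i \<in> V" and h: "h i \<in> polys_upto k" if "i < d" for i
    using * that unfolding polys_upto_eq by blast+
  have d: "ev (h i) (v j) = (if i = j then 1 else 0)" if "i < d" "j < d" for i j using * that by blast
  have mon: "ev (monomial m) z = (\<Sum>i<d. ev (monomial m) (v i) * ev (h i) z)"
    if "m \<in> set (monomials k)" "z \<in> V" for m z using * that unfolding set_map by blast
  have rep: "ev f z = (\<Sum>i<d. ev f (v i) * ev (h i) z)" if "f \<in> polys_upto k" "z \<in> V" for f z
  proof -
    have e: "ev f y = (\<Sum>m\<in>set (monomials k). bicoeff f (fst m) (snd m) * ev (monomial m) y)" for y
      by (subst bipoly_monomial_sum[OF that(1)]) simp
    have "ev f z = (\<Sum>m\<in>set (monomials k). \<Sum>i<d. bicoeff f (fst m) (snd m) * ev (monomial m) (v i) * ev (h i) z)"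
      unfolding e by (intro sum.cong refl) (simp add: mon[OF _ that(2)] sum_distrib_left mult_ac)
    also have "\<dots> = (\<Sum>i<d. ev f (v i) * ev (h i) z)"
      unfolding e by (subst sum.swap) (simp add: sum_distrib_right)
    finally show ?thesis .
  qed
  \<comment> \<open>Positivity, applied to a polynomial vanishing on \<open>V\<close> and to its
    negative, shows that \<open>L\<close> depends only on restrictions to \<open>V\<close>.\<close>
  have Lrep: "L f = (\<Sum>i<d. ev f (v i) * L (h i))" if f: "f \<in> polys_upto k" for f
  proof -
    define g where "g = f - (\<Sum>i<d. cst (ev f (v i)) * h i)"
    have g: "g \<in> polys_upto k" using f h unfolding g_def polys_upto_eq by auto
    have "ev g z = 0" if "z \<in> V" for z using rep[OF f that] by (simp add: g_def)
    then have "L g \<ge> 0" "L (- g) \<ge> 0"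
      using pos[of g] pos[of "- g"] g by (auto simp: polys_upto_eq)
    then have "L g = 0" using L(4)[of g] by simp
    then show ?thesis by (simp add: g_def L)
  qed
  \<comment> \<open>Coordinates with index at least \<open>d\<close> are left arbitrary, so that
    vectors of length \<open>d\<close> can be written as functions on all naturals.\<close>
  define C where "C = {x. \<exists>xs. (\<forall>(w, z)\<in>set xs. w \<ge> 0 \<and> z \<in> V) \<and>
    (\<forall>i<d. x i = (\<Sum>(w, z)\<leftarrow>xs. w * ev (h i) z))}"
  have C_add: "(\<lambda>i. x i + y i) \<in> C" if "x \<in> C" "y \<in> C" for x y
  proof -
    from that obtain xs ys where "\<forall>(w, z)\<in>set xs. w \<ge> 0 \<and> z \<in> V" "\<forall>(w, z)\<in>set ys. w \<ge> 0 \<and> z \<in> V"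
      "\<forall>i<d. x i = (\<Sum>(w, z)\<leftarrow>xs. w * ev (h i) z)" "\<forall>i<d. y i = (\<Sum>(w, z)\<leftarrow>ys. w * ev (h i) z)"
      by (auto simp: C_def)
    then show ?thesis unfolding C_def by (intro CollectI exI[of _ "xs @ ys"]) auto
  qed
  have C_scale: "(\<lambda>i. s * x i) \<in> C" if "x \<in> C" "s \<ge> 0" for x s
  proof -
    from that obtain xs where xs: "\<forall>(w, z)\<in>set xs. w \<ge> 0 \<and> z \<in> V"
      "\<forall>i<d. x i = (\<Sum>(w, z)\<leftarrow>xs. w * ev (h i) z)" by (auto simp: C_def)
    have "s * (\<Sum>(w, z)\<leftarrow>xs. w * ev (h i) z) = (\<Sum>(w, z)\<leftarrow>map (\<lambda>(w, z). (s * w, z)) xs. w * ev (h i) z)" for i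
      by (induction xs) (auto simp: algebra_simps)
    then show ?thesis using xs that(2)
      unfolding C_def by (intro CollectI exI[of _ "map (\<lambda>(w, z). (s * w, z)) xs"]) auto
  qed
  have C_cong: "x \<in> C \<Longrightarrow> (\<And>i. i < d \<Longrightarrow> x i = y i) \<Longrightarrow> y \<in> C" for x y by (auto simp: C_def)
  \<comment> \<open>The evaluations at the nodes are the unit vectors, so \<open>C\<close> contains
    the nonnegative orthant and multiples of the constant vector 1 dominate every vector.\<close>
  have C_pos: "x \<in> C" if "\<And>i. i < d \<Longrightarrow> x i \<ge> 0" for x
  proof -
    have "x i = (\<Sum>(w, z)\<leftarrow>map (\<lambda>j. (x j, v j)) [0..<d]. w * ev (h i) z)" if "i < d" for i
    proof -
      have "(\<Sum>(w, z)\<leftarrow>map (\<lambda>j. (x j, v j)) [0..<d]. w * ev (h i) z) = (\<Sum>j<d. x j * ev (h i) (v j))"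
        by (simp add: o_def sum_list_distinct_conv_sum_set atLeast0LessThan)
      also have "\<dots> = (\<Sum>j<d. if i = j then x j else 0)"
        using that by (intro sum.cong) (auto simp: d)
      finally show ?thesis using that by simp
    qed
    then show ?thesis using that v
      unfolding C_def by (intro CollectI exI[of _ "map (\<lambda>j. (x j, v j)) [0..<d]"]) auto
  qed
  have C_atom: "(\<lambda>i. ev (h i) z) \<in> C" if "z \<in> V" for z
    unfolding C_def using that by (intro CollectI exI[of _ "[(1, z)]"]) auto
  define b where "b = (\<lambda>i. L (h i))"
  have "b \<in> C"
  proof (rule ccontr)
    assume bC: "b \<notin> C"
    \<comment> \<open>\<open>D\<close> is the cone \<open>C\<close> enlarged by \<open>- b\<close>;
      separating \<open>b\<close> from \<open>C\<close> means finding a functional that is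
      nonnegative on \<open>D\<close>.\<close>
    define D where "D = {x. \<exists>s\<ge>0. (\<lambda>i. x i + s * b i) \<in> C}"
    have D_add: "(\<lambda>i. x i + y i) \<in> D" if "x \<in> D" "y \<in> D" for x y
    proof -
      from that obtain s t where "s \<ge> 0" "t \<ge> 0" "(\<lambda>i. x i + s * b i) \<in> C" "(\<lambda>i. y i + t * b i) \<in> C"
        by (auto simp: D_def)
      then show ?thesis unfolding D_def using C_add[of "\<lambda>i. x i + s * b i" "\<lambda>i. y i + t * b i"]
        by (intro CollectI exI[of _ "s + t"]) (auto simp: algebra_simps)
    qed
    have D_scale: "(\<lambda>i. r * x i) \<in> D" if "x \<in> D" "r \<ge> 0" for x r
    proof -
      from that obtain s where "s \<ge> 0" "(\<lambda>i. x i + s * b i) \<in> C" by (auto simp: D_def)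
      then show ?thesis unfolding D_def using C_scale[of "\<lambda>i. x i + s * b i" r] that(2)
        by (intro CollectI exI[of _ "r * s"]) (auto simp: algebra_simps)
    qed
    have CD: "x \<in> D" if "x \<in> C" for x using that unfolding D_def by (intro CollectI exI[of _ 0]) auto
    \<comment> \<open>Otherwise adding orthant vectors would put \<open>b\<close> into
      \<open>C\<close>: for \<open>s = 0\<close> the cone would be everything, and for
      \<open>s > 0\<close> the vector \<open>s * b\<close> is the sum of an element of
      \<open>C\<close> and the constant vector 1.\<close>
    have m1: "(\<lambda>i. -1) \<notin> D"
    proof
      assume "(\<lambda>i. -1) \<in> D"
      then obtain s where s: "s \<ge> 0" "(\<lambda>i. -1 + s * b i) \<in> C" by (auto simp: D_def)
      show False
      proof (cases "s = 0")
        case True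
        define M where "M = (\<Sum>i<d. \<bar>b i\<bar>)"
        have "\<bar>b i\<bar> \<le> M" if "i < d" for i unfolding M_def using that by (intro member_le_sum) auto
        then have "(\<lambda>i. b i + M) \<in> C" by (intro C_pos) (smt (verit) abs_ge_minus_self)
        moreover have "(\<lambda>i. M * (-1 + s * b i)) \<in> C" using s by (intro C_scale) (auto simp: M_def sum_nonneg)
        ultimately have "(\<lambda>i. (b i + M) + M * (-1 + s * b i)) \<in> C" by (rule C_add)
        then show False using bC True by simp
      next
        case False
        have "(\<lambda>i. (-1 + s * b i) + 1) \<in> C" by (rule C_add[OF s(2)]) (simp add: C_pos)
        then have "(\<lambda>i. (1 / s) * ((-1 + s * b i) + 1)) \<in> C" by (rule C_scale) (use s in simp)
        then have "b \<in> C" by (rule C_cong) (use False in simp)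
        then show False using bC by simp
      qed
    qed
    \<comment> \<open>\<open>p x\<close> is the infimum of the constants exceeding \<open>x\<close>
      in the order defined by \<open>D\<close>. A functional dominated by \<open>p\<close> is
      nonnegative on \<open>D\<close> and at least 1 on the constant vector 1.\<close>
    define S where "S = (\<lambda>x. {s. (\<lambda>i. s - x i) \<in> D})"
    define p where "p = (\<lambda>x. Inf (S x))"
    have S_ne: "(\<Sum>i<d. \<bar>x i\<bar>) \<in> S x" for x
    proof -
      have "\<bar>x i\<bar> \<le> (\<Sum>i<d. \<bar>x i\<bar>)" if "i < d" for i using that by (intro member_le_sum) auto
      then show ?thesis unfolding S_def by (intro CollectI CD C_pos) (smt (verit) abs_ge_self)
    qed
    have S_lb: "- (\<Sum>i<d. \<bar>x i\<bar>) \<le> s" if "s \<in> S x" for x s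
    proof (rule ccontr)
      define M where "M = (\<Sum>i<d. \<bar>x i\<bar>)"
      assume "\<not> ?thesis"
      then have neg: "s + M < 0" by (simp add: M_def)
      have "\<bar>x i\<bar> \<le> M" if "i < d" for i unfolding M_def using that by (intro member_le_sum) auto
      then have 1: "(\<lambda>i. M + x i) \<in> D" by (intro CD C_pos) (smt (verit) abs_ge_minus_self)
      have "(\<lambda>i. s - x i) \<in> D" using that by (simp add: S_def)
      from D_add[OF this 1] have "(\<lambda>i. (s - x i) + (M + x i)) \<in> D" .
      then have "(\<lambda>i. (- 1 / (s + M)) * ((s - x i) + (M + x i))) \<in> D"
        by (rule D_scale) (use neg in \<open>simp add: divide_nonpos_neg\<close>)
      moreover have "(\<lambda>i. (- 1 / (s + M)) * ((s - x i) + (M + x i))) = (\<lambda>i. -1)"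
        using neg by (intro ext) (simp add: add.commute)
      ultimately show False using m1 by simp
    qed
    have bdd: "bdd_below (S x)" for x using S_lb by (intro bdd_belowI) auto
    have p_le: "p x \<le> s" if "s \<in> S x" for x s unfolding p_def using that bdd by (rule cInf_lower)
    have p_ge: "r \<le> p x" if "\<And>s. s \<in> S x \<Longrightarrow> r \<le> s" for x r
      unfolding p_def using S_ne[of x] that by (intro cInf_greatest) auto
    have p_add: "p (\<lambda>i. x i + y i) \<le> p x + p y" for x y
    proof -
      have "p (\<lambda>i. x i + y i) \<le> s + t" if "s \<in> S x" "t \<in> S y" for s t
      proof (rule p_le)
        have "(\<lambda>i. (s - x i) + (t - y i)) \<in> D" using D_add[of "\<lambda>i. s - x i" "\<lambda>i. t - y i"] that by (simp only: S_def mem_Collect_eq)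
        moreover have "(\<lambda>i. (s - x i) + (t - y i)) = (\<lambda>i. s + t - (x i + y i))" by (rule ext) simp
        ultimately show "s + t \<in> S (\<lambda>i. x i + y i)" by (simp add: S_def)
      qed
      then have "p (\<lambda>i. x i + y i) - t \<le> p x" if "t \<in> S y" for t
        using that by (intro p_ge) (simp add: diff_le_eq)
      then have "p (\<lambda>i. x i + y i) - p x \<le> p y" by (intro p_ge) (smt (verit))
      then show ?thesis by simp
    qed
    have p_scale: "p (\<lambda>i. r * x i) \<le> r * p x" if "r > 0" for r x
    proof -
      have "p (\<lambda>i. r * x i) / r \<le> s" if "s \<in> S x" for s
      proof -
        have "(\<lambda>i. r * (s - x i)) \<in> D" using D_scale[of "\<lambda>i. s - x i" r] that \<open>r > 0\<close> by (simp only: S_def mem_Collect_eq less_imp_le)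
        then have "r * s \<in> S (\<lambda>i. r * x i)" by (simp add: S_def right_diff_distrib)
        then show ?thesis using p_le \<open>r > 0\<close> by (simp add: field_simps)
      qed
      then have "p (\<lambda>i. r * x i) / r \<le> p x" by (rule p_ge)
      then show ?thesis using that by (simp add: field_simps)
    qed
    obtain c where c: "\<And>x. (\<forall>i\<ge>d. x i = 0) \<Longrightarrow> (\<Sum>i<d. c i * x i) \<le> p x"
      using dominated_linear_functional[of p d, OF p_add p_scale] by blast
    \<comment> \<open>Domination is known only for vectors supported below \<open>d\<close>;
      truncating \<open>x\<close> does not affect membership in \<open>C\<close>.\<close>
    have c': "(\<Sum>i<d. c i * x i) \<le> s" if D: "(\<lambda>i. s - x i) \<in> D" for x s
    proof -
      define y where "y = (\<lambda>i. if i < d then x i else 0)"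
      obtain t where t: "t \<ge> 0" "(\<lambda>i. s - x i + t * b i) \<in> C" using D by (auto simp: D_def)
      have "(\<lambda>i. s - y i + t * b i) \<in> C" using t(2) by (rule C_cong) (simp add: y_def)
      then have "s \<in> S y" using t(1) by (auto simp: S_def D_def)
      then have "(\<Sum>i<d. c i * y i) \<le> s" using c[of y] p_le[of s y] by (auto simp: y_def)
      then show ?thesis by (simp add: y_def)
    qed
    define f where "f = (\<Sum>i<d. cst (c i) * h i)"
    have f: "f \<in> polys_upto k" using h unfolding f_def polys_upto_eq by auto
    have "ev f z \<ge> 0" if "z \<in> V" for z
      using c'[of 0 "\<lambda>i. - ev (h i) z"] CD[OF C_atom[OF that]] by (simp add: f_def sum_negf)
    moreover have "L f \<le> 0"
    proof -
      have "(\<lambda>i. 0 - b i) \<in> D" unfolding D_def using C_pos[of "\<lambda>i. 0"] by (intro CollectI exI[of _ 1]) auto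
      then show ?thesis using c'[of 0 b] by (simp add: f_def L b_def)
    qed
    ultimately have f0: "ev f z = 0" if "z \<in> V" for z using pos[OF f] that by fastforce
    \<comment> \<open>The coefficients of \<open>f\<close> are its values at the nodes, so all of
      them vanish, against the normalisation at the constant vector.\<close>
    have "c j = 0" if "j < d" for j
    proof -
      have "ev f (v j) = (\<Sum>i<d. if i = j then c i else 0)"
        unfolding f_def ev_simps using that by (intro sum.cong) (auto simp: d)
      then show ?thesis using f0[OF v[OF that]] that by simp
    qed
    moreover have "(\<Sum>i<d. c i * (-1)) \<le> -1"
      using c'[of "-1" "\<lambda>i. -1"] CD[OF C_pos[of "\<lambda>i. 0"]] by simp
    ultimately show False by simp
  qed
  then obtain xs where xs: "\<forall>(w, z)\<in>set xs. w \<ge> 0 \<and> z \<in> V"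
    "\<And>i. i < d \<Longrightarrow> L (h i) = (\<Sum>(w, z)\<leftarrow>xs. w * ev (h i) z)" by (auto simp: C_def b_def)
  have "L f = (\<Sum>(w, z)\<leftarrow>xs. w * ev f z)" if f: "f \<in> polys_upto k" for f
  proof -
    have "L f = (\<Sum>i<d. ev f (v i) * (\<Sum>(w, z)\<leftarrow>xs. w * ev (h i) z))"
      by (rule trans[OF Lrep[OF f]], intro sum.cong refl) (simp add: xs(2))
    also have "\<dots> = (\<Sum>(w, z)\<leftarrow>xs. w * (\<Sum>i<d. ev f (v i) * ev (h i) z))"
      by (induction xs) (simp_all add: case_prod_beta distrib_left sum.distrib sum_distrib_left mult_ac)
    also have "\<dots> = (\<Sum>(w, z)\<leftarrow>xs. w * ev f z)"
    proof (intro arg_cong[of _ _ sum_list] map_cong refl)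
      fix a assume a: "a \<in> set xs"
      then have "snd a \<in> V" using xs(1) by auto
      from rep[OF f this] show "(case a of (w, z) \<Rightarrow> w * (\<Sum>i<d. ev f (v i) * ev (h i) z)) = (case a of (w, z) \<Rightarrow> w * ev f z)"
        unfolding case_prod_beta by (rule arg_cong[of _ _ "(*) (fst a)", OF sym])
    qed
    finally show ?thesis .
  qed
  then show ?thesis using xs(1) by blast
qed

section \<open>Moment matrices as bilinear forms\<close>

text \<open>Terms of degree above \<open>2 * n\<close> are dropped, which makes the functional
  linear on all bivariate polynomials.\<close>

definition riesz :: "nat \<Rightarrow> (nat \<Rightarrow> nat \<Rightarrow> real) \<Rightarrow> bipoly \<Rightarrow> real" where
  "riesz n \<beta> p = (\<Sum>z\<in>set (monomials (2 * n)). bicoeff p (fst z) (snd z) * \<beta> (fst z) (snd z))"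

lemma linear_riesz: "linear_functional (riesz n \<beta>)"
  by (simp add: linear_functional_def riesz_def distrib_right sum.distrib sum_distrib_left mult.assoc)

lemmas riesz_simps = linear_functionalD[OF linear_riesz]

lemma riesz_monomial:
  assumes "fst z + snd z \<le> 2 * n"
  shows "riesz n \<beta> (monomial z) = \<beta> (fst z) (snd z)"
proof -
  have "riesz n \<beta> (monomial z) = (\<Sum>y\<in>set (monomials (2 * n)). if y = z then \<beta> (fst z) (snd z) else 0)"
    unfolding riesz_def by (intro sum.cong) (auto simp: bicoeff_monomial)
  also have "\<dots> = \<beta> (fst z) (snd z)"
    by (subst sum.delta, simp) (use assms in \<open>auto simp: set_monomials\<close>)
  finally show ?thesis .
qed

lemma monomial_mult: "monomial z * monomial w = monomial (fst z + fst w, snd z + snd w)"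
  by (simp add: monomial_def power_add mult_ac)

lemma distinct_monomials: "distinct (monomials n)"
proof (induction n)
  case 0
  show ?case by (simp add: monomials_def)
next
  case (Suc n)
  have "monomials (Suc n) = monomials n @ map (\<lambda>i. (i, Suc n - i)) [0..<Suc n + 1]"
    by (simp add: monomials_def)
  moreover have "distinct (map (\<lambda>i. (i, Suc n - i)) [0..<Suc n + 1])"
    by (auto simp: distinct_map intro!: inj_onI simp del: upt_Suc)
  moreover have "set (monomials n) \<inter> set (map (\<lambda>i. (i, Suc n - i)) [0..<Suc n + 1]) = {}"
    by (auto simp: set_monomials simp del: upt_Suc)
  ultimately show ?case using Suc by (simp del: upt_Suc)
qed

lemma sum_monomials_nth:
  "(\<Sum>c\<in>{0..<mm_size n}. f (monomials n ! c)) = (\<Sum>z\<in>set (monomials n). f z)"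
  by (rule sum.reindex_bij_betw[OF bij_betw_nth[OF distinct_monomials]])
    (auto simp: length_monomials)

lemma monomials_nth:
  assumes "r < mm_size n"
  shows "fst (monomials n ! r) + snd (monomials n ! r) \<le> n"
proof -
  have "monomials n ! r \<in> set (monomials n)" using assms by (simp add: length_monomials)
  then show ?thesis by (auto simp: set_monomials)
qed

lemma moment_matrix_index:
  assumes "r < mm_size n" "c < mm_size n"
  shows "moment_matrix n \<beta> $$ (r, c) = riesz n \<beta> (monomial (monomials n ! r) * monomial (monomials n ! c))"
  using assms monomials_nth[OF assms(1)] monomials_nth[OF assms(2)]
  by (simp add: moment_matrix_def monomial_mult riesz_monomial case_prod_beta Let_def)

lemma moment_matrix_carrier: "moment_matrix n \<beta> \<in> carrier_mat (mm_size n) (mm_size n)"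
  by (simp add: moment_matrix_def)

lemma column_eval_carrier: "column_eval n \<beta> p \<in> carrier_vec (mm_size n)"
  unfolding column_eval_def by (rule finsum_vec_closed) (use moment_matrix_carrier in auto)

lemma column_eval_index:
  assumes p: "p \<in> polys_upto n" and r: "r < mm_size n"
  shows "column_eval n \<beta> p $ r = riesz n \<beta> (p * monomial (monomials n ! r))"
proof -
  let ?m = "monomials n"
  have "column_eval n \<beta> p $ r = (\<Sum>c\<in>{0..<mm_size n}.
      ((case ?m ! c of (i, j) \<Rightarrow> bicoeff p i j) \<cdot>\<^sub>v Matrix.col (moment_matrix n \<beta>) c) $ r)"
    unfolding column_eval_def using r moment_matrix_carrier
    by (subst index_finsum_vec) auto
  also have "\<dots> = (\<Sum>c\<in>{0..<mm_size n}. bicoeff p (fst (?m ! c)) (snd (?m ! c)) *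
      riesz n \<beta> (monomial (?m ! r) * monomial (?m ! c)))"
    using r moment_matrix_carrier[of n \<beta>]
    by (intro sum.cong) (auto simp: case_prod_beta moment_matrix_index)
  also have "\<dots> = (\<Sum>z\<in>set ?m. bicoeff p (fst z) (snd z) * riesz n \<beta> (monomial (?m ! r) * monomial z))"
    by (rule sum_monomials_nth)
  also have "\<dots> = riesz n \<beta> ((\<Sum>z\<in>set ?m. cst (bicoeff p (fst z) (snd z)) * monomial z) * monomial (?m ! r))"
    by (simp add: sum_distrib_right riesz_simps mult.assoc mult.commute[of "monomial (?m ! r)"])
  also have "\<dots> = riesz n \<beta> (p * monomial (?m ! r))"
    by (subst (2) bipoly_monomial_sum[OF p]) simp
  finally show ?thesis .
qed

lemma riesz_mult_monomials:
  assumes "q \<in> polys_upto n"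
  shows "riesz n \<beta> (p * q) = (\<Sum>z\<in>set (monomials n). bicoeff q (fst z) (snd z) * riesz n \<beta> (p * monomial z))"
proof -
  have "riesz n \<beta> (p * q) = riesz n \<beta> (\<Sum>z\<in>set (monomials n). cst (bicoeff q (fst z) (snd z)) * (p * monomial z))"
    by (subst bipoly_monomial_sum[OF assms]) (simp add: sum_distrib_left mult_ac)
  then show ?thesis by (simp add: riesz_simps)
qed

text \<open>The entries of \<open>column_eval\<close> are the values of the functional at the
  products of \<open>p\<close> with the monomials, so relations form the kernel of the bilinear form
  given by \<open>p * q\<close>.\<close>

lemma column_relation_iff:
  assumes p: "p \<in> polys_upto n"
  shows "column_relation n \<beta> p \<longleftrightarrow> (\<forall>q\<in>polys_upto n. riesz n \<beta> (p * q) = 0)"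
proof
  assume c: "column_relation n \<beta> p"
  have z: "riesz n \<beta> (p * monomial z) = 0" if "z \<in> set (monomials n)" for z
  proof -
    from that obtain r where "r < mm_size n" "z = monomials n ! r"
      by (auto simp: in_set_conv_nth length_monomials)
    then show ?thesis using c column_eval_index[OF p, of r \<beta>] by (simp add: column_relation_def)
  qed
  show "\<forall>q\<in>polys_upto n. riesz n \<beta> (p * q) = 0"
    by (simp add: riesz_mult_monomials z)
next
  assume "\<forall>q\<in>polys_upto n. riesz n \<beta> (p * q) = 0"
  then have "column_eval n \<beta> p $ r = 0" if "r < mm_size n" for r
    using that column_eval_index[OF p that] monomials_nth[OF that] by (simp add: monomial_in_polys_upto)
  then show "column_relation n \<beta> p"
    unfolding column_relation_def using column_eval_carrier[of n \<beta> p] by (intro eq_vecI) auto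
qed

lemma positive_semidefinite_iff:
  "positive_semidefinite (moment_matrix n \<beta>) \<longleftrightarrow> (\<forall>p\<in>polys_upto n. riesz n \<beta> (p * p) \<ge> 0)"
proof -
  let ?M = "moment_matrix n \<beta>" and ?m = "monomials n"
  define P where "P v = (\<Sum>c\<in>{0..<mm_size n}. cst (v $ c) * monomial (?m ! c))" for v
  have form: "v \<bullet> (?M *\<^sub>v v) = riesz n \<beta> (P v * P v)" if v: "v \<in> carrier_vec (mm_size n)" for v
  proof -
    have "v \<bullet> (?M *\<^sub>v v) = (\<Sum>r\<in>{0..<mm_size n}. v $ r * (\<Sum>c\<in>{0..<mm_size n}. ?M $$ (r, c) * v $ c))"
      using v moment_matrix_carrier[of n \<beta>] by (simp add: scalar_prod_def)
    also have "\<dots> = (\<Sum>r\<in>{0..<mm_size n}. \<Sum>c\<in>{0..<mm_size n}. v $ r * (v $ c *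
        riesz n \<beta> (monomial (?m ! r) * monomial (?m ! c))))"
      by (simp add: sum_distrib_left moment_matrix_index mult_ac)
    also have "\<dots> = riesz n \<beta> (P v * P v)"
      unfolding P_def sum_product
      by (simp add: riesz_simps mult.assoc mult.left_commute[of "monomial _" "cst _"])
    finally show ?thesis .
  qed
  have P_in: "P v \<in> polys_upto n" for v
    unfolding P_def polys_upto_eq
    by (intro polys_below_sum polys_below_cmult) (auto intro!: monomial_in_polys_upto monomials_nth simp flip: polys_upto_eq)
  have P_surj: "P (vec (mm_size n) (\<lambda>c. bicoeff p (fst (?m ! c)) (snd (?m ! c)))) = p" if "p \<in> polys_upto n" for p
  proof -
    have "P (vec (mm_size n) (\<lambda>c. bicoeff p (fst (?m ! c)) (snd (?m ! c))))
        = (\<Sum>c\<in>{0..<mm_size n}. cst (bicoeff p (fst (?m ! c)) (snd (?m ! c))) * monomial (?m ! c))"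
      unfolding P_def by (intro sum.cong) auto
    also have "\<dots> = (\<Sum>z\<in>set ?m. cst (bicoeff p (fst z) (snd z)) * monomial z)"
      by (rule sum_monomials_nth)
    also have "\<dots> = p" using bipoly_monomial_sum[OF that] by simp
    finally show ?thesis .
  qed
  have sym: "square_mat ?M" "transpose_mat ?M = ?M"
    using moment_matrix_carrier[of n \<beta>]
    by (auto intro!: eq_matI simp: moment_matrix_index mult.commute)
  have dim: "dim_row ?M = mm_size n" using moment_matrix_carrier[of n \<beta>] by auto
  show ?thesis
  proof
    assume psd: "positive_semidefinite ?M"
    show "\<forall>p\<in>polys_upto n. riesz n \<beta> (p * p) \<ge> 0"
    proof
      fix p assume p: "p \<in> polys_upto n"
      let ?v = "vec (mm_size n) (\<lambda>c. bicoeff p (fst (?m ! c)) (snd (?m ! c)))"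
      have "?v \<bullet> (?M *\<^sub>v ?v) \<ge> 0"
        using psd unfolding positive_semidefinite_def dim by (meson vec_carrier)
      then show "riesz n \<beta> (p * p) \<ge> 0"
        unfolding form[OF vec_carrier] P_surj[OF p] .
    qed
  next
    assume "\<forall>p\<in>polys_upto n. riesz n \<beta> (p * p) \<ge> 0"
    then show "positive_semidefinite ?M"
      unfolding positive_semidefinite_def dim using sym form P_in by simp
  qed
qed

text \<open>If \<open>g\<close> were no relation, the columns of \<open>g\<close> and of the
  \<open>l v\<close> would be \<open>card V + 1\<close> independent vectors of the column space.
  Indeed a dependence is a column relation, so it vanishes on \<open>V\<close>; evaluating it at the
  points removes the \<open>l v\<close>, and only a multiple of \<open>g\<close> is left.\<close>

lemma vanishing_imp_column_relation:
  assumes V: "finite V" "moment_rank n \<beta> \<le> card V" "V \<subseteq> moment_variety n \<beta>"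
    and l: "\<And>v. v \<in> V \<Longrightarrow> l v \<in> polys_upto n"
      "\<And>u v. u \<in> V \<Longrightarrow> v \<in> V \<Longrightarrow> ev (l v) u = (if u = v then 1 else 0)"
    and g: "g \<in> polys_upto n" "\<And>v. v \<in> V \<Longrightarrow> ev g v = 0"
  shows "column_relation n \<beta> g"
proof (rule ccontr)
  assume ng: "\<not> column_relation n \<beta> g"
  interpret vec_space "TYPE(real)" "mm_size n" .
  let ?M = "moment_matrix n \<beta>"
  let ?ce = "column_eval n \<beta>"
  define T where "T = insert g (l ` V)"
  have fT: "finite T" using V(1) by (simp add: T_def)
  have TR: "T \<subseteq> polys_upto n" using l g by (auto simp: T_def)
  have van: "ev p v = 0" if "p \<in> polys_upto n" "column_relation n \<beta> p" "v \<in> V" for p v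
    using that V(3) unfolding moment_variety_def zero_set_eq by blast
  have comb: "a g = 0 \<and> (\<forall>v\<in>V. a (l v) = 0)"
    if a: "column_relation n \<beta> (cst (a g) * g + (\<Sum>v\<in>V. cst (a (l v)) * l v))" for a
  proof -
    let ?p = "cst (a g) * g + (\<Sum>v\<in>V. cst (a (l v)) * l v)"
    have pR: "?p \<in> polys_upto n" using l(1) g(1) unfolding polys_upto_eq
      by (intro polys_below_add polys_below_sum polys_below_cmult)
    have al: "a (l u) = 0" if "u \<in> V" for u
    proof -
      have "ev ?p u = (\<Sum>v\<in>V. a (l v) * ev (l v) u)" using that by (simp add: g(2))
      also have "\<dots> = (\<Sum>v\<in>V. if u = v then a (l v) else 0)"
        using that by (intro sum.cong) (auto simp: l(2))
      also have "\<dots> = a (l u)" using that V(1) by simp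
      finally show ?thesis using van[OF pR a that] by simp
    qed
    then have pg: "?p = cst (a g) * g" by simp
    have "a g = 0"
    proof (rule ccontr)
      assume ag: "a g \<noteq> 0"
      have "riesz n \<beta> (g * q) = 0" if "q \<in> polys_upto n" for q
      proof -
        have "riesz n \<beta> (cst (a g) * g * q) = 0"
          using a that column_relation_iff[OF pR] unfolding pg by blast
        then show ?thesis using ag by (simp add: mult.assoc riesz_simps)
      qed
      then show False using ng column_relation_iff[OF g(1)] by blast
    qed
    then show ?thesis using al by blast
  qed
  have inj_l: "inj_on l V"
    by (rule inj_onI) (metis l(2) zero_neq_one)
  have gl: "g \<notin> l ` V"
    using g(2) l(2) by (metis imageE zero_neq_one)
  have sumT: "(\<Sum>p\<in>T. F p) = F g + (\<Sum>v\<in>V. F (l v))" for F :: "bipoly \<Rightarrow> 'b::comm_monoid_add"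
    unfolding T_def using gl V(1) by (simp add: sum.reindex[OF inj_l])
  have ce_comb: "?ce (\<Sum>p\<in>T. cst (a p) * p) $ r = (\<Sum>p\<in>T. a p * ?ce p $ r)" if "r < mm_size n" for a r
  proof -
    have "(\<Sum>p\<in>T. cst (a p) * p) \<in> polys_upto n" using TR unfolding polys_upto_eq by auto
    then show ?thesis
      using that TR by (auto simp: column_eval_index sum_distrib_right riesz_simps mult.assoc intro!: sum.cong)
  qed
  have lin: "\<forall>p\<in>T. a p = 0" if "\<And>r. r < mm_size n \<Longrightarrow> (\<Sum>p\<in>T. a p * ?ce p $ r) = 0" for a
  proof -
    have "column_relation n \<beta> (\<Sum>p\<in>T. cst (a p) * p)"
      unfolding column_relation_def using column_eval_carrier that
      by (intro eq_vecI) (auto simp: ce_comb)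
    then have "a g = 0 \<and> (\<forall>v\<in>V. a (l v) = 0)" by (intro comb) (simp only: sumT)
    then show ?thesis unfolding T_def by blast
  qed
  have inj: "inj_on ?ce T"
  proof (rule inj_onI, rule ccontr)
    fix p q assume pq: "p \<in> T" "q \<in> T" "?ce p = ?ce q" "p \<noteq> q"
    \<comment> \<open>Equal columns of distinct polynomials count as a dependence with coefficients
      1 and -1.\<close>
    define a where "a = (\<lambda>r. if r = p then 1 else if r = q then -1 else 0 :: real)"
    have "(\<Sum>r\<in>T. a r * x r) = x p - x q" for x :: "bipoly \<Rightarrow> real"
    proof -
      have "(\<Sum>r\<in>T. a r * x r) = (\<Sum>r\<in>{p, q}. a r * x r)"
        using fT pq by (intro sum.mono_neutral_right) (auto simp: a_def)
      then show ?thesis using pq(4) by (simp add: a_def)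
    qed
    then have "\<forall>r\<in>T. a r = 0" using pq(3) by (intro lin) simp
    then show False using pq(1) by (auto simp: a_def)
  qed
  let ?S = "?ce ` T"
  have Sc: "?S \<subseteq> carrier_vec (mm_size n)" using column_eval_carrier by auto
  have li: "lin_indpt ?S"
  proof (rule finite_lin_indpt2)
    fix a assume a: "lincomb a ?S = 0\<^sub>v (mm_size n)"
    have "(\<Sum>p\<in>T. a (?ce p) * ?ce p $ r) = 0" if r: "r < mm_size n" for r
    proof -
      have "lincomb a ?S $ r = (\<Sum>x\<in>?S. a x * x $ r)" by (rule lincomb_index[OF r Sc])
      also have "\<dots> = (\<Sum>p\<in>T. a (?ce p) * ?ce p $ r)" by (simp add: sum.reindex[OF inj])
      finally show ?thesis using a r by simp
    qed
    then have "\<forall>p\<in>T. a (?ce p) = 0" by (rule lin)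
    then show "\<forall>v\<in>?S. a v = 0" by auto
  qed (use fT Sc in auto)
  have S_span: "?S \<subseteq> span (set (cols ?M))"
  proof
    fix x assume "x \<in> ?S"
    then obtain p where p: "p \<in> T" "x = ?ce p" by auto
    let ?v = "vec (mm_size n) (\<lambda>c. bicoeff p (fst (monomials n ! c)) (snd (monomials n ! c)))"
    have "?M *\<^sub>v ?v = ?ce p"
    proof (rule eq_vecI)
      fix r assume "r < dim_vec (?ce p)"
      then have r: "r < mm_size n" using column_eval_carrier by (metis carrier_vecD)
      have "(?M *\<^sub>v ?v) $ r = (\<Sum>c\<in>{0..<mm_size n}. bicoeff p (fst (monomials n ! c)) (snd (monomials n ! c)) * ?M $$ (r, c))"
        using r moment_matrix_carrier[of n \<beta>] by (simp add: scalar_prod_def mult.commute)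
      also have "\<dots> = ?ce p $ r"
        unfolding column_eval_def using r moment_matrix_carrier[of n \<beta>]
        by (subst index_finsum_vec) (auto simp: case_prod_beta intro!: sum.cong)
      finally show "(?M *\<^sub>v ?v) $ r = ?ce p $ r" .
    qed (use moment_matrix_carrier[of n \<beta>] column_eval_carrier[of n \<beta> p] in auto)
    then have "x \<in> col_space ?M"
      unfolding col_space_eq[OF moment_matrix_carrier] using p moment_matrix_carrier[of n \<beta>]
        column_eval_carrier[of n \<beta> p] by (auto intro!: exI[of _ ?v])
    then show "x \<in> span (set (cols ?M))" by (simp add: col_space_def)
  qed
  have cM: "set (cols ?M) \<subseteq> carrier_vec (mm_size n)"
    using moment_matrix_carrier cols_dim by (metis carrier_matD(1))
  have sub: "submodule class_ring (span (set (cols ?M))) (module_vec TYPE(real) (mm_size n))"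
    using cM by (intro span_is_submodule) auto
  interpret W: vectorspace class_ring "vs (span (set (cols ?M)))"
    using cM by (intro subspace_is_vs span_is_subspace) auto
  have "W.lin_indpt ?S"
    using li span_li_not_depend(2)[OF S_span sub] by simp
  moreover have "W.fin_dim" by (rule fin_dim_span_cols[OF moment_matrix_carrier])
  ultimately have "card ?S \<le> W.dim"
    using S_span by (intro W.li_le_dim) auto
  also have "W.dim = moment_rank n \<beta>" by (simp add: moment_rank_def rank_def)
  also have "card ?S = card V + 1"
    using V(1) gl by (simp add: card_image[OF inj]) (simp add: T_def card_image[OF inj_l])
  finally show False using V(2) by simp
qed

text \<open>Each atom contributes a matrix of rank at most one to the moment matrix, and rank is
  subadditive.\<close>

lemma moment_rank_atomic_le:
  assumes "finite V" and "\<And>f. f \<in> polys_upto (2 * n) \<Longrightarrow> riesz n \<beta> f = (\<Sum>z\<in>V. w z * ev f z)"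
  shows "moment_rank n \<beta> \<le> card V"
proof -
  interpret vec_space "TYPE(real)" "mm_size n" .
  let ?m = "monomials n"
  define A where "A S = Matrix.mat (mm_size n) (mm_size n)
    (\<lambda>(r, c). \<Sum>z\<in>S. w z * ev (monomial (?m ! r)) z * ev (monomial (?m ! c)) z)" for S
  have "rank (A S) \<le> card S" if "finite S" for S
    using that
  proof (induction S rule: finite_induct)
    case empty
    have "A {} = 0\<^sub>m (mm_size n) (mm_size n)" by (auto simp: A_def)
    then show ?case using rank_0I by simp
  next
    case (insert z S)
    have eq: "A (insert z S) = A {z} + A S" using insert.hyps by (intro eq_matI) (auto simp: A_def)
    have "rank (A {z}) \<le> 1"
      by (rule rank_le_1_product_entries[where f = "\<lambda>r. w z * ev (monomial (?m ! r)) z" and g = "\<lambda>c. ev (monomial (?m ! c)) z"])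
        (auto simp: A_def)
    moreover have "rank (A {z} + A S) \<le> rank (A {z}) + rank (A S)"
      by (rule rank_subadditive) (auto simp: A_def)
    ultimately show ?case using insert unfolding eq by simp
  qed
  moreover have "moment_matrix n \<beta> = A V"
  proof (rule eq_matI)
    fix r c assume "r < dim_row (A V)" "c < dim_col (A V)"
    then have rc: "r < mm_size n" "c < mm_size n" by (auto simp: A_def)
    have "monomial (?m ! r) * monomial (?m ! c) \<in> polys_upto (2 * n)"
      unfolding monomial_mult using monomials_nth[OF rc(1)] monomials_nth[OF rc(2)]
      by (intro monomial_in_polys_upto) simp
    then show "moment_matrix n \<beta> $$ (r, c) = A V $$ (r, c)"
      using rc by (simp add: moment_matrix_index assms(2) A_def mult.assoc)
  qed (use moment_matrix_carrier in \<open>auto simp: A_def\<close>)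
  ultimately show ?thesis using assms(1) by (simp add: moment_rank_def)
qed

section \<open>Representing measures\<close>

lemma ev_monomial: "ev (monomial z) = (\<lambda>(x, y). y ^ fst z * x ^ snd z)"
  by (auto simp: monomial_def)

lemma ev_expand:
  assumes "p \<in> polys_upto k"
  shows "ev p = (\<lambda>z. \<Sum>m\<in>set (monomials k). bicoeff p (fst m) (snd m) * ev (monomial m) z)"
  by (rule ext, subst bipoly_monomial_sum[OF assms]) simp

lemma ev_1: "ev 1 = (\<lambda>z. 1)"
  by (rule ext) simp

lemma in_polys_upto_total_degree: "p \<in> polys_upto (total_degree p)"
  by (simp add: polys_upto_def)

lemma continuous_ev [continuous_intros]: "continuous_on A (ev p)"
proof -
  have "continuous_on A (ev (monomial m))" for m
    unfolding ev_monomial case_prod_beta by (intro continuous_intros)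
  then show ?thesis
    by (subst ev_expand[OF in_polys_upto_total_degree]) (intro continuous_intros)
qed

lemma borel_measurable_ev [measurable]: "ev p \<in> borel_measurable borel"
  by (intro borel_measurable_continuous_onI continuous_ev)

text \<open>The complement of the support is a union of open null sets, of which countably many
  suffice by the Lindelof property.\<close>

lemma AE_measure_support:
  fixes \<mu> :: "(real \<times> real) measure"
  assumes "sets \<mu> = sets borel"
  shows "AE z in \<mu>. z \<in> measure_support \<mu>"
proof -
  define F where "F = {U. open U \<and> emeasure \<mu> U = 0}"
  obtain F' where F': "F' \<subseteq> F" "countable F'" "\<Union>F' = \<Union>F"
    using Lindelof[of F] by (auto simp: F_def)
  have "(\<Union>U\<in>F'. U) \<in> null_sets \<mu>"
    using F' assms by (intro null_sets_UN') (auto simp: F_def null_sets_def)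
  moreover have "{z \<in> space \<mu>. z \<notin> measure_support \<mu>} \<subseteq> (\<Union>U\<in>F'. U)"
    using F'(3) by (auto simp: measure_support_def F_def)
  ultimately show ?thesis by (rule AE_I')
qed

lemma representing_measure_integral:
  assumes r: "representing_measure n \<beta> \<mu>" and p: "p \<in> polys_upto (2 * n)"
  shows "integrable \<mu> (ev p)" "riesz n \<beta> p = integral\<^sup>L \<mu> (ev p)"
proof -
  have m: "integrable \<mu> (ev (monomial z))" "\<beta> (fst z) (snd z) = integral\<^sup>L \<mu> (ev (monomial z))"
    if "z \<in> set (monomials (2 * n))" for z
    using r that unfolding representing_measure_def ev_monomial by (auto simp: set_monomials)
  show "integrable \<mu> (ev p)"
    unfolding ev_expand[OF p] using m by auto
  show "riesz n \<beta> p = integral\<^sup>L \<mu> (ev p)"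
    unfolding ev_expand[OF p] riesz_def using m by (subst Bochner_Integration.integral_sum) auto
qed

lemma polys_upto_mult:
  "p \<in> polys_upto k \<Longrightarrow> q \<in> polys_upto m \<Longrightarrow> k + m \<le> l \<Longrightarrow> p * q \<in> polys_upto l"
  unfolding polys_upto_eq by (rule polys_below_mult) auto

text \<open>The functional takes \<open>p * p\<close> to the integral of the square of
  \<open>p\<close>, so column relations are exactly the polynomials that vanish almost everywhere;
  recursive generation and the relation \<open>P\<close> are immediate from this. For the rank
  bound, the measure is concentrated on the finite variety and hence atomic.\<close>

lemma representing_measure_imp:
  assumes r: "representing_measure n \<beta> \<mu>" and supp: "measure_support \<mu> \<subseteq> zero_set P"
    and P: "P \<in> polys_upto n"
  shows "positive_semidefinite (moment_matrix n \<beta>)" "recursively_generated n \<beta>"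
    "column_relation n \<beta> P"
    "finite (moment_variety n \<beta>) \<Longrightarrow> moment_rank n \<beta> \<le> card (moment_variety n \<beta>)"
proof -
  have sets: "sets \<mu> = sets borel" using r by (simp add: representing_measure_def)
  have prod: "p * q \<in> polys_upto (2 * n)" if "p \<in> polys_upto n" "q \<in> polys_upto n" for p q
    using that by (rule polys_upto_mult) simp
  have meas [measurable]: "ev p \<in> borel_measurable \<mu>" for p
    using borel_measurable_ev measurable_cong_sets[OF sets refl] by blast
  show "positive_semidefinite (moment_matrix n \<beta>)"
    unfolding positive_semidefinite_iff
  proof
    fix p assume p: "p \<in> polys_upto n"
    have "ev (p * p) = (\<lambda>z. ev p z * ev p z)" by (rule ext) simp
    then show "riesz n \<beta> (p * p) \<ge> 0"
      unfolding representing_measure_integral(2)[OF r prod[OF p p]] by (simp add: integral_nonneg_AE)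
  qed
  have null: "column_relation n \<beta> p \<longleftrightarrow> (AE z in \<mu>. ev p z = 0)" if p: "p \<in> polys_upto n" for p
  proof
    assume "column_relation n \<beta> p"
    then have "riesz n \<beta> (p * p) = 0" using p column_relation_iff[OF p] by blast
    then have "integral\<^sup>L \<mu> (ev (p * p)) = 0"
      unfolding representing_measure_integral(2)[OF r prod[OF p p]] .
    then have "AE z in \<mu>. ev (p * p) z = 0"
      using representing_measure_integral(1)[OF r prod[OF p p]]
      by (subst (asm) integral_nonneg_eq_0_iff_AE) auto
    then show "AE z in \<mu>. ev p z = 0" by simp
  next
    assume z: "AE z in \<mu>. ev p z = 0"
    have "riesz n \<beta> (p * q) = 0" if q: "q \<in> polys_upto n" for q
    proof -
      have "AE z in \<mu>. ev (p * q) z = 0" using z by eventually_elim simp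
      then show ?thesis
        unfolding representing_measure_integral(2)[OF r prod[OF p q]] by (rule integral_eq_zero_AE)
    qed
    then show "column_relation n \<beta> p" by (simp add: column_relation_iff[OF p])
  qed
  show "recursively_generated n \<beta>"
    unfolding recursively_generated_def
  proof (intro allI impI, elim conjE)
    fix p q assume pq: "p \<in> polys_upto n" "p * q \<in> polys_upto n" "column_relation n \<beta> p"
    then have "AE z in \<mu>. ev p z = 0" by (simp add: null)
    then have "AE z in \<mu>. ev (p * q) z = 0" by eventually_elim simp
    then show "column_relation n \<beta> (p * q)" using pq by (simp add: null)
  qed
  have "AE z in \<mu>. ev P z = 0"
    using AE_measure_support[OF sets] by eventually_elim (use supp in \<open>auto simp: zero_set_eq\<close>)
  then show "column_relation n \<beta> P" by (simp add: null[OF P])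
  let ?V = "moment_variety n \<beta>"
  assume fin: "finite ?V"
  \<comment> \<open>The set where a relation is nonzero is open and null, so it misses the
    support.\<close>
  have "measure_support \<mu> \<subseteq> ?V"
  proof (rule subsetI, rule ccontr)
    fix z assume z: "z \<in> measure_support \<mu>" "z \<notin> ?V"
    then obtain p where p: "p \<in> polys_upto n" "column_relation n \<beta> p" "ev p z \<noteq> 0"
      by (auto simp: moment_variety_def zero_set_eq)
    let ?U = "{z. ev p z \<noteq> 0}"
    have "open ?U" by (intro open_Collect_neq continuous_intros)
    then have "emeasure \<mu> ?U > 0" using z(1) p(3) by (auto simp: measure_support_def)
    moreover have "AE z in \<mu>. ev p z = 0" using p by (simp add: null)
    then have "emeasure \<mu> {z \<in> space \<mu>. ev p z \<noteq> 0} = 0" by (subst (asm) AE_iff_measurable[OF _ refl]) auto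
    moreover have "space \<mu> = UNIV" using sets_eq_imp_space_eq[OF sets] by simp
    ultimately show False by simp
  qed
  then have AEV: "AE z in \<mu>. z \<in> ?V"
    using AE_measure_support[OF sets] by (auto elim: eventually_mono)
  have "1 \<in> polys_upto (2 * n)" by (simp add: polys_upto_eq)
  then have "integrable \<mu> (\<lambda>z. 1 :: real)"
    using representing_measure_integral(1)[OF r, of 1] by (simp add: ev_1)
  then have fm: "finite_measure \<mu>"
    by (auto intro!: finite_measureI simp: integrable_iff_bounded)
  have sing: "{a} \<in> sets \<mu>" for a :: "real \<times> real" using sets by simp
  have "riesz n \<beta> f = (\<Sum>z\<in>?V. measure \<mu> {z} * ev f z)" if f: "f \<in> polys_upto (2 * n)" for f
  proof -
    have "riesz n \<beta> f = integral\<^sup>L \<mu> (ev f)" by (rule representing_measure_integral(2)[OF r f])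
    also have "\<dots> = (\<integral>z. ev f z * indicator ?V z \<partial>\<mu>)"
    proof (rule integral_cong_AE)
      show "AE z in \<mu>. ev f z = ev f z * indicator ?V z"
        using AEV by eventually_elim simp
      have "?V \<in> sets \<mu>" using fin sets by (simp add: finite_imp_closed)
      then show "(\<lambda>z. ev f z * indicator ?V z) \<in> borel_measurable \<mu>" by measurable
    qed (rule meas)
    also have "\<dots> = (\<Sum>z\<in>?V. ev f z * measure \<mu> {z})"
      using fin sing finite_measure.emeasure_finite[OF fm]
      by (intro integral_indicator_finite_real) (auto simp: less_top)
    finally show ?thesis by (simp add: mult.commute)
  qed
  then show "moment_rank n \<beta> \<le> card ?V" by (rule moment_rank_atomic_le[OF fin])
qed

lemma atomic_representing_measure:
  assumes xs: "\<forall>(w, z)\<in>set xs. w \<ge> 0 \<and> z \<in> V"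
    and L: "\<And>f. f \<in> polys_upto (2 * n) \<Longrightarrow> riesz n \<beta> f = (\<Sum>(w, z)\<leftarrow>xs. w * ev f z)"
  shows "\<exists>\<mu>. representing_measure n \<beta> \<mu> \<and> measure_support \<mu> \<subseteq> V"
proof -
  \<comment> \<open>The weights sit on the indices of the list and are pushed forward to the plane,
    so repeated points need no merging.\<close>
  let ?I = "{..<length xs}"
  let ?pm = "point_measure ?I (\<lambda>j. ennreal (fst (xs ! j)))"
  let ?g = "\<lambda>j. snd (xs ! j)"
  define \<mu> where "\<mu> = distr ?pm borel ?g"
  have g: "?g \<in> measurable ?pm borel" by simp
  have w: "fst (xs ! j) \<ge> 0" "snd (xs ! j) \<in> V" if "j < length xs" for j
    using xs nth_mem[OF that] by (auto simp: case_prod_beta)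
  have int: "integrable \<mu> (ev f)" "integral\<^sup>L \<mu> (ev f) = (\<Sum>(w, z)\<leftarrow>xs. w * ev f z)" for f
  proof -
    show "integrable \<mu> (ev f)"
      unfolding \<mu>_def by (subst integrable_distr_eq[OF g]) (auto intro: integrable_point_measure_finite)
    have "integral\<^sup>L \<mu> (ev f) = integral\<^sup>L ?pm (\<lambda>j. ev f (?g j))"
      unfolding \<mu>_def by (rule integral_distr[OF g]) simp
    also have "\<dots> = (\<Sum>j\<in>?I. fst (xs ! j) * ev f (?g j))"
      using w by (subst lebesgue_integral_point_measure_finite) auto
    also have "\<dots> = (\<Sum>(w, z)\<leftarrow>xs. w * ev f z)"
      by (simp add: sum_list_sum_nth atLeast0LessThan case_prod_beta)
    finally show "integral\<^sup>L \<mu> (ev f) = (\<Sum>(w, z)\<leftarrow>xs. w * ev f z)" .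
  qed
  have "representing_measure n \<beta> \<mu>"
    unfolding representing_measure_def
  proof (intro conjI allI impI)
    show "sets \<mu> = sets borel" by (simp add: \<mu>_def)
    fix i j assume ij: "i + j \<le> 2 * n"
    show "integrable \<mu> (\<lambda>(x, y). y ^ i * x ^ j)"
      using int(1)[of "monomial (i, j)"] by (simp add: ev_monomial)
    have "\<beta> i j = riesz n \<beta> (monomial (i, j))" using ij by (simp add: riesz_monomial)
    also have "\<dots> = integral\<^sup>L \<mu> (ev (monomial (i, j)))"
      using ij by (simp add: int L monomial_in_polys_upto)
    finally show "\<beta> i j = (LINT (x, y)|\<mu>. y ^ i * x ^ j)" by (simp add: ev_monomial)
  qed
  moreover have "measure_support \<mu> \<subseteq> V"
  proof (rule subsetI, rule ccontr)
    fix z assume z: "z \<in> measure_support \<mu>" "z \<notin> V"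
    let ?U = "- (?g ` ?I)"
    have "open ?U" by (simp add: finite_imp_closed open_Compl)
    moreover have "z \<in> ?U" using z(2) w by auto
    ultimately have "emeasure \<mu> ?U > 0" using z(1) unfolding measure_support_def by blast
    moreover have "emeasure \<mu> ?U = emeasure ?pm (?g -` ?U \<inter> ?I)"
      unfolding \<mu>_def using \<open>open ?U\<close> by (subst emeasure_distr[OF g]) (auto simp: space_point_measure)
    moreover have "?g -` ?U \<inter> ?I = {}" unfolding vimage_def by blast
    ultimately show False by simp
  qed
  ultimately show ?thesis by blast
qed

section \<open>Positive functionals and their varieties\<close>

text \<open>\<open>N\<close> is the kernel of the moment matrix and \<open>V\<close> its variety.
  The rank condition enters as \<open>vanishing_in_N\<close>: once a finite \<open>V\<close> has a
  dual family of degree at most \<open>n\<close>, the kernel contains every polynomial of that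
  degree that vanishes on \<open>V\<close>.\<close>

locale moment_functional =
  fixes n :: nat and L :: "bipoly \<Rightarrow> real" and N :: "bipoly set" and V :: "(real \<times> real) set"
  assumes linear: "linear_functional L"
    and psd: "p \<in> polys_upto n \<Longrightarrow> L (p * p) \<ge> 0"
    and N_def: "N = {p \<in> polys_upto n. \<forall>q\<in>polys_upto n. L (p * q) = 0}"
    and V_def: "V = {z. \<forall>p\<in>N. ev p z = 0}"
    and recursive: "\<And>p q. p \<in> N \<Longrightarrow> q \<in> polys_upto n \<Longrightarrow> p * q \<in> polys_upto n \<Longrightarrow> p * q \<in> N"
    and vanishing_in_N: "\<And>l g. finite V \<Longrightarrow> \<forall>v\<in>V. l v \<in> polys_upto n \<Longrightarrow>
      \<forall>u\<in>V. \<forall>v\<in>V. ev (l v) u = (if u = v then 1 else 0) \<Longrightarrow>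
      g \<in> polys_upto n \<Longrightarrow> \<forall>v\<in>V. ev g v = 0 \<Longrightarrow> g \<in> N"
begin

lemmas L_simps = linear_functionalD[OF linear]

lemma N_D: "p \<in> N \<Longrightarrow> p \<in> polys_upto n" "p \<in> N \<Longrightarrow> q \<in> polys_upto n \<Longrightarrow> L (p * q) = 0"
  "p \<in> N \<Longrightarrow> z \<in> V \<Longrightarrow> ev p z = 0"
  by (auto simp: N_def V_def)

lemma prod_in: "p \<in> polys_upto n \<Longrightarrow> q \<in> polys_upto n \<Longrightarrow> p * q \<in> polys_upto (2 * n)"
  by (rule polys_upto_mult) auto

lemma in_double: "p \<in> polys_upto n \<Longrightarrow> p \<in> polys_upto (2 * n)"
  by (simp add: polys_upto_def)

lemma null_square_in_N:
  assumes p: "p \<in> polys_upto n" and 0: "L (p * p) = 0"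
  shows "p \<in> N"
proof -
  have "L (p * q) = 0" if q: "q \<in> polys_upto n" for q
  proof (rule ccontr)
    assume nz: "L (p * q) \<noteq> 0"
    \<comment> \<open>Chosen such that \<open>L\<close> takes the value -1 on the square of
      \<open>q + cst c * p\<close>.\<close>
    define c where "c = - (L (q * q) + 1) / (2 * L (p * q))"
    have "q + cst c * p \<in> polys_upto n" using p q by (auto simp: polys_upto_eq)
    then have "L ((q + cst c * p) * (q + cst c * p)) \<ge> 0" by (rule psd)
    also have "(q + cst c * p) * (q + cst c * p)
        = q * q + (cst (2 * c) * (p * q) + cst (c * c) * (p * p))"
      by (rule ev_ext, simp only: ev_simps) (simp add: algebra_simps)
    finally have "L (q * q) + 2 * c * L (p * q) \<ge> 0" by (simp add: L_simps 0)
    moreover have "2 * c * L (p * q) = - (L (q * q) + 1)" using nz by (simp add: c_def)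
    ultimately show False by simp
  qed
  then show ?thesis using p by (simp add: N_def)
qed

text \<open>The two clauses serve different ends: the first gives \<open>L f \<ge> 0\<close>, the
  second shows that \<open>f\<close> vanishes on \<open>V\<close> once \<open>L f = 0\<close>.
  Neither asserts that \<open>f\<close> is a sum of squares as a polynomial.\<close>

definition sos_on_variety :: bool where
  "sos_on_variety \<longleftrightarrow> (\<forall>f\<in>polys_upto (2 * n). (\<forall>z\<in>V. ev f z \<ge> 0) \<longrightarrow>
    (\<exists>gs. set gs \<subseteq> polys_upto n \<and> L f = (\<Sum>g\<leftarrow>gs. L (g * g)) \<and>
      (\<forall>z\<in>V. ev f z = (\<Sum>g\<leftarrow>gs. ev g z ^ 2))))"

lemma sos_on_varietyI:
  assumes "\<And>f. f \<in> polys_upto (2 * n) \<Longrightarrow> (\<And>z. z \<in> V \<Longrightarrow> ev f z \<ge> 0) \<Longrightarrow>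
    \<exists>gs. set gs \<subseteq> polys_upto n \<and> L (f - (\<Sum>g\<leftarrow>gs. g * g)) = 0 \<and>
      (\<forall>z\<in>V. ev (f - (\<Sum>g\<leftarrow>gs. g * g)) z = 0)"
  shows sos_on_variety
  unfolding sos_on_variety_def
proof (intro ballI impI)
  fix f assume "f \<in> polys_upto (2 * n)" "\<forall>z\<in>V. ev f z \<ge> 0"
  then obtain gs where gs: "set gs \<subseteq> polys_upto n" "L (f - (\<Sum>g\<leftarrow>gs. g * g)) = 0"
    "\<forall>z\<in>V. ev (f - (\<Sum>g\<leftarrow>gs. g * g)) z = 0" using assms[of f] by blast
  have "L (\<Sum>g\<leftarrow>gs. g * g) = (\<Sum>g\<leftarrow>gs. L (g * g))" by (induction gs) (simp_all add: L_simps)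
  moreover have "ev (\<Sum>g\<leftarrow>gs. g * g) z = (\<Sum>g\<leftarrow>gs. ev g z ^ 2)" for z
    by (induction gs) (simp_all add: power2_eq_square)
  ultimately show "\<exists>gs. set gs \<subseteq> polys_upto n \<and> L f = (\<Sum>g\<leftarrow>gs. L (g * g)) \<and>
      (\<forall>z\<in>V. ev f z = (\<Sum>g\<leftarrow>gs. ev g z ^ 2))"
    using gs by (intro exI[of _ gs]) (auto simp: L_simps)
qed

text \<open>If \<open>L f = 0\<close>, every summand \<open>L (g * g)\<close> is zero, so each
  \<open>g\<close> lies in the kernel and vanishes on \<open>V\<close>; this is the strictness that
  \<open>atomic_representation\<close> demands.\<close>

lemma sos_on_variety_imp_atomic:
  assumes sos_on_variety
  shows "\<exists>xs. (\<forall>(w, z)\<in>set xs. w \<ge> 0 \<and> z \<in> V) \<and>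
    (\<forall>f\<in>polys_upto (2 * n). L f = (\<Sum>(w, z)\<leftarrow>xs. w * ev f z))"
proof (rule atomic_representation[OF linear])
  fix f assume "f \<in> polys_upto (2 * n)" "\<And>z. z \<in> V \<Longrightarrow> ev f z \<ge> 0"
  then obtain gs where gs: "set gs \<subseteq> polys_upto n" "L f = (\<Sum>g\<leftarrow>gs. L (g * g))"
    "\<forall>z\<in>V. ev f z = (\<Sum>g\<leftarrow>gs. ev g z ^ 2)"
    using assms unfolding sos_on_variety_def by blast
  have nn: "x \<ge> 0" if "x \<in> set (map (\<lambda>g. L (g * g)) gs)" for x
    using that gs(1) psd by auto
  have "L f \<ge> 0" unfolding gs(2) by (rule sum_list_nonneg) (rule nn)
  moreover have "ev f z = 0" if "L f = 0" "z \<in> V" for z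
  proof -
    have "\<forall>x\<in>set (map (\<lambda>g. L (g * g)) gs). x = 0"
      using that(1) unfolding gs(2) by (subst (asm) sum_list_nonneg_eq_0_iff[OF nn])
    then have "ev g z = 0" if "g \<in> set gs" for g
      using that gs(1) \<open>z \<in> V\<close> by (auto intro!: N_D(3) null_square_in_N)
    then have "map (\<lambda>g. ev g z ^ 2) gs = map (\<lambda>g. 0) gs" by simp
    then have "(\<Sum>g\<leftarrow>gs. ev g z ^ 2) = (\<Sum>g\<leftarrow>gs. 0)" by (rule arg_cong)
    then show ?thesis using gs(3) that(2) by simp
  qed
  ultimately show "L f \<ge> 0 \<and> (L f = 0 \<longrightarrow> (\<forall>z\<in>V. ev f z = 0))" by blast
qed

text \<open>A single square of an interpolating polynomial matches \<open>f\<close> on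
  \<open>V\<close>, which leaves \<open>van\<close> as the real task in the finite case.\<close>

lemma sos_on_finite_variety:
  assumes fin: "finite V"
    and l: "\<And>v. v \<in> V \<Longrightarrow> l v \<in> polys_upto n"
      "\<And>u v. u \<in> V \<Longrightarrow> v \<in> V \<Longrightarrow> ev (l v) u = (if u = v then 1 else 0)"
    and van: "\<And>f. f \<in> polys_upto (2 * n) \<Longrightarrow> (\<And>v. v \<in> V \<Longrightarrow> ev f v = 0) \<Longrightarrow> L f = 0"
  shows sos_on_variety
proof (rule sos_on_varietyI)
  fix f assume f: "f \<in> polys_upto (2 * n)" "\<And>z. z \<in> V \<Longrightarrow> ev f z \<ge> 0"
  define g where "g = (\<Sum>v\<in>V. cst (sqrt (ev f v)) * l v)"
  have g: "g \<in> polys_upto n" using l(1) unfolding g_def polys_upto_eq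
    by (intro polys_below_sum polys_below_cmult)
  have "ev g u = sqrt (ev f u)" if "u \<in> V" for u
  proof -
    have "ev g u = (\<Sum>v\<in>V. if u = v then sqrt (ev f v) else 0)"
      unfolding g_def ev_simps using that by (intro sum.cong) (auto simp: l(2))
    then show ?thesis using that fin by simp
  qed
  then have 0: "ev (f - g * g) u = 0" if "u \<in> V" for u using that f(2) by simp
  moreover have "f - g * g \<in> polys_upto (2 * n)" using f(1) prod_in[OF g g] by (auto simp: polys_upto_eq)
  ultimately have "L (f - g * g) = 0" using van by blast
  then show "\<exists>gs. set gs \<subseteq> polys_upto n \<and> L (f - (\<Sum>g\<leftarrow>gs. g * g)) = 0 \<and>
      (\<forall>z\<in>V. ev (f - (\<Sum>g\<leftarrow>gs. g * g)) z = 0)"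
    using g 0 by (intro exI[of _ "[g]"]) auto
qed

text \<open>
  Lines (\<open>m = n\<close>) and smooth conics (\<open>m = 2 n\<close>) are covered simultaneously: \<open>t\<close> is a rational
  parameter on the curve \<open>Z\<close> and \<open>a\<close> the denominator, whose zeros on \<open>Z\<close> are the points with \<open>t = \<infinity>\<close>.
\<close>

lemma sos_on_rational_curve:
  fixes a t :: "real \<times> real \<Rightarrow> real"
  assumes Z0: "Z0 = {z \<in> Z. a z \<noteq> 0}" and VZ: "V \<subseteq> Z" and Vfin: "finite V \<Longrightarrow> V \<subseteq> Z0"
    and poly_n: "\<And>p. p \<in> polys_upto n \<Longrightarrow> \<exists>g. degree g \<le> m \<and> (\<forall>z\<in>Z0. ev p z = a z ^ n * poly g (t z))"
    and poly_2n: "\<And>p. p \<in> polys_upto (2 * n) \<Longrightarrow>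
      \<exists>g. degree g \<le> 2 * m \<and> (\<forall>z\<in>Z0. ev p z = a z ^ (2 * n) * poly g (t z))"
    and lift: "\<And>g. degree g \<le> m \<Longrightarrow> \<exists>p\<in>polys_upto n. \<forall>z\<in>Z0. ev p z = a z ^ n * poly g (t z)"
    and ideal: "\<And>p. p \<in> polys_upto (2 * n) \<Longrightarrow> (\<And>z. z \<in> Z0 \<Longrightarrow> ev p z = 0) \<Longrightarrow> L p = 0 \<and> (\<forall>z\<in>Z. ev p z = 0)"
    and inj: "inj_on t Z0" and cofin: "finite (- t ` Z0)" and Zfin: "finite (Z - Z0)"
  shows sos_on_variety
proof -
  have nz: "a z \<noteq> 0" "z \<in> Z" if "z \<in> Z0" for z using that Z0 by auto
  have a2: "a z ^ (2 * n) = a z ^ n * a z ^ n" for z by (simp add: mult_2 power_add)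
  have inf: "infinite (t ` Z0)"
    using cofin infinite_UNIV_char_0[where 'a = real] by (metis Compl_partition finite_Un)
  \<comment> \<open>An infinite \<open>V\<close> has infinitely many parameters, so the univariate
    form of a kernel element is zero; hence \<open>V\<close> is all of \<open>Z\<close>.\<close>
  have N_Z: "\<forall>z\<in>Z. ev p z = 0" if p: "p \<in> N" and "infinite V" for p
  proof -
    obtain g where g: "\<forall>z\<in>Z0. ev p z = a z ^ n * poly g (t z)" using poly_n N_D(1)[OF p] by blast
    have "V - Z0 \<subseteq> Z - Z0" using VZ by auto
    then have "finite (V - Z0)" using Zfin by (rule finite_subset)
    moreover have "V \<subseteq> (V \<inter> Z0) \<union> (V - Z0)" by auto
    ultimately have "infinite (V \<inter> Z0)" using \<open>infinite V\<close> by (metis finite_Un finite_subset)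
    then have "infinite (t ` (V \<inter> Z0))"
      using inj by (metis finite_imageD inj_on_Int)
    moreover have "poly g x = 0" if "x \<in> t ` (V \<inter> Z0)" for x
    proof -
      from that obtain z where z: "z \<in> V" "z \<in> Z0" "x = t z" by auto
      then have "a z ^ n * poly g (t z) = 0" using g N_D(3)[OF p, of z] by simp
      then show ?thesis using nz[OF z(2)] z(3) by simp
    qed
    ultimately have "g = 0" using poly_roots_finite[of g] by (metis (mono_tags) finite_subset mem_Collect_eq subsetI)
    then show ?thesis using g ideal[OF in_double[OF N_D(1)[OF p]]] by simp
  qed
  show ?thesis
  proof (cases "finite V")
    case False
    have VeqZ: "V = Z" using N_Z[OF _ False] VZ V_def by auto
    show ?thesis
    proof (rule sos_on_varietyI)
      fix f assume f: "f \<in> polys_upto (2 * n)" "\<And>z. z \<in> V \<Longrightarrow> ev f z \<ge> 0"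
      obtain g where g: "degree g \<le> 2 * m" "\<forall>z\<in>Z0. ev f z = a z ^ (2 * n) * poly g (t z)"
        using poly_2n[OF f(1)] by blast
      have "poly g x \<ge> 0" for x
      proof (rule poly_nonneg_cofinite[OF cofin])
        fix x assume "x \<notin> - t ` Z0"
        then obtain z where z: "z \<in> Z0" "x = t z" by auto
        \<comment> \<open>The exponent is even, so dividing by the power of the denominator keeps
          the sign.\<close>
        then have "a z ^ (2 * n) > 0" using nz(1)[OF z(1)] by (simp add: zero_less_power_eq)
        moreover have "a z ^ (2 * n) * poly g x \<ge> 0" using f(2)[of z] g(2) z VeqZ nz(2)[OF z(1)] by simp
        ultimately show "poly g x \<ge> 0" by (simp add: zero_le_mult_iff)
      qed
      then obtain g1 g2 where g12: "g = g1^2 + g2^2" "2 * degree g1 \<le> degree g" "2 * degree g2 \<le> degree g"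
        using nonneg_poly_two_squares by blast
      obtain p1 where p1: "p1 \<in> polys_upto n" "\<forall>z\<in>Z0. ev p1 z = a z ^ n * poly g1 (t z)"
        using lift[of g1] g12 g(1) by fastforce
      obtain p2 where p2: "p2 \<in> polys_upto n" "\<forall>z\<in>Z0. ev p2 z = a z ^ n * poly g2 (t z)"
        using lift[of g2] g12 g(1) by fastforce
      let ?r = "f - (\<Sum>g\<leftarrow>[p1, p2]. g * g)"
      have "?r \<in> polys_upto (2 * n)"
        using f(1) prod_in[OF p1(1) p1(1)] prod_in[OF p2(1) p2(1)] by (auto simp: polys_upto_eq)
      moreover have "ev ?r z = 0" if "z \<in> Z0" for z
        using bspec[OF g(2) that, unfolded a2] bspec[OF p1(2) that] bspec[OF p2(2) that]
        by (simp add: g12(1) power2_eq_square algebra_simps)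
      ultimately have "L ?r = 0 \<and> (\<forall>z\<in>Z. ev ?r z = 0)" by (rule ideal)
      then show "\<exists>gs. set gs \<subseteq> polys_upto n \<and> L (f - (\<Sum>g\<leftarrow>gs. g * g)) = 0 \<and>
        (\<forall>z\<in>V. ev (f - (\<Sum>g\<leftarrow>gs. g * g)) z = 0)"
        using p1 p2 VeqZ by (intro exI[of _ "[p1, p2]"]) auto
    qed
  next
    case fin: True
    have VZ0: "V \<subseteq> Z0" by (rule Vfin[OF fin])
    let ?S = "t ` V"
    define R where "R = root_poly ?S"
    have S: "finite ?S" "card ?S = card V" using fin card_image[OF inj_on_subset[OF inj VZ0]] by auto
    \<comment> \<open>\<open>V\<close> is finite and \<open>Z0\<close> is not, so some kernel
      element survives on the curve. Its univariate form has degree at most \<open>m\<close> and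
      vanishes at the parameters of \<open>V\<close>, which bounds \<open>card V\<close> by
      \<open>m\<close>.\<close>
    have "\<exists>p\<in>N. \<exists>z\<in>Z0. ev p z \<noteq> 0"
    proof (rule ccontr)
      assume "\<not> ?thesis"
      then have "Z0 \<subseteq> V" using V_def by auto
      then show False using fin inf by (meson finite_imageI finite_subset)
    qed
    then obtain p z where p: "p \<in> N" "z \<in> Z0" "ev p z \<noteq> 0" by blast
    obtain g where g: "degree g \<le> m" "\<forall>z\<in>Z0. ev p z = a z ^ n * poly g (t z)"
      using poly_n N_D(1)[OF p(1)] by blast
    have g0: "g \<noteq> 0" using bspec[OF g(2) p(2)] p(3) by (metis mult_zero_right poly_0)
    have "poly g x = 0" if x: "x \<in> ?S" for x
    proof -
      from x obtain z where z: "z \<in> V" "x = t z" by auto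
      then have z0: "z \<in> Z0" using VZ0 by blast
      then have "a z ^ n * poly g (t z) = 0" using g(2) z N_D(3)[OF p(1), of z] by simp
      then show ?thesis using nz[OF z0] z(2) by simp
    qed
    then have "R dvd g" unfolding R_def using S(1) by (intro root_poly_dvd)
    then have card_le: "card V \<le> m" using dvd_imp_degree_le[OF _ g0] g(1) S(2) by (fastforce simp: R_def)
    have "\<exists>l\<in>polys_upto n. \<forall>u\<in>V. ev l u = (if u = v then 1 else 0)" if v: "v \<in> V" for v
    proof -
      have "card ?S \<le> Suc m" using S card_le by simp
      then obtain h where h: "degree h \<le> m" "\<forall>r\<in>?S. poly h r = (if r = t v then 1 / a v ^ n else 0)"
        using poly_interpolation[OF S(1), of m "\<lambda>r. if r = t v then 1 / a v ^ n else 0"] by blast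
      obtain l where l: "l \<in> polys_upto n" "\<forall>z\<in>Z0. ev l z = a z ^ n * poly h (t z)"
        using lift[OF h(1)] by blast
      have "ev l u = (if u = v then 1 else 0)" if u: "u \<in> V" for u
      proof -
        have "t u = t v \<longleftrightarrow> u = v" using inj u v VZ0 by (auto simp: inj_on_def)
        moreover have "a v \<noteq> 0" using v VZ0 nz by blast
        moreover have "ev l u = a u ^ n * poly h (t u)" using l(2) u VZ0 by blast
        moreover have "poly h (t u) = (if t u = t v then 1 / a v ^ n else 0)" using h(2) u by blast
        ultimately show ?thesis by simp
      qed
      then show ?thesis using l(1) by blast
    qed
    then obtain l where l: "\<And>v. v \<in> V \<Longrightarrow> l v \<in> polys_upto n"
      "\<And>u v. u \<in> V \<Longrightarrow> v \<in> V \<Longrightarrow> ev (l v) u = (if u = v then 1 else 0)" by metis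
    have inN: "p \<in> N" if "p \<in> polys_upto n" "\<And>v. v \<in> V \<Longrightarrow> ev p v = 0" for p
      using vanishing_in_N[OF fin, of l p] l that by auto
    \<comment> \<open>Vanishing on \<open>V\<close> now implies membership in \<open>N\<close>, so
      every multiple of \<open>R\<close> of degree at most \<open>m\<close> comes from the
      kernel.\<close>
    have liftN: "\<exists>p\<in>N. \<forall>z\<in>Z0. ev p z = a z ^ n * poly (R * h) (t z)" if h: "degree h \<le> m - card V" for h
    proof -
      have "degree (R * h) \<le> m"
        using degree_mult_le[of R h] h card_le S(2) by (simp add: R_def)
      then obtain p where p: "p \<in> polys_upto n" "\<forall>z\<in>Z0. ev p z = a z ^ n * poly (R * h) (t z)"
        using lift by blast
      have "ev p v = 0" if "v \<in> V" for v
        using bspec[OF p(2), of v] that VZ0 S(1) by (auto simp: R_def)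
      then show ?thesis using inN p by blast
    qed
    show ?thesis
    proof (rule sos_on_finite_variety[OF fin l])
      fix f assume f: "f \<in> polys_upto (2 * n)" "\<And>v. v \<in> V \<Longrightarrow> ev f v = 0"
      obtain g where g: "degree g \<le> 2 * m" "\<forall>z\<in>Z0. ev f z = a z ^ (2 * n) * poly g (t z)"
        using poly_2n[OF f(1)] by blast
      have "poly g x = 0" if x: "x \<in> ?S" for x
      proof -
        from x obtain z where z: "z \<in> V" "x = t z" by auto
        then have z0: "z \<in> Z0" using VZ0 by blast
        then have "a z ^ (2 * n) * poly g (t z) = 0" using g(2) f(2)[OF z(1)] by simp
        then show ?thesis using nz[OF z0] z(2) by simp
      qed
      then have "R dvd g" unfolding R_def using S(1) by (intro root_poly_dvd)
      then obtain q where q: "g = R * q" by (auto elim: dvdE)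
      \<comment> \<open>The cofactor is cut at degree \<open>m\<close>: one product pairs
        \<open>R\<close> with \<open>lo\<close>, the other \<open>R * hi\<close> with the
        \<open>m\<close>-th power, and in both the first factor comes from the kernel and the second
        has degree at most \<open>m\<close>.\<close>
      have "degree q \<le> m + (m - card V)"
      proof (cases "q = 0")
        case False
        then have "degree g = card V + degree q" unfolding q using S(2) by (subst degree_mult_eq) (auto simp: R_def)
        then show ?thesis using g(1) card_le by simp
      qed simp
      then obtain lo hi where q': "q = lo + Polynomial.monom 1 m * hi" "degree lo \<le> m" "degree hi \<le> m - card V"
        by (rule poly_split_at)
      obtain p1 where p1: "p1 \<in> N" "\<forall>z\<in>Z0. ev p1 z = a z ^ n * poly (R * 1) (t z)" using liftN[of 1] by auto
      obtain p2 where p2: "p2 \<in> polys_upto n" "\<forall>z\<in>Z0. ev p2 z = a z ^ n * poly lo (t z)" using lift[OF q'(2)] by blast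
      obtain p3 where p3: "p3 \<in> N" "\<forall>z\<in>Z0. ev p3 z = a z ^ n * poly (R * hi) (t z)" using liftN[OF q'(3)] by blast
      obtain p4 where p4: "p4 \<in> polys_upto n" "\<forall>z\<in>Z0. ev p4 z = a z ^ n * poly (Polynomial.monom 1 m) (t z)"
        using lift[of "Polynomial.monom 1 m"] by (auto simp: degree_monom_eq)
      have "f - (p1 * p2 + p3 * p4) \<in> polys_upto (2 * n)"
        using f(1) prod_in[OF N_D(1)[OF p1(1)] p2(1)] prod_in[OF N_D(1)[OF p3(1)] p4(1)]
        by (auto simp: polys_upto_eq)
      moreover have "ev (f - (p1 * p2 + p3 * p4)) z = 0" if "z \<in> Z0" for z
        using bspec[OF g(2) that, unfolded a2] bspec[OF p1(2) that] bspec[OF p2(2) that]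
          bspec[OF p3(2) that] bspec[OF p4(2) that]
        by (simp add: q q'(1) algebra_simps)
      ultimately have "L (f - (p1 * p2 + p3 * p4)) = 0" using ideal by blast
      then show "L f = 0" using N_D(2) p1(1) p2(1) p3(1) p4(1) by (simp add: L_simps)
    qed
  qed
qed

end

section \<open>Affine frames, lines and smooth conics\<close>

definition aff :: "real \<Rightarrow> real \<Rightarrow> real \<Rightarrow> bipoly" where
  "aff a b c = cst a + cst b * vx + cst c * vy"

lemma ev_aff [simp]: "ev (aff a b c) z = a + b * fst z + c * snd z"
  by (simp add: aff_def)

lemma aff_in: "aff a b c \<in> polys_below 2"
  unfolding aff_def numeral_2_eq_2 by auto

text \<open>Cramer's rule. The last three equations say that the same coefficients also invert the
  system from the other side, which yields points with prescribed values of the forms up to a common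
  factor.\<close>

lemma aff_frame:
  fixes p0 p1 p2 q0 q1 q2 r0 r1 r2 :: real
  defines "D \<equiv> p0 * (q1 * r2 - q2 * r1) - p1 * (q0 * r2 - q2 * r0) + p2 * (q0 * r1 - q1 * r0)"
  assumes "D \<noteq> 0"
  obtains a0 b0 c0 a1 b1 c1 a2 b2 c2 where
    "1 = cst a0 * aff p0 p1 p2 + cst b0 * aff q0 q1 q2 + cst c0 * aff r0 r1 r2"
    "vx = cst a1 * aff p0 p1 p2 + cst b1 * aff q0 q1 q2 + cst c1 * aff r0 r1 r2"
    "vy = cst a2 * aff p0 p1 p2 + cst b2 * aff q0 q1 q2 + cst c2 * aff r0 r1 r2"
    "\<And>\<alpha> \<beta> \<gamma>. p0 * (a0 * \<alpha> + b0 * \<beta> + c0 * \<gamma>) + p1 * (a1 * \<alpha> + b1 * \<beta> + c1 * \<gamma>) + p2 * (a2 * \<alpha> + b2 * \<beta> + c2 * \<gamma>) = \<alpha>"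
    "\<And>\<alpha> \<beta> \<gamma>. q0 * (a0 * \<alpha> + b0 * \<beta> + c0 * \<gamma>) + q1 * (a1 * \<alpha> + b1 * \<beta> + c1 * \<gamma>) + q2 * (a2 * \<alpha> + b2 * \<beta> + c2 * \<gamma>) = \<beta>"
    "\<And>\<alpha> \<beta> \<gamma>. r0 * (a0 * \<alpha> + b0 * \<beta> + c0 * \<gamma>) + r1 * (a1 * \<alpha> + b1 * \<beta> + c1 * \<gamma>) + r2 * (a2 * \<alpha> + b2 * \<beta> + c2 * \<gamma>) = \<gamma>"
proof -
  define E where "E = 1 / D"
  have E: "E * (p0 * (q1 * r2 - q2 * r1) - p1 * (q0 * r2 - q2 * r0) + p2 * (q0 * r1 - q1 * r0)) = 1"
    using assms(2) by (simp add: E_def D_def[symmetric])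
  show ?thesis
  \<comment> \<open>The witnesses are the entries of the adjugate divided by the
    determinant.\<close>
  proof (rule that[of "E * (q1 * r2 - q2 * r1)" "- E * (p1 * r2 - p2 * r1)" "E * (p1 * q2 - p2 * q1)"
        "- E * (q0 * r2 - q2 * r0)" "E * (p0 * r2 - p2 * r0)" "- E * (p0 * q2 - p2 * q0)"
        "E * (q0 * r1 - q1 * r0)" "- E * (p0 * r1 - p1 * r0)" "E * (p0 * q1 - p1 * q0)"], goal_cases)
    case 1
    show ?case by (rule ev_ext, simp only: ev_simps ev_aff) (use E in \<open>simp add: algebra_simps\<close>)
  next
    case 2
    show ?case
    proof (rule ev_ext, simp only: ev_simps ev_aff)
      fix z :: "real \<times> real"
      show "fst z = - E * (q0 * r2 - q2 * r0) * (p0 + p1 * fst z + p2 * snd z)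
        + E * (p0 * r2 - p2 * r0) * (q0 + q1 * fst z + q2 * snd z)
        + - E * (p0 * q2 - p2 * q0) * (r0 + r1 * fst z + r2 * snd z)"
        using arg_cong[OF E, of "\<lambda>e. e * fst z"] by (simp add: algebra_simps)
    qed
  next
    case 3
    show ?case
    proof (rule ev_ext, simp only: ev_simps ev_aff)
      fix z :: "real \<times> real"
      show "snd z = E * (q0 * r1 - q1 * r0) * (p0 + p1 * fst z + p2 * snd z)
        + - E * (p0 * r1 - p1 * r0) * (q0 + q1 * fst z + q2 * snd z)
        + E * (p0 * q1 - p1 * q0) * (r0 + r1 * fst z + r2 * snd z)"
        using arg_cong[OF E, of "\<lambda>e. e * snd z"] by (simp add: algebra_simps)
    qed
  next
    case (4 \<alpha> \<beta> \<gamma>)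
    show ?case using arg_cong[OF E, of "\<lambda>e. e * \<alpha>"] by (simp add: algebra_simps)
  next
    case (5 \<alpha> \<beta> \<gamma>)
    show ?case using arg_cong[OF E, of "\<lambda>e. e * \<beta>"] by (simp add: algebra_simps)
  next
    case (6 \<alpha> \<beta> \<gamma>)
    show ?case using arg_cong[OF E, of "\<lambda>e. e * \<gamma>"] by (simp add: algebra_simps)
  qed
qed

text \<open>In a line frame, \<open>m\<close> is an affine coordinate on the line \<open>l = 0\<close>.\<close>

definition line_frame :: "bipoly \<Rightarrow> bipoly \<Rightarrow> bool" where
  "line_frame l m \<longleftrightarrow> (\<exists>l0 l1 l2 m0 m1 m2. l = aff l0 l1 l2 \<and> m = aff m0 m1 m2 \<and> l1 * m2 - l2 * m1 \<noteq> 0)"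

lemma line_frame_in: "line_frame l m \<Longrightarrow> l \<in> polys_below 2" "line_frame l m \<Longrightarrow> m \<in> polys_below 2"
  by (auto simp: line_frame_def aff_in)

lemma line_frame_point:
  assumes "line_frame l m"
  shows "\<exists>!z. ev l z = s \<and> ev m z = t"
proof -
  obtain l0 l1 l2 m0 m1 m2 where lm: "l = aff l0 l1 l2" "m = aff m0 m1 m2" and D: "l1 * m2 - l2 * m1 \<noteq> 0"
    using assms by (auto simp: line_frame_def)
  define D where "D = l1 * m2 - l2 * m1"
  have D0: "D \<noteq> 0" using D by (simp add: D_def)
  define x where "x = ((s - l0) * m2 - l2 * (t - m0)) / D"
  define y where "y = (l1 * (t - m0) - (s - l0) * m1) / D"
  have xy: "D * x = (s - l0) * m2 - l2 * (t - m0)" "D * y = l1 * (t - m0) - (s - l0) * m1"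
    using D0 by (simp_all add: x_def y_def)
  show ?thesis
  proof (rule ex1I[of _ "(x, y)"])
    have "D * (l0 + l1 * x + l2 * y) = D * l0 + l1 * (D * x) + l2 * (D * y)" by (simp add: algebra_simps)
    also have "\<dots> = D * s" unfolding xy by (simp add: D_def algebra_simps)
    finally have 1: "l0 + l1 * x + l2 * y = s" using D0 by simp
    have "D * (m0 + m1 * x + m2 * y) = D * m0 + m1 * (D * x) + m2 * (D * y)" by (simp add: algebra_simps)
    also have "\<dots> = D * t" unfolding xy by (simp add: D_def algebra_simps)
    finally have 2: "m0 + m1 * x + m2 * y = t" using D0 by simp
    show "ev l (x, y) = s \<and> ev m (x, y) = t" using 1 2 by (simp add: lm)
    fix z assume "ev l z = s \<and> ev m z = t"
    then have z: "s = l0 + l1 * fst z + l2 * snd z" "t = m0 + m1 * fst z + m2 * snd z" by (auto simp: lm)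
    have "D * fst z = D * x" "D * snd z = D * y" unfolding xy z by (simp_all add: D_def algebra_simps)
    then show "z = (x, y)" using D0 by (simp add: prod_eq_iff)
  qed
qed

text \<open>Division with remainder by a line: in the frame \<open>1, l, m\<close> every term with a
  factor \<open>l\<close> goes into the quotient, and a polynomial in \<open>m\<close> alone
  remains.\<close>

lemma line_division:
  assumes "line_frame l m" "p \<in> polys_below (Suc k)"
  shows "\<exists>g q. degree g \<le> k \<and> q \<in> polys_below k \<and> p = homog k g 1 m + l * q"
proof -
  obtain l0 l1 l2 m0 m1 m2 where lm: "l = aff l0 l1 l2" "m = aff m0 m1 m2" and D: "l1 * m2 - l2 * m1 \<noteq> 0"
    using assms(1) by (auto simp: line_frame_def)
  have one: "1 = aff 1 0 0" by (simp add: aff_def cst_1)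
  obtain a0 b0 c0 a1 b1 c1 a2 b2 c2 where
    "1 = cst a0 * aff 1 0 0 + cst b0 * aff l0 l1 l2 + cst c0 * aff m0 m1 m2"
    "vx = cst a1 * aff 1 0 0 + cst b1 * aff l0 l1 l2 + cst c1 * aff m0 m1 m2"
    "vy = cst a2 * aff 1 0 0 + cst b2 * aff l0 l1 l2 + cst c2 * aff m0 m1 m2"
    by (rule aff_frame[of 1 l1 m2 l2 m1 0 l0 m0 0]) (use D in simp, rule that)
  note fr = this[folded one lm]
  show ?thesis using assms(2)
  proof (induction k arbitrary: p)
    case 0
    then obtain c where "p = cst c" using bipoly_const by auto
    then show ?case by (intro exI[of _ "[:c:]"] exI[of _ 0]) (simp add: homog_def)
  next
    case (Suc k)
    obtain p1 p2 p3 where p: "p = 1 * p1 + l * p2 + m * p3"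
      "p1 \<in> polys_below (Suc k)" "p2 \<in> polys_below (Suc k)" "p3 \<in> polys_below (Suc k)"
      using Suc.prems fr by (rule polys_below_frame_cases)
    obtain g1 q1 where 1: "degree g1 \<le> k" "q1 \<in> polys_below k" "p1 = homog k g1 1 m + l * q1"
      using Suc.IH[OF p(2)] by blast
    obtain g3 q3 where 3: "degree g3 \<le> k" "q3 \<in> polys_below k" "p3 = homog k g3 1 m + l * q3"
      using Suc.IH[OF p(4)] by blast
    have "p = homog (Suc k) (g1 + pCons 0 g3) 1 m + l * (q1 + p2 + m * q3)"
      unfolding homog_add homog_Suc[OF 1(1)] homog_pCons by (simp add: p(1) 1(3) 3(3) algebra_simps)
    moreover have "q1 + p2 + m * q3 \<in> polys_below (Suc k)"
      using 1(2) 3(2) p(3) line_frame_in(2)[OF assms(1)]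
      by (intro polys_below_add polys_below_affine_mult) (auto intro: polys_below_mono)
    moreover have "degree (g1 + pCons 0 g3) \<le> Suc k"
      using 1(1) 3(1) by (intro degree_add_le) (auto intro: order_trans[OF degree_pCons_le])
    ultimately show ?case by blast
  qed
qed

lemma ev_homog:
  assumes "degree u \<le> k" "ev a z \<noteq> 0"
  shows "ev (homog k u a c) z = ev a z ^ k * poly u (ev c z / ev a z)"
  using bieval_homog assms unfolding ev_def by blast

lemma ev_homog_1: "degree u \<le> k \<Longrightarrow> ev (homog k u 1 m) z = poly u (ev m z)"
  by (simp add: ev_homog)

lemma homog_1_in: "m \<in> polys_below 2 \<Longrightarrow> homog k g 1 m \<in> polys_upto k"
  unfolding polys_upto_eq by (rule homog_in) (simp_all add: numeral_2_eq_2)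

lemma homog_0 [simp]: "homog k 0 a c = 0"
  by (simp add: homog_def)

lemma line_restriction:
  assumes "line_frame l m" "p \<in> polys_below (Suc k)"
  shows "\<exists>g. degree g \<le> k \<and> (\<forall>z. ev l z = 0 \<longrightarrow> ev p z = poly g (ev m z))"
  using line_division[OF assms] by (metis ev_homog_1 ev_simps(1,4) mult_zero_left add_0_right)

text \<open>The remainder on the line is a univariate polynomial with infinitely many roots.
  Parameters outside \<open>T\<close> stay free, so that the common point of two lines can be
  disregarded.\<close>

lemma line_vanishing:
  assumes fr: "line_frame l m" and p: "p \<in> polys_below (Suc k)"
    and inf: "infinite T" and T: "\<And>z. ev l z = 0 \<Longrightarrow> ev m z \<in> T \<Longrightarrow> ev p z = 0"
  shows "\<exists>q\<in>polys_below k. p = l * q"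
proof -
  obtain g q where gq: "degree g \<le> k" "q \<in> polys_below k" "p = homog k g 1 m + l * q"
    using line_division[OF fr p] by blast
  have "poly g t = 0" if t: "t \<in> T" for t
  proof -
    obtain z where z: "ev l z = 0" "ev m z = t" using line_frame_point[OF fr] by blast
    then show ?thesis using T[of z] t by (simp add: gq(3) ev_homog_1[OF gq(1)])
  qed
  then have "g = 0" using inf poly_roots_finite[of g] by (metis (mono_tags) finite_subset mem_Collect_eq subsetI)
  then show ?thesis using gq by auto
qed

lemma (in moment_functional) sos_on_line:
  assumes fr: "line_frame l m" and V: "V \<subseteq> {z. ev l z = 0}"
    and ideal: "\<And>q. q \<in> polys_below (2 * n) \<Longrightarrow> L (l * q) = 0"
  shows sos_on_variety
proof (rule sos_on_rational_curve[where a = "\<lambda>_. 1" and t = "ev m" and m = n])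
  let ?Z = "{z. ev l z = 0}"
  show "?Z = {z \<in> ?Z. (1::real) \<noteq> 0}" by simp
  show "V \<subseteq> ?Z" "V \<subseteq> ?Z" by fact+
  show "\<exists>g. degree g \<le> n \<and> (\<forall>z\<in>?Z. ev p z = 1 ^ n * poly g (ev m z))" if "p \<in> polys_upto n" for p
    using line_restriction[OF fr] that by (simp add: polys_upto_eq)
  show "\<exists>g. degree g \<le> 2 * n \<and> (\<forall>z\<in>?Z. ev p z = 1 ^ (2 * n) * poly g (ev m z))" if "p \<in> polys_upto (2 * n)" for p
    using line_restriction[OF fr] that by (simp add: polys_upto_eq)
  show "\<exists>p\<in>polys_upto n. \<forall>z\<in>?Z. ev p z = 1 ^ n * poly g (ev m z)" if "degree g \<le> n" for g
    using homog_1_in[OF line_frame_in(2)[OF fr], of n g] ev_homog_1[OF that]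
    by (intro bexI[of _ "homog n g 1 m"]) auto
  show "L p = 0 \<and> (\<forall>z\<in>?Z. ev p z = 0)"
    if "p \<in> polys_upto (2 * n)" and 0: "\<And>z. z \<in> ?Z \<Longrightarrow> ev p z = 0" for p
  proof -
    have "\<exists>q\<in>polys_below (2 * n). p = l * q"
      by (rule line_vanishing[OF fr _ infinite_UNIV_char_0[where 'a = real]])
        (use that in \<open>auto simp: polys_upto_eq\<close>)
    then obtain q where "q \<in> polys_below (2 * n)" "p = l * q" by blast
    then show ?thesis using ideal 0 by simp
  qed
  show "inj_on (ev m) ?Z" using line_frame_point[OF fr, of 0] by (auto intro!: inj_onI)
  have "x \<in> ev m ` ?Z" for x using line_frame_point[OF fr, of 0 x] by blast
  then have "ev m ` ?Z = UNIV" by blast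
  then show "finite (- ev m ` ?Z)" by simp
qed auto

text \<open>Division by the conic: \<open>b * b\<close> is traded for \<open>a * c\<close>, which
  leaves a remainder of degree at most one in \<open>b\<close>.\<close>

lemma conic_division:
  assumes fr: "1 = cst a0 * a + cst b0 * b + cst c0 * c" "vx = cst a1 * a + cst b1 * b + cst c1 * c"
      "vy = cst a2 * a + cst b2 * b + cst c2 * c"
    and aff: "a \<in> polys_below 2" "b \<in> polys_below 2" "c \<in> polys_below 2"
    and p: "p \<in> polys_below (Suc (Suc k))"
  shows "\<exists>u v q. degree u \<le> Suc k \<and> degree v \<le> k \<and> q \<in> polys_below k \<and>
    p = homog (Suc k) u a c + b * homog k v a c + (a * c - b * b) * q"
  using p
proof (induction k arbitrary: p)
  case 0
  obtain p1 p2 p3 where p: "p = a * p1 + b * p2 + c * p3"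
    "p1 \<in> polys_below (Suc 0)" "p2 \<in> polys_below (Suc 0)" "p3 \<in> polys_below (Suc 0)"
    using 0 fr by (rule polys_below_frame_cases)
  then obtain d1 d2 d3 where "p1 = cst d1" "p2 = cst d2" "p3 = cst d3"
    using bipoly_const by (metis One_nat_def)
  then have "p = homog (Suc 0) [:d1, d3:] a c + b * homog 0 [:d2:] a c + (a * c - b * b) * 0"
    by (simp add: p(1) homog_def algebra_simps)
  then show ?case by (intro exI[of _ "[:d1, d3:]"] exI[of _ "[:d2:]"] exI[of _ 0]) auto
next
  case (Suc k)
  obtain p1 p2 p3 where p: "p = a * p1 + b * p2 + c * p3"
    "p1 \<in> polys_below (Suc (Suc k))" "p2 \<in> polys_below (Suc (Suc k))" "p3 \<in> polys_below (Suc (Suc k))"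
    using Suc.prems fr by (rule polys_below_frame_cases)
  obtain u1 v1 q1 where 1: "degree u1 \<le> Suc k" "degree v1 \<le> k" "q1 \<in> polys_below k"
    "p1 = homog (Suc k) u1 a c + b * homog k v1 a c + (a * c - b * b) * q1" using Suc.IH[OF p(2)] by blast
  obtain u2 v2 q2 where 2: "degree u2 \<le> Suc k" "degree v2 \<le> k" "q2 \<in> polys_below k"
    "p2 = homog (Suc k) u2 a c + b * homog k v2 a c + (a * c - b * b) * q2" using Suc.IH[OF p(3)] by blast
  obtain u3 v3 q3 where 3: "degree u3 \<le> Suc k" "degree v3 \<le> k" "q3 \<in> polys_below k"
    "p3 = homog (Suc k) u3 a c + b * homog k v3 a c + (a * c - b * b) * q3" using Suc.IH[OF p(4)] by blast
  have dv2: "degree (pCons 0 v2) \<le> Suc k" using 2(2) by (auto intro: order_trans[OF degree_pCons_le])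
  \<comment> \<open>The term \<open>b * b * homog k v2 a c\<close> is replaced by
    \<open>a * c * homog k v2 a c\<close>; the difference goes into the quotient.\<close>
  let ?q = "a * q1 + b * q2 + c * q3 - homog k v2 a c"
  have "p = homog (Suc (Suc k)) (u1 + pCons 0 u3 + pCons 0 v2) a c
      + b * homog (Suc k) (v1 + pCons 0 v3 + u2) a c + (a * c - b * b) * ?q"
    unfolding homog_add homog_Suc[OF 1(1)] homog_Suc[OF 1(2)] homog_pCons homog_Suc[OF 2(2)]
    by (simp add: p(1) 1(4) 2(4) 3(4) algebra_simps)
  moreover have "?q \<in> polys_below (Suc k)"
    using 1(3) 2(3) 3(3) aff by (intro polys_below_add polys_below_diff polys_below_affine_mult homog_in) auto
  moreover have "degree (u1 + pCons 0 u3 + pCons 0 v2) \<le> Suc (Suc k)" "degree (v1 + pCons 0 v3 + u2) \<le> Suc k"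
    using 1 2 3 dv2 by (intro degree_add_le; force intro: order_trans[OF degree_pCons_le])+
  ultimately show ?case by blast
qed

text \<open>In the homogeneous coordinates \<open>a, b, c\<close> the conic
  \<open>a * c = b * b\<close> is the curve \<open>1 : t : t^2\<close> with
  \<open>t = b / a\<close>, so a polynomial of degree at most \<open>k\<close> restricts to a
  univariate one of degree at most \<open>2 * k\<close>.\<close>

lemma (in moment_functional) sos_on_conic_aux:
  assumes D: "p0 * (q1 * r2 - q2 * r1) - p1 * (q0 * r2 - q2 * r0) + p2 * (q0 * r1 - q1 * r0) \<noteq> 0"
    and abc: "a = aff p0 p1 p2" "b = aff q0 q1 q2" "c = aff r0 r1 r2"
    and n: "n \<ge> 1"
    and V: "V \<subseteq> {z. ev (a * c - b * b) z = 0}"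
    and Va: "\<And>z. finite V \<Longrightarrow> z \<in> V \<Longrightarrow> ev a z \<noteq> 0"
    and ideal: "\<And>q. q \<in> polys_below (2 * n - 1) \<Longrightarrow> L ((a * c - b * b) * q) = 0"
  shows sos_on_variety
proof -
  obtain a0 b0 c0 a1 b1 c1 a2 b2 c2 where fr:
    "1 = cst a0 * a + cst b0 * b + cst c0 * c"
    "vx = cst a1 * a + cst b1 * b + cst c1 * c"
    "vy = cst a2 * a + cst b2 * b + cst c2 * c"
    and inv: "\<And>\<alpha> \<beta> \<gamma>. p0 * (a0 * \<alpha> + b0 * \<beta> + c0 * \<gamma>) + p1 * (a1 * \<alpha> + b1 * \<beta> + c1 * \<gamma>) + p2 * (a2 * \<alpha> + b2 * \<beta> + c2 * \<gamma>) = \<alpha>"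
    "\<And>\<alpha> \<beta> \<gamma>. q0 * (a0 * \<alpha> + b0 * \<beta> + c0 * \<gamma>) + q1 * (a1 * \<alpha> + b1 * \<beta> + c1 * \<gamma>) + q2 * (a2 * \<alpha> + b2 * \<beta> + c2 * \<gamma>) = \<beta>"
    "\<And>\<alpha> \<beta> \<gamma>. r0 * (a0 * \<alpha> + b0 * \<beta> + c0 * \<gamma>) + r1 * (a1 * \<alpha> + b1 * \<beta> + c1 * \<gamma>) + r2 * (a2 * \<alpha> + b2 * \<beta> + c2 * \<gamma>) = \<gamma>"
    by (rule aff_frame[OF D]) (rule that, unfold abc)
  have aff: "a \<in> polys_below 2" "b \<in> polys_below 2" "c \<in> polys_below 2" by (simp_all add: abc aff_in)
  have e1: "1 = a0 * ev a z + b0 * ev b z + c0 * ev c z" for z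
    using arg_cong[OF fr(1), of "\<lambda>p. ev p z"] by simp
  have ex: "fst z = a1 * ev a z + b1 * ev b z + c1 * ev c z" for z
    using arg_cong[OF fr(2), of "\<lambda>p. ev p z"] by simp
  have ey: "snd z = a2 * ev a z + b2 * ev b z + c2 * ev c z" for z
    using arg_cong[OF fr(3), of "\<lambda>p. ev p z"] by simp
  have eq: "z = y" if "ev a z = ev a y" "ev b z = ev b y" "ev c z = ev c y" for z y
    using ex[of z] ex[of y] ey[of z] ey[of y] that by (simp add: prod_eq_iff)
  let ?Q = "a * c - b * b"
  define Z where "Z = {z. ev ?Q z = 0}"
  define Z0 where "Z0 = {z \<in> Z. ev a z \<noteq> 0}"
  define t where "t = (\<lambda>z. ev b z / ev a z)"
  have Z0D: "ev a z \<noteq> 0" "ev b z = ev a z * t z" "ev c z = ev a z * (t z)^2" if "z \<in> Z0" for z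
    using that by (auto simp: Z0_def Z_def t_def power2_eq_square field_simps)
  \<comment> \<open>Along the curve the combination that equals 1 becomes \<open>a * W(t)\<close>.
    The roots of \<open>W\<close> belong to points at infinity and are the only values that
    \<open>t\<close> can miss.\<close>
  define W where "W = [:a0, b0, c0:]"
  have W: "ev a z * poly W (t z) = 1" if "z \<in> Z0" for z
    using e1[of z] Z0D[OF that] by (simp add: W_def power2_eq_square algebra_simps)
  have W0: "W \<noteq> 0" using e1[of "(0, 0)"] by (auto simp: W_def)
  have inj: "inj_on t Z0"
  proof (rule inj_onI)
    fix z y assume zy: "z \<in> Z0" "y \<in> Z0" "t z = t y"
    have "ev a z * poly W (t y) = ev a y * poly W (t y)" "poly W (t y) \<noteq> 0"
      using W[OF zy(1)] W[OF zy(2)] zy(3) by auto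
    then have "ev a z = ev a y" by simp
    then show "z = y" using Z0D[OF zy(1)] Z0D[OF zy(2)] zy(3) by (intro eq) auto
  qed
  have "- t ` Z0 \<subseteq> {x. poly W x = 0}"
  proof (rule subsetI, rule ccontr)
    fix x assume x: "x \<in> - t ` Z0" "x \<notin> {x. poly W x = 0}"
    define w where "w = a0 * 1 + b0 * x + c0 * x^2"
    have w: "w \<noteq> 0" using x(2) by (simp add: w_def W_def power2_eq_square algebra_simps)
    \<comment> \<open>The point with homogeneous coordinates \<open>1 : x : x^2\<close>, made affine
      by dividing by \<open>w\<close>.\<close>
    define z where "z = ((a1 * 1 + b1 * x + c1 * x^2) / w, (a2 * 1 + b2 * x + c2 * x^2) / w)"
    have "ev a z * w = 1" "ev b z * w = x" "ev c z * w = x^2"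
      using w inv[of 1 x "x^2"] unfolding abc ev_aff z_def fst_conv snd_conv w_def[symmetric]
      by (simp_all add: distrib_right)
    then have "ev a z = 1 / w" "ev b z = x / w" "ev c z = x^2 / w" using w by (simp_all add: field_simps)
    then have "z \<in> Z0" "t z = x" using w by (auto simp: Z0_def Z_def t_def power2_eq_square)
    then show False using x(1) by auto
  qed
  then have cofin: "finite (- t ` Z0)" using poly_roots_finite[OF W0] by (rule finite_subset)
  have Zfin: "finite (Z - Z0)"
  proof -
    \<comment> \<open>On the conic \<open>a = 0\<close> forces \<open>b = 0\<close>, and then the
      combination equal to 1 fixes \<open>c\<close>.\<close>
    have "z = y" if "z \<in> Z - Z0" "y \<in> Z - Z0" for z y
    proof -
      have z: "ev a z = 0" "ev b z = 0" and y: "ev a y = 0" "ev b y = 0" using that by (auto simp: Z0_def Z_def)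
      then have "c0 * ev c z = 1" "c0 * ev c y = 1" using e1[of z] e1[of y] by auto
      then have "ev c z = ev c y" by (metis mult_cancel_left zero_neq_one mult_zero_left)
      then show ?thesis using z y by (intro eq) auto
    qed
    then show ?thesis by (metis finite.emptyI finite.insertI finite_subset insertI1 subsetI)
  qed
  \<comment> \<open>Because \<open>b / a = t\<close> and \<open>c / a = t^2\<close>, the normal form
    of \<open>conic_division\<close> has \<open>u\<close> as its even and \<open>v\<close> as its
    odd part in \<open>t\<close>.\<close>
  define sq where "sq u v = pcompose u [:0, 0, 1:] + [:0, 1:] * pcompose v [:0, 0, 1:]" for u v :: "real poly"
  have sq: "poly (sq u v) x = poly u (x^2) + x * poly v (x^2)" for u v x
    by (simp add: sq_def poly_pcompose power2_eq_square)
  have division: "\<exists>u v q. degree u \<le> k \<and> degree v \<le> k - 1 \<and> q \<in> polys_below (k - 1) \<and>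
      p = homog k u a c + b * homog (k - 1) v a c + ?Q * q" if "p \<in> polys_upto k" "k \<ge> 1" for p k
    using conic_division[OF fr aff, of p "k - 1"] that by (simp add: polys_upto_eq)
  have ev_nf: "ev (homog k u a c + b * homog (k - 1) v a c + ?Q * q) z = ev a z ^ k * poly (sq u v) (t z)"
    if "z \<in> Z0" "degree u \<le> k" "degree v \<le> k - 1" "k \<ge> 1" for k u v q z
  proof -
    from that(4) obtain k' where k: "k = Suc k'" by (cases k) auto
    have "ev ?Q z = 0" using that(1) by (simp add: Z0_def Z_def)
    moreover have "ev c z / ev a z = (t z)^2" using Z0D[OF that(1)] by simp
    ultimately show ?thesis using that Z0D(1,2)[OF that(1)]
      unfolding ev_simps(1) ev_simps(4)[of ?Q] by (simp add: ev_homog sq k algebra_simps)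
  qed
  have restrict: "\<exists>g. degree g \<le> 2 * k \<and> (\<forall>z\<in>Z0. ev p z = ev a z ^ k * poly g (t z))"
    if p: "p \<in> polys_upto k" and k: "k \<ge> 1" for p k
  proof -
    obtain u v q where uvq: "degree u \<le> k" "degree v \<le> k - 1"
      "p = homog k u a c + b * homog (k - 1) v a c + ?Q * q" using division[OF p k] by blast
    have "degree (sq u v) \<le> 2 * k"
      unfolding sq_def using uvq(1,2) k
      by (intro degree_add_le order_trans[OF degree_mult_le]) (auto simp: degree_pcompose)
    then show ?thesis using ev_nf[OF _ uvq(1,2) k] uvq(3) by blast
  qed
  \<comment> \<open>Two powers of \<open>t\<close> are handled at a time: by
    \<open>c = a * t^2\<close>, multiplying a lift of \<open>h\<close> by \<open>c\<close> accounts
    for the factor \<open>t^2\<close>.\<close>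
  have lift: "\<exists>p\<in>polys_upto k. \<forall>z\<in>Z0. ev p z = ev a z ^ k * poly g (t z)" if "degree g \<le> 2 * k" for g k
    using that
  proof (induction k arbitrary: g)
    case 0
    then obtain d where "g = [:d:]" by (auto elim: degree_eq_zeroE)
    then show ?case by (intro bexI[of _ "cst d"]) (auto simp: polys_upto_eq)
  next
    case (Suc k)
    obtain d e h where g: "g = pCons d (pCons e h)" by (metis pCons_cases)
    have "degree h \<le> 2 * k" using Suc.prems by (auto simp: g split: if_splits)
    then obtain p where p: "p \<in> polys_upto k" "\<forall>z\<in>Z0. ev p z = ev a z ^ k * poly h (t z)" using Suc.IH by blast
    let ?p = "a ^ k * (cst d * a + cst e * b) + c * p"
    have "cst d * a + cst e * b \<in> polys_below 2" using aff by auto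
    then have "a ^ k * (cst d * a + cst e * b) \<in> polys_below (Suc (Suc k))"
      using aff by (intro polys_below_mult[of _ k _ 2] polys_below_affine_power) auto
    moreover have "c * p \<in> polys_below (Suc (Suc k))"
      using p(1) aff by (intro polys_below_affine_mult) (auto simp: polys_upto_eq)
    ultimately have "?p \<in> polys_upto (Suc k)" by (auto simp: polys_upto_eq)
    moreover have "ev ?p z = ev a z ^ Suc k * poly g (t z)" if "z \<in> Z0" for z
      using bspec[OF p(2) that] Z0D(2,3)[OF that] by (simp add: g algebra_simps power2_eq_square)
    ultimately show ?case by blast
  qed
  show ?thesis
  proof (rule sos_on_rational_curve[where a = "ev a" and t = t and m = "2 * n" and Z = Z and Z0 = Z0])
    show "Z0 = {z \<in> Z. ev a z \<noteq> 0}" by (rule Z0_def)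
    show "V \<subseteq> Z" using V by (simp add: Z_def)
    then show "V \<subseteq> Z0" if "finite V" using Va[OF that] by (auto simp: Z0_def)
    show "\<exists>g. degree g \<le> 2 * n \<and> (\<forall>z\<in>Z0. ev p z = ev a z ^ n * poly g (t z))" if "p \<in> polys_upto n" for p
      using restrict[OF that n] .
    show "\<exists>g. degree g \<le> 2 * (2 * n) \<and> (\<forall>z\<in>Z0. ev p z = ev a z ^ (2 * n) * poly g (t z))"
      if "p \<in> polys_upto (2 * n)" for p
      using restrict[OF that] n by simp
    show "\<exists>p\<in>polys_upto n. \<forall>z\<in>Z0. ev p z = ev a z ^ n * poly g (t z)" if "degree g \<le> 2 * n" for g
      using lift[OF that] .
    show "L p = 0 \<and> (\<forall>z\<in>Z. ev p z = 0)"
      if p: "p \<in> polys_upto (2 * n)" and 0: "\<And>z. z \<in> Z0 \<Longrightarrow> ev p z = 0" for p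
    proof -
      obtain u v q where uvq: "degree u \<le> 2 * n" "degree v \<le> 2 * n - 1" "q \<in> polys_below (2 * n - 1)"
        "p = homog (2 * n) u a c + b * homog (2 * n - 1) v a c + ?Q * q" using division[OF p] n by auto
      have "poly (sq u v) x = 0" if "x \<notin> - t ` Z0" for x
      proof -
        from that obtain z where z: "z \<in> Z0" "x = t z" by auto
        then have "ev a z ^ (2 * n) * poly (sq u v) (t z) = 0"
          using ev_nf[OF z(1) uvq(1,2)] 0[OF z(1)] n uvq(4) by simp
        then show ?thesis using Z0D(1)[OF z(1)] z(2) by simp
      qed
      then have "UNIV \<subseteq> (- t ` Z0) \<union> {x. poly (sq u v) x = 0}" by auto
      then have "infinite {x. poly (sq u v) x = 0}"
        using cofin infinite_UNIV_char_0[where 'a = real] by (meson finite_UnI finite_subset)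
      then have sq0: "sq u v = 0" using poly_roots_finite by blast
      \<comment> \<open>Evaluation at both square roots of \<open>s\<close> separates the even part
        from the odd one.\<close>
      have uv: "poly u s = 0 \<and> poly v s = 0" if s: "s \<in> {0<..}" for s
      proof -
        have "poly u s + sqrt s * poly v s = 0" "poly u s - sqrt s * poly v s = 0"
          using sq[of u v "sqrt s"] sq[of u v "- sqrt s"] sq0 s by auto
        then have "poly u s = 0" "sqrt s * poly v s = 0" by linarith+
        then show ?thesis using s by simp
      qed
      have inf: "infinite {0::real<..}" by (rule infinite_Ioi)
      have "u = 0" using uv poly_roots_finite[of u] inf by (metis (mono_tags) finite_subset mem_Collect_eq subsetI)
      moreover have "v = 0" using uv poly_roots_finite[of v] inf by (metis (mono_tags) finite_subset mem_Collect_eq subsetI)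
      ultimately have "p = ?Q * q" using uvq(4) by simp
      then show ?thesis using ideal[OF uvq(3)] by (simp add: Z_def del: right_diff_distrib left_diff_distrib)
    qed
  qed (fact inj cofin Zfin)+
qed

lemma (in moment_functional) sos_on_conic:
  assumes D: "p0 * (q1 * r2 - q2 * r1) - p1 * (q0 * r2 - q2 * r0) + p2 * (q0 * r1 - q1 * r0) \<noteq> 0"
    and abc: "a = aff p0 p1 p2" "b = aff q0 q1 q2" "c = aff r0 r1 r2"
    and n: "n \<ge> 1"
    and V: "V \<subseteq> {z. ev (a * c - b * b) z = 0}"
    and ideal: "\<And>q. q \<in> polys_below (2 * n - 1) \<Longrightarrow> L ((a * c - b * b) * q) = 0"
  shows sos_on_variety
proof -
  obtain a0 b0 c0 where "1 = cst a0 * a + cst b0 * b + cst c0 * c"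
    by (rule aff_frame[OF D]) (rule that, unfold abc)
  then have e1: "1 = a0 * ev a z + b0 * ev b z + c0 * ev c z" for z
    by (metis ev_simps(1,4,7,8))
  \<comment> \<open>a projective change of the parameter moves the points of a finite variety away from \<open>t = \<infinity>\<close>\<close>
  have "\<exists>s. finite V \<longrightarrow> (\<forall>z\<in>V. ev a z + 2 * s * ev b z + s^2 * ev c z \<noteq> 0)"
  proof (cases "finite V")
    case True
    define R where "R = (\<Union>z\<in>V. {s. poly [:ev a z, 2 * ev b z, ev c z:] s = 0})"
    have "finite R" unfolding R_def
    proof (intro finite_UN_I True poly_roots_finite)
      show "[:ev a z, 2 * ev b z, ev c z:] \<noteq> 0" for z using e1[of z] by auto
    qed
    then obtain s where "s \<notin> R" using ex_new_if_finite infinite_UNIV_char_0 by blast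
    then have "ev a z + 2 * s * ev b z + s^2 * ev c z \<noteq> 0" if "z \<in> V" for z
      using that by (auto simp: R_def power2_eq_square algebra_simps)
    then show ?thesis by blast
  qed simp
  then obtain s where s: "finite V \<Longrightarrow> z \<in> V \<Longrightarrow> ev a z + 2 * s * ev b z + s^2 * ev c z \<noteq> 0" for z by blast
  \<comment> \<open>This change of frame preserves both \<open>a * c - b * b\<close> and the
    determinant.\<close>
  define a' where "a' = aff (p0 + 2 * s * q0 + s^2 * r0) (p1 + 2 * s * q1 + s^2 * r1) (p2 + 2 * s * q2 + s^2 * r2)"
  define b' where "b' = aff (q0 + s * r0) (q1 + s * r1) (q2 + s * r2)"
  have Q: "a' * c - b' * b' = a * c - b * b"
    by (rule ev_ext, simp only: ev_simps ev_aff a'_def b'_def abc) (simp add: power2_eq_square algebra_simps)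
  show ?thesis
  proof (rule sos_on_conic_aux[OF _ a'_def b'_def abc(3) n])
    show "(p0 + 2 * s * q0 + s^2 * r0) * ((q1 + s * r1) * r2 - (q2 + s * r2) * r1) -
      (p1 + 2 * s * q1 + s^2 * r1) * ((q0 + s * r0) * r2 - (q2 + s * r2) * r0) +
      (p2 + 2 * s * q2 + s^2 * r2) * ((q0 + s * r0) * r1 - (q1 + s * r1) * r0) \<noteq> 0"
      using D by (simp add: power2_eq_square algebra_simps)
    show "V \<subseteq> {z. ev (a' * c - b' * b') z = 0}" unfolding Q by (rule V)
    show "L ((a' * c - b' * b') * q) = 0" if "q \<in> polys_below (2 * n - 1)" for q
      unfolding Q by (rule ideal[OF that])
    show "ev a' z \<noteq> 0" if "finite V" "z \<in> V" for z
      using s[OF that] by (simp add: a'_def abc algebra_simps)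
  qed
qed

section \<open>Pairs of lines\<close>

text \<open>
  Intersecting and parallel lines are treated together: \<open>l\<^sub>1, l\<^sub>2, E\<close> is an affine frame, and the
  possibly infinite common point \<open>l\<^sub>1 = l\<^sub>2 = 0\<close> is seen by the coefficient of \<open>E\<^sup>k\<close>.
\<close>

locale two_lines = moment_functional n L N V
  for n :: nat and L :: "bipoly \<Rightarrow> real" and N :: "bipoly set" and V :: "(real \<times> real) set" +
  fixes l1 l2 m1 m2 E :: bipoly
  assumes n1: "n \<ge> 1"
    and fr1: "line_frame l1 m1" and fr2: "line_frame l2 m2" and E_in: "E \<in> polys_below 2"
    and frame: "\<And>p k. p \<in> polys_below (Suc (Suc k)) \<Longrightarrow>
      \<exists>p1\<in>polys_below (Suc k). \<exists>p2\<in>polys_below (Suc k). \<exists>p3\<in>polys_below (Suc k). p = l1 * p1 + l2 * p2 + E * p3"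
    and glue1: "\<And>c h k. h \<in> polys_below k \<Longrightarrow>
      (\<And>z. ev l1 z = 0 \<Longrightarrow> c * ev E z ^ k + ev l2 z * ev h z = 0) \<Longrightarrow> c = 0"
    and glue2: "\<And>c h k. h \<in> polys_below k \<Longrightarrow>
      (\<And>z. ev l2 z = 0 \<Longrightarrow> c * ev E z ^ k + ev l1 z * ev h z = 0) \<Longrightarrow> c = 0"
    and glue_unique: "\<And>z y. ev l1 z = 0 \<Longrightarrow> ev l2 z = 0 \<Longrightarrow> ev l1 y = 0 \<Longrightarrow> ev l2 y = 0 \<Longrightarrow> z = y"
    and V_lines: "V \<subseteq> {z. ev l1 z = 0} \<union> {z. ev l2 z = 0}"
    and ideal: "\<And>q. q \<in> polys_below (2 * n - 1) \<Longrightarrow> L (l1 * (l2 * q)) = 0"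
begin

text \<open>By interpretation, every fact proved for the first line becomes available for the
  second.\<close>

lemma swap: "two_lines n L N V l2 l1 m2 m1 E"
proof unfold_locales
  show "\<exists>p1\<in>polys_below (Suc k). \<exists>p2\<in>polys_below (Suc k). \<exists>p3\<in>polys_below (Suc k). p = l2 * p1 + l1 * p2 + E * p3"
    if "p \<in> polys_below (Suc (Suc k))" for p k
    using frame[OF that] by (metis add.commute)
  show "L (l2 * (l1 * q)) = 0" if "q \<in> polys_below (2 * n - 1)" for q
    using ideal[OF that] by (simp add: mult.left_commute)
  show "c = 0" if "h \<in> polys_below k" "\<And>z. ev l2 z = 0 \<Longrightarrow> c * ev E z ^ k + ev l1 z * ev h z = 0" for c h k
    using that by (rule glue2)
  show "c = 0" if "h \<in> polys_below k" "\<And>z. ev l1 z = 0 \<Longrightarrow> c * ev E z ^ k + ev l2 z * ev h z = 0" for c h k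
    using that by (rule glue1)
qed (use n1 fr1 fr2 E_in V_lines glue_unique in auto)

lemmas line_in = line_frame_in[OF fr1] line_frame_in[OF fr2]

definition pt1 :: "real \<Rightarrow> real \<times> real" where
  "pt1 t = (THE z. ev l1 z = 0 \<and> ev m1 z = t)"

lemma pt1: "ev l1 (pt1 t) = 0" "ev m1 (pt1 t) = t"
  using theI'[OF line_frame_point[OF fr1, of 0 t]] by (auto simp: pt1_def)

lemma pt1_m1: "ev l1 z = 0 \<Longrightarrow> pt1 (ev m1 z) = z"
  unfolding pt1_def using line_frame_point[OF fr1, of 0 "ev m1 z"] by (intro the1_equality) auto

lemma inj_m1: "inj_on (ev m1) {z. ev l1 z = 0}"
  by (rule inj_on_inverseI[of _ pt1]) (simp add: pt1_m1)

lemma infinite_line1: "infinite {z. ev l1 z = 0}"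
proof
  assume "finite {z. ev l1 z = 0}"
  then have "finite (ev m1 ` {z. ev l1 z = 0})" by simp
  moreover have "ev m1 ` {z. ev l1 z = 0} = UNIV" using pt1 by (metis (mono_tags) UNIV_eq_I image_eqI mem_Collect_eq)
  ultimately show False using infinite_UNIV_char_0[where 'a = real] by simp
qed

lemma restrict1: "p \<in> polys_below (Suc k) \<Longrightarrow> \<exists>g. degree g \<le> k \<and> (\<forall>z. ev l1 z = 0 \<longrightarrow> ev p z = poly g (ev m1 z))"
  by (rule line_restriction[OF fr1])

text \<open>Applying the frame repeatedly to the cofactor of \<open>E\<close> leaves a single term
  outside the ideal of \<open>l1\<close> and \<open>l2\<close>. By \<open>glue1\<close> and
  \<open>glue2\<close> its coefficient is determined by the restriction to either line: it is the
  datum on which the two univariate problems have to agree.\<close>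

lemma glue_decomposition:
  assumes "p \<in> polys_below (Suc k)"
  shows "\<exists>c. \<exists>h1\<in>polys_below k. \<exists>h2\<in>polys_below k. p = cst c * E ^ k + l1 * h1 + l2 * h2"
  using assms
proof (induction k arbitrary: p)
  case 0
  then obtain c where "p = cst c" using bipoly_const by auto
  then show ?case by (intro exI[of _ c] bexI[of _ 0]) auto
next
  case (Suc k)
  obtain p1 p2 p3 where p: "p1 \<in> polys_below (Suc k)" "p2 \<in> polys_below (Suc k)" "p3 \<in> polys_below (Suc k)"
    "p = l1 * p1 + l2 * p2 + E * p3" using frame[OF Suc.prems] by blast
  obtain c h1 h2 where h: "h1 \<in> polys_below k" "h2 \<in> polys_below k" "p3 = cst c * E ^ k + l1 * h1 + l2 * h2"
    using Suc.IH[OF p(3)] by blast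
  have "p = cst c * E ^ Suc k + l1 * (p1 + E * h1) + l2 * (p2 + E * h2)"
    by (simp add: p(4) h(3) algebra_simps)
  moreover have "p1 + E * h1 \<in> polys_below (Suc k)" "p2 + E * h2 \<in> polys_below (Suc k)"
    using p h E_in by (intro polys_below_add polys_below_affine_mult; simp)+
  ultimately show ?case by blast
qed

lemma E_glue: "ev l1 z = 0 \<Longrightarrow> ev l2 z = 0 \<Longrightarrow> ev E z \<noteq> 0"
proof
  assume z: "ev l1 z = 0" "ev l2 z = 0" "ev E z = 0"
  obtain p1 p2 p3 where "1 = l1 * p1 + l2 * p2 + E * p3" using frame[of 1 0] by auto
  from arg_cong[OF this, of "\<lambda>p. ev p z"] show False using z by simp
qed

lemma L_zero_on_lines:
  assumes f: "f \<in> polys_upto (2 * n)" and 0: "\<And>z. ev l1 z = 0 \<or> ev l2 z = 0 \<Longrightarrow> ev f z = 0"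
  shows "L f = 0"
proof -
  have n: "2 * n = Suc (2 * n - 1)" using n1 by simp
  have "f \<in> polys_below (Suc (2 * n))" using f by (simp add: polys_upto_eq)
  then obtain q where q: "q \<in> polys_below (2 * n)" "f = l1 * q"
    using line_vanishing[OF fr1 _ infinite_UNIV_char_0[where 'a = real], of f "2 * n"] 0 by blast
  \<comment> \<open>At a common point \<open>l1\<close> vanishes too and \<open>f = l1 * q\<close>
    says nothing about \<open>q\<close>. There is at most one such point.\<close>
  define T where "T = - ev m2 ` {z. ev l1 z = 0 \<and> ev l2 z = 0}"
  have "finite {z. ev l1 z = 0 \<and> ev l2 z = 0}"
  proof (cases "{z. ev l1 z = 0 \<and> ev l2 z = 0} = {}")
    case False
    then obtain y where "ev l1 y = 0" "ev l2 y = 0" by auto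
    then have "{z. ev l1 z = 0 \<and> ev l2 z = 0} \<subseteq> {y}" using glue_unique by blast
    then show ?thesis by (rule finite_subset) simp
  qed (simp only: finite.emptyI)
  then have "infinite T"
    unfolding T_def using infinite_UNIV_char_0[where 'a = real] by (metis finite_compl finite_imageI)
  moreover have "ev q z = 0" if "ev l2 z = 0" "ev m2 z \<in> T" for z
    using 0[of z] that by (auto simp: q(2) T_def)
  ultimately obtain r where "r \<in> polys_below (2 * n - 1)" "q = l2 * r"
    using line_vanishing[OF fr2, of q "2 * n - 1" T] q(1) n by auto
  then show ?thesis using ideal by (simp add: q(2))
qed

lemma N_vanishes_line1:
  assumes "infinite (V \<inter> {z. ev l1 z = 0})" "p \<in> N" "ev l1 z = 0"
  shows "ev p z = 0"
proof -
  obtain g where g: "\<forall>z. ev l1 z = 0 \<longrightarrow> ev p z = poly g (ev m1 z)"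
    using restrict1[of p n] N_D(1)[OF assms(2)] by (auto simp: polys_upto_eq)
  have "infinite (ev m1 ` (V \<inter> {z. ev l1 z = 0}))"
    using assms(1) inj_m1 by (metis Int_lower2 finite_imageD inj_on_subset)
  moreover have "ev m1 ` (V \<inter> {z. ev l1 z = 0}) \<subseteq> {t. poly g t = 0}"
  proof (rule subsetI, elim imageE IntE CollectE, intro CollectI)
    fix t z assume "t = ev m1 z" "z \<in> V" "ev l1 z = 0"
    moreover have "ev p z = poly g (ev m1 z)" using g \<open>ev l1 z = 0\<close> by blast
    ultimately show "poly g t = 0" using N_D(3)[OF assms(2), of z] by simp
  qed
  ultimately have "g = 0" using poly_roots_finite[of g] finite_subset by blast
  then show ?thesis using g assms(3) by (metis poly_0)
qed

lemma square_split_line1: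
  assumes f: "f \<in> polys_upto (2 * n)" and pos: "\<And>z. ev l1 z = 0 \<Longrightarrow> ev f z \<ge> 0"
  obtains a1 a2 where "degree a1 \<le> n" "degree a2 \<le> n"
    "\<And>z. ev l1 z = 0 \<Longrightarrow> ev f z = poly a1 (ev m1 z) ^ 2 + poly a2 (ev m1 z) ^ 2"
proof -
  obtain g where g: "degree g \<le> 2 * n" "\<forall>z. ev l1 z = 0 \<longrightarrow> ev f z = poly g (ev m1 z)"
    using restrict1[of f "2 * n"] f by (auto simp: polys_upto_eq)
  have "poly g t \<ge> 0" for t using g(2) pos pt1 by metis
  then obtain a1 a2 where "g = a1^2 + a2^2" "2 * degree a1 \<le> degree g" "2 * degree a2 \<le> degree g"
    using nonneg_poly_two_squares by blast
  then show ?thesis using g by (intro that[of a1 a2]) auto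
qed

text \<open>The two squared polynomials are decomposed like \<open>f\<close>, which exhibits their
  values at the common point; comparison with \<open>f\<close> there gives the equation for
  \<open>c\<close>, the only quantity shared with the other line.\<close>

lemma glued_squares_line1:
  assumes f: "f \<in> polys_upto (2 * n)" and pos: "\<And>z. ev l1 z = 0 \<Longrightarrow> ev f z \<ge> 0"
    and dec: "f = cst c * E ^ (2 * n) + l1 * x + l2 * y" "y \<in> polys_below (2 * n)"
  obtains \<alpha>1 \<alpha>2 h1 h2 where "h1 \<in> polys_below n" "h2 \<in> polys_below n" "c = \<alpha>1^2 + \<alpha>2^2"
    "\<And>z. ev l1 z = 0 \<Longrightarrow> ev f z = (\<alpha>1 * ev E z ^ n + ev l2 z * ev h1 z)^2 + (\<alpha>2 * ev E z ^ n + ev l2 z * ev h2 z)^2"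
proof -
  obtain a1 a2 where a: "degree a1 \<le> n" "degree a2 \<le> n"
    "\<And>z. ev l1 z = 0 \<Longrightarrow> ev f z = poly a1 (ev m1 z) ^ 2 + poly a2 (ev m1 z) ^ 2"
    using square_split_line1[OF f pos] by blast
  have A: "\<exists>\<alpha>. \<exists>h\<in>polys_below n. \<forall>z. ev l1 z = 0 \<longrightarrow> poly a (ev m1 z) = \<alpha> * ev E z ^ n + ev l2 z * ev h z"
    if "degree a \<le> n" for a
  proof -
    have "homog n a 1 m1 \<in> polys_below (Suc n)"
      using homog_1_in[OF line_in(2)] by (simp add: polys_upto_eq)
    then obtain \<alpha> h1 h where "h \<in> polys_below n" "homog n a 1 m1 = cst \<alpha> * E ^ n + l1 * h1 + l2 * h"
      using glue_decomposition by blast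
    moreover have "poly a (ev m1 z) = ev (homog n a 1 m1) z" for z using that by (simp add: ev_homog_1)
    ultimately show ?thesis by (intro exI[of _ \<alpha>] bexI[of _ h]) auto
  qed
  obtain \<alpha>1 h1 where 1: "h1 \<in> polys_below n"
    "\<forall>z. ev l1 z = 0 \<longrightarrow> poly a1 (ev m1 z) = \<alpha>1 * ev E z ^ n + ev l2 z * ev h1 z" using A[OF a(1)] by blast
  obtain \<alpha>2 h2 where 2: "h2 \<in> polys_below n"
    "\<forall>z. ev l1 z = 0 \<longrightarrow> poly a2 (ev m1 z) = \<alpha>2 * ev E z ^ n + ev l2 z * ev h2 z" using A[OF a(2)] by blast
  have f_eq: "ev f z = (\<alpha>1 * ev E z ^ n + ev l2 z * ev h1 z)^2 + (\<alpha>2 * ev E z ^ n + ev l2 z * ev h2 z)^2"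
    if "ev l1 z = 0" for z using that a(3) 1(2) 2(2) by simp
  \<comment> \<open>On the first line, \<open>f\<close> minus the squares is a multiple of
    \<open>E ^ (2 * n)\<close> plus \<open>l2 * w\<close>, the form to which \<open>glue1\<close>
    applies.\<close>
  define w where "w = y - (E ^ n * (cst (2 * \<alpha>1) * h1 + cst (2 * \<alpha>2) * h2) + l2 * h1 * h1 + l2 * h2 * h2)"
  have "l2 * h1 \<in> polys_below (Suc n)" "l2 * h2 \<in> polys_below (Suc n)"
    using 1(1) 2(1) line_in by (auto intro: polys_below_affine_mult)
  then have "l2 * h1 * h1 \<in> polys_below (2 * n)" "l2 * h2 * h2 \<in> polys_below (2 * n)"
    using 1(1) 2(1) by (auto intro: polys_below_mult[of _ n _ n])
  moreover have "E ^ n * (cst (2 * \<alpha>1) * h1 + cst (2 * \<alpha>2) * h2) \<in> polys_below (2 * n)"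
    using 1(1) 2(1) E_in by (intro polys_below_mult[of _ n _ n] polys_below_affine_power) auto
  ultimately have "w \<in> polys_below (2 * n)"
    unfolding w_def using dec(2) by (intro polys_below_diff polys_below_add)
  then have "c - (\<alpha>1^2 + \<alpha>2^2) = 0"
  proof (rule glue1)
    fix z assume z: "ev l1 z = 0"
    have "c * ev E z ^ (2 * n) + ev l2 z * ev y z
        = (\<alpha>1 * ev E z ^ n + ev l2 z * ev h1 z)^2 + (\<alpha>2 * ev E z ^ n + ev l2 z * ev h2 z)^2"
      using f_eq[OF z] z unfolding dec(1) by simp
    moreover have "ev E z ^ (2 * n) = ev E z ^ n * ev E z ^ n" by (simp add: mult_2 power_add)
    ultimately show "(c - (\<alpha>1^2 + \<alpha>2^2)) * ev E z ^ (2 * n) + ev l2 z * ev w z = 0"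
      by (simp add: w_def power2_eq_square algebra_simps)
  qed
  then show ?thesis using 1(1) 2(1) f_eq by (intro that) auto
qed

text \<open>Each line yields two squares with the same sum \<open>c\<close> at the common point, but
  the individual values there may differ, so the squares cannot be glued one by one.\<close>

lemma sos_on_both_lines:
  assumes inf: "infinite (V \<inter> {z. ev l1 z = 0})" "infinite (V \<inter> {z. ev l2 z = 0})"
  shows sos_on_variety
proof (rule sos_on_varietyI)
  interpret sw: two_lines n L N V l2 l1 m2 m1 E by (rule swap)
  have inV: "z \<in> V \<longleftrightarrow> ev l1 z = 0 \<or> ev l2 z = 0" for z
    using N_vanishes_line1[OF inf(1)] sw.N_vanishes_line1[OF inf(2)] V_lines unfolding V_def by blast
  fix f assume f: "f \<in> polys_upto (2 * n)" "\<And>z. z \<in> V \<Longrightarrow> ev f z \<ge> 0"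
  have pos: "ev f z \<ge> 0" if "ev l1 z = 0 \<or> ev l2 z = 0" for z using f(2) inV that by blast
  obtain c x y where xy: "x \<in> polys_below (2 * n)" "y \<in> polys_below (2 * n)"
    "f = cst c * E ^ (2 * n) + l1 * x + l2 * y"
    using glue_decomposition[of f "2 * n"] f(1) by (auto simp: polys_upto_eq)
  obtain \<alpha>1 \<alpha>2 h1 h2 where h: "h1 \<in> polys_below n" "h2 \<in> polys_below n" and c\<alpha>: "c = \<alpha>1^2 + \<alpha>2^2"
    and f1: "\<And>z. ev l1 z = 0 \<Longrightarrow> ev f z = (\<alpha>1 * ev E z ^ n + ev l2 z * ev h1 z)^2 + (\<alpha>2 * ev E z ^ n + ev l2 z * ev h2 z)^2"
    using glued_squares_line1[OF f(1) _ xy(3,2)] pos by metis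
  have "f = cst c * E ^ (2 * n) + l2 * y + l1 * x" using xy(3) by simp
  then obtain \<beta>1 \<beta>2 k1 k2 where k: "k1 \<in> polys_below n" "k2 \<in> polys_below n" and c\<beta>: "c = \<beta>1^2 + \<beta>2^2"
    and f2: "\<And>z. ev l2 z = 0 \<Longrightarrow> ev f z = (\<beta>1 * ev E z ^ n + ev l1 z * ev k1 z)^2 + (\<beta>2 * ev E z ^ n + ev l1 z * ev k2 z)^2"
    using sw.glued_squares_line1[OF f(1) _ _ xy(1)] pos by metis
  have in_n: "l2 * h \<in> polys_upto n" "l1 * h \<in> polys_upto n" if "h \<in> polys_below n" for h
    using that line_in by (auto simp: polys_upto_eq intro: polys_below_affine_mult)
  have En: "E ^ n \<in> polys_upto n" using E_in by (auto simp: polys_upto_eq intro: polys_below_affine_power)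
  have "\<exists>gs. set gs \<subseteq> polys_upto n \<and> (\<forall>z. ev l1 z = 0 \<or> ev l2 z = 0 \<longrightarrow> ev (f - (\<Sum>g\<leftarrow>gs. g * g)) z = 0)"
  proof (cases "c = 0")
    case True
    \<comment> \<open>With value zero at the common point, the squares belonging to one line can be
      extended by zero to the other.\<close>
    then have 0: "\<alpha>1 = 0" "\<alpha>2 = 0" "\<beta>1 = 0" "\<beta>2 = 0" using c\<alpha> c\<beta> by (simp_all add: sum_power2_eq_zero_iff)
    show ?thesis
      by (rule exI[of _ "[l2 * h1, l2 * h2, l1 * k1, l1 * k2]"])
        (use in_n h k f1 f2 0 in \<open>auto simp: power2_eq_square\<close>)
  next
    case False
    then have "c > 0" using c\<alpha> by (simp add: less_le)
    define s where "s = 1 / sqrt c"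
    have s: "s * s * c = 1" using \<open>c > 0\<close> by (simp add: s_def)
    text \<open>The two representations agree at the common point only up to a rotation; the products
      \<open>\<alpha>\<^sub>i \<beta>\<^sub>j / sqrt c\<close> serve as common values for both lines.\<close>
    define F where "F \<alpha> h \<beta> k = cst s * (cst (\<alpha> * \<beta>) * E ^ n + cst \<beta> * (l2 * h) + cst \<alpha> * (l1 * k))" for \<alpha> h \<beta> k
    have F_in: "F \<alpha> h \<beta> k \<in> polys_upto n" if "h \<in> polys_below n" "k \<in> polys_below n" for \<alpha> h \<beta> k
      using in_n that En unfolding F_def polys_upto_eq by (intro polys_below_add polys_below_cmult)
    have F1: "ev (F \<alpha> h \<beta> k) z = s * \<beta> * (\<alpha> * ev E z ^ n + ev l2 z * ev h z)" if "ev l1 z = 0" for \<alpha> h \<beta> k z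
      using that by (simp add: F_def algebra_simps)
    have F2: "ev (F \<alpha> h \<beta> k) z = s * \<alpha> * (\<beta> * ev E z ^ n + ev l1 z * ev k z)" if "ev l2 z = 0" for \<alpha> h \<beta> k z
      using that by (simp add: F_def algebra_simps)
    let ?gs = "[F \<alpha>1 h1 \<beta>1 k1, F \<alpha>1 h1 \<beta>2 k2, F \<alpha>2 h2 \<beta>1 k1, F \<alpha>2 h2 \<beta>2 k2]"
    have "ev (f - (\<Sum>g\<leftarrow>?gs. g * g)) z = 0" if z: "ev l1 z = 0 \<or> ev l2 z = 0" for z
    proof (cases "ev l1 z = 0")
      case True
      define A B where "A = \<alpha>1 * ev E z ^ n + ev l2 z * ev h1 z" and "B = \<alpha>2 * ev E z ^ n + ev l2 z * ev h2 z"
      have "ev (F \<alpha>1 h1 \<beta>1 k1) z = s * \<beta>1 * A" "ev (F \<alpha>1 h1 \<beta>2 k2) z = s * \<beta>2 * A"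
        "ev (F \<alpha>2 h2 \<beta>1 k1) z = s * \<beta>1 * B" "ev (F \<alpha>2 h2 \<beta>2 k2) z = s * \<beta>2 * B"
        by (simp_all only: F1[OF True] A_def B_def)
      then have "ev (\<Sum>g\<leftarrow>?gs. g * g) z = (s * s * (\<beta>1^2 + \<beta>2^2)) * (A^2 + B^2)"
        by (simp add: power2_eq_square algebra_simps)
      then show ?thesis using f1[OF True] s c\<beta> by (simp add: A_def B_def)
    next
      case False
      then have z2: "ev l2 z = 0" using z by simp
      define A B where "A = \<beta>1 * ev E z ^ n + ev l1 z * ev k1 z" and "B = \<beta>2 * ev E z ^ n + ev l1 z * ev k2 z"
      have "ev (F \<alpha>1 h1 \<beta>1 k1) z = s * \<alpha>1 * A" "ev (F \<alpha>1 h1 \<beta>2 k2) z = s * \<alpha>1 * B"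
        "ev (F \<alpha>2 h2 \<beta>1 k1) z = s * \<alpha>2 * A" "ev (F \<alpha>2 h2 \<beta>2 k2) z = s * \<alpha>2 * B"
        by (simp_all only: F2[OF z2] A_def B_def)
      then have "ev (\<Sum>g\<leftarrow>?gs. g * g) z = (s * s * (\<alpha>1^2 + \<alpha>2^2)) * (A^2 + B^2)"
        by (simp add: power2_eq_square algebra_simps)
      then show ?thesis using f2[OF z2] s c\<alpha> by (simp add: A_def B_def)
    qed
    then show ?thesis using F_in h k by (intro exI[of _ ?gs]) auto
  qed
  then obtain gs where gs: "set gs \<subseteq> polys_upto n"
    "\<And>z. ev l1 z = 0 \<or> ev l2 z = 0 \<Longrightarrow> ev (f - (\<Sum>g\<leftarrow>gs. g * g)) z = 0" by blast
  have "(\<Sum>g\<leftarrow>gs. g * g) \<in> polys_upto (2 * n)" using gs(1)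
  proof (induction gs)
    case (Cons g gs)
    then show ?case using prod_in[of g g] by (auto simp: polys_upto_eq)
  qed (simp add: polys_upto_eq)
  then have "f - (\<Sum>g\<leftarrow>gs. g * g) \<in> polys_upto (2 * n)" using f(1) by (auto simp: polys_upto_eq)
  then have "L (f - (\<Sum>g\<leftarrow>gs. g * g)) = 0" using gs(2) by (rule L_zero_on_lines)
  then show "\<exists>gs. set gs \<subseteq> polys_upto n \<and> L (f - (\<Sum>g\<leftarrow>gs. g * g)) = 0 \<and>
      (\<forall>z\<in>V. ev (f - (\<Sum>g\<leftarrow>gs. g * g)) z = 0)"
    using gs inV by blast
qed

text \<open>\<open>V\<close> is infinite, so \<open>vanishing_in_N\<close> is silent and the kernel
  is studied directly. Dividing by \<open>l1\<close> turns it into univariate data on the second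
  line: a set \<open>M\<close> consisting of multiples of one \<open>G\<close>, and a functional
  \<open>ell\<close> that is nonnegative on \<open>\<kappa> * B^2\<close>. Positivity and minimality
  make the roots of \<open>G\<close> real and simple, which permits interpolation there.\<close>

lemma sos_on_one_line:
  assumes inf: "infinite (V \<inter> {z. ev l1 z = 0})" and fin: "finite (V \<inter> {z. ev l2 z = 0})"
  shows sos_on_variety
proof -
  interpret sw: two_lines n L N V l2 l1 m2 m1 E by (rule swap)
  obtain k where n: "n = Suc k" using n1 by (cases n) auto
  have onV1: "z \<in> V" if "ev l1 z = 0" for z
    using N_vanishes_line1[OF inf _ that] by (auto simp: V_def)
  have ih: "homog j h 1 m2 \<in> polys_below (Suc j)" for j h
    using homog_1_in[OF line_in(4)] by (simp add: polys_upto_eq)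
  have l1_in: "l1 * p \<in> polys_below (Suc j)" if "p \<in> polys_below j" for p j
    using that line_in(1) by (rule polys_below_affine_mult[rotated])
  define \<sigma> where "\<sigma> h = homog k h 1 m2" for h
  have \<sigma>_in: "\<sigma> h \<in> polys_below n" for h unfolding \<sigma>_def n by (rule ih)
  have ev_\<sigma>: "ev (\<sigma> h) z = poly h (ev m2 z)" if "degree h \<le> k" for h z
    unfolding \<sigma>_def using that by (rule ev_homog_1)
  have l1\<sigma>_in: "l1 * \<sigma> h \<in> polys_upto n" for h
    using l1_in[OF \<sigma>_in] by (simp add: polys_upto_eq)
  \<comment> \<open>\<open>h\<close> stands for \<open>l1 * h(m2)\<close>; the bound
    \<open>k = n - 1\<close> leaves room for the factor \<open>l1\<close>.\<close>
  define M where "M = {h. degree h \<le> k \<and> l1 * \<sigma> h \<in> N}"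
  define ell where "ell h = L (l1 * homog (2 * n - 1) h 1 m2)" for h
  have n2: "2 * n = Suc (2 * n - 1)" using n by simp
  \<comment> \<open>A multiple of \<open>l1\<close> vanishes on the first line, so \<open>L\<close>
    sees only its restriction to the second one, and \<open>ell\<close> can be computed from any
    representative.\<close>
  have ell_eq: "L (l1 * p) = ell h"
    if p: "p \<in> polys_below (2 * n)" and h: "degree h \<le> 2 * n - 1"
      and eq: "\<And>z. ev l2 z = 0 \<Longrightarrow> ev p z = poly h (ev m2 z)" for p h
  proof -
    have "L (l1 * p - l1 * homog (2 * n - 1) h 1 m2) = 0"
    proof (rule L_zero_on_lines)
      have "homog (2 * n - 1) h 1 m2 \<in> polys_below (2 * n)" using ih[of "2 * n - 1" h] n2 by simp
      then show "l1 * p - l1 * homog (2 * n - 1) h 1 m2 \<in> polys_upto (2 * n)"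
        using l1_in p by (auto simp: polys_upto_eq)
      show "ev (l1 * p - l1 * homog (2 * n - 1) h 1 m2) z = 0" if "ev l1 z = 0 \<or> ev l2 z = 0" for z
        using that eq[of z] ev_homog_1[OF h, of m2 z] unfolding ev_simps by auto
    qed
    then show ?thesis by (simp add: L_simps ell_def)
  qed
  have ell_add: "ell (g + h) = ell g + ell h" for g h
    by (simp add: ell_def homog_add distrib_left L_simps)
  have ell_smult: "ell ([:c:] * h) = c * ell h" for c h
  proof -
    have "homog (2 * n - 1) ([:c:] * h) 1 m2 = cst c * homog (2 * n - 1) h 1 m2"
      by (simp add: homog_def sum_distrib_left cst_mult mult.assoc)
    then show ?thesis by (simp add: ell_def L_simps mult.left_commute[of l1 "cst c"])
  qed
  have N_M: "\<exists>h\<in>M. \<forall>z. ev l2 z = 0 \<longrightarrow> ev p z = ev l1 z * poly h (ev m2 z)" if p: "p \<in> N" for p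
  proof -
    obtain q where q: "q \<in> polys_below n" "p = l1 * q"
      using line_vanishing[OF fr1 _ infinite_UNIV_char_0[where 'a = real], of p n]
        N_D(1)[OF p] N_vanishes_line1[OF inf p] by (auto simp: polys_upto_eq)
    obtain h where h: "degree h \<le> k" "\<forall>z. ev l2 z = 0 \<longrightarrow> ev q z = poly h (ev m2 z)"
      using sw.restrict1[of q k] q(1) n by blast
    have "L (l1 * \<sigma> h * r) = 0" if r: "r \<in> polys_upto n" for r
    proof -
      have "L (p * r - l1 * \<sigma> h * r) = 0"
      proof (rule L_zero_on_lines)
        show "p * r - l1 * \<sigma> h * r \<in> polys_upto (2 * n)"
          using prod_in[OF N_D(1)[OF p] r] prod_in[OF l1\<sigma>_in r] by (auto simp: polys_upto_eq)
        show "ev (p * r - l1 * \<sigma> h * r) z = 0" if "ev l1 z = 0 \<or> ev l2 z = 0" for z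
          using that h(2) by (cases z) (auto simp: q(2) ev_\<sigma>[OF h(1)])
      qed
      then show ?thesis using N_D(2)[OF p r] by (simp add: L_simps)
    qed
    then have "h \<in> M" using h(1) l1\<sigma>_in by (simp add: M_def N_def)
    then show ?thesis using h(2) q(2) by (intro bexI[of _ h]) auto
  qed
  have M_comb: "g + [:c:] * h \<in> M" if "g \<in> M" "h \<in> M" for g h c
  proof -
    have "\<sigma> (g + [:c:] * h) = \<sigma> g + cst c * \<sigma> h"
      by (simp add: \<sigma>_def homog_add) (simp add: homog_def sum_distrib_left cst_mult mult.assoc)
    then have eq: "l1 * \<sigma> (g + [:c:] * h) = l1 * \<sigma> g + cst c * (l1 * \<sigma> h)" by (simp add: distrib_left mult.left_commute)
    have "L ((l1 * \<sigma> g + cst c * (l1 * \<sigma> h)) * r) = 0" if "r \<in> polys_upto n" for r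
      using \<open>g \<in> M\<close> \<open>h \<in> M\<close> that N_D(2) by (simp add: M_def distrib_right mult.assoc[of "cst c"] L_simps)
    from this[folded eq] have "l1 * \<sigma> (g + [:c:] * h) \<in> N"
      using l1\<sigma>_in[of "g + [:c:] * h"] unfolding N_def by blast
    moreover have "degree (g + [:c:] * h) \<le> k"
      using that degree_mult_le[of "[:c:]" h] by (intro degree_add_le) (auto simp: M_def)
    ultimately show ?thesis by (simp add: M_def)
  qed
  have M_0: "0 \<in> M"
    using N_D(1) by (auto simp: M_def \<sigma>_def N_def polys_upto_eq L_simps)
  \<comment> \<open>Multiplication by \<open>m2\<close> stays in the kernel by recursive generation;
    the degree bound keeps the product within degree \<open>n\<close>.\<close>
  have M_t: "pCons 0 h \<in> M" if h: "h \<in> M" and d: "degree (pCons 0 h) \<le> k" for h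
  proof (cases "h = 0")
    case False
    then obtain j where k: "k = Suc j" "degree h \<le> j" using d by (cases k) auto
    have \<sigma>h: "\<sigma> h = homog j h 1 m2" unfolding \<sigma>_def k(1) homog_Suc[OF k(2)] by simp
    then have "l1 * \<sigma> h \<in> polys_below n" using l1_in[OF ih[of j h]] by (simp add: n k(1))
    then have "l1 * \<sigma> h * m2 \<in> polys_upto n"
      using line_in(4) polys_below_affine_mult[of m2 "l1 * \<sigma> h" n] by (simp add: polys_upto_eq mult.commute)
    moreover have "m2 \<in> polys_upto n" using line_in(4) n by (auto simp: polys_upto_eq intro: polys_below_mono)
    ultimately have "l1 * \<sigma> h * m2 \<in> N" using h recursive[of "l1 * \<sigma> h" m2] by (simp add: M_def)
    moreover have "l1 * \<sigma> h * m2 = l1 * \<sigma> (pCons 0 h)"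
      unfolding \<sigma>h by (simp add: \<sigma>_def k(1) homog_pCons mult_ac)
    ultimately show ?thesis using d by (simp add: M_def)
  qed (use M_0 in simp)
  have M_mult: "g * s \<in> M" if "g \<in> M" "degree g + degree s \<le> k" for g s
    using that(2)
  proof (induction s)
    case 0
    show ?case using M_0 by simp
  next
    case (pCons a s)
    have eq: "g * pCons a s = pCons 0 (g * s) + [:a:] * g" by (simp add: mult.commute)
    have "pCons 0 (g * s) \<in> M"
    proof (cases "s = 0")
      case False
      then have d: "degree g + Suc (degree s) \<le> k" using pCons.prems by simp
      then have "g * s \<in> M" by (intro pCons.IH) simp
      moreover have "degree (pCons 0 (g * s)) \<le> k"
        using d degree_mult_le[of g s] by (intro order_trans[OF degree_pCons_le]) simp
      ultimately show ?thesis by (rule M_t)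
    qed (use M_0 in simp)
    then show ?case unfolding eq using that(1) by (rule M_comb)
  qed
  \<comment> \<open>Otherwise the kernel would vanish on the whole second line, which would then lie
    in \<open>V\<close>.\<close>
  have "\<exists>h\<in>M. h \<noteq> 0"
  proof (rule ccontr)
    assume "\<not> ?thesis"
    then have "ev p z = 0" if "p \<in> N" "ev l2 z = 0" for p z
      using N_M[OF that(1)] that(2) by (metis mult_zero_right poly_0)
    then have "{z. ev l2 z = 0} \<subseteq> V \<inter> {z. ev l2 z = 0}" unfolding V_def by blast
    then show False using fin sw.infinite_line1 finite_subset by blast
  qed
  then obtain G where G: "G \<in> M" "G \<noteq> 0" and Gmin: "\<And>h. h \<in> M \<Longrightarrow> h \<noteq> 0 \<Longrightarrow> degree G \<le> degree h"
    using ex_has_least_nat[of "\<lambda>h. h \<in> M \<and> h \<noteq> 0" _ degree] by blast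
  have dG: "degree G \<le> k" using G(1) by (simp add: M_def)
  have G_dvd: "G dvd h" if h: "h \<in> M" for h
  proof -
    define q where "q = h div G"
    have hq: "h = G * q + h mod G" by (simp add: q_def)
    have "degree h \<le> k" using h by (simp add: M_def)
    moreover have "degree G + degree q \<le> degree h" if "q \<noteq> 0"
    proof (rule ccontr)
      assume neg: "\<not> ?thesis"
      moreover have dGq: "degree (G * q) = degree G + degree q" using G(2) that by (rule degree_mult_eq)
      moreover have "h mod G = 0 \<or> degree (h mod G) < degree G" using degree_mod_less[OF G(2)] .
      ultimately have "degree (h mod G) < degree (G * q)" using that by auto
      then have "degree (G * q + h mod G) = degree (G * q)" by (rule degree_add_eq_left)
      then have "degree h = degree (G * q)" using hq by metis
      then show False using neg dGq by simp
    qed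
    ultimately have "G * q \<in> M" using M_0 by (cases "q = 0") (auto intro: M_mult[OF G(1)])
    then have "h + [:-1:] * (G * q) \<in> M" by (rule M_comb[OF h])
    moreover have "h + [:-1:] * (G * q) = h mod G" by (simp add: q_def minus_mult_div_eq_mod)
    ultimately have "h mod G = 0"
      using Gmin[of "h mod G"] degree_mod_less[OF G(2), of h] by force
    then show ?thesis by (simp add: mod_eq_0_iff_dvd)
  qed
  have ell_M: "ell (h * s) = 0" if h: "h \<in> M" and s: "degree s \<le> n" for h s
  proof -
    have hs: "degree h \<le> k" "l1 * \<sigma> h \<in> N" using h by (auto simp: M_def)
    have hom: "homog n s 1 m2 \<in> polys_upto n" using ih by (simp add: polys_upto_eq)
    have "L (l1 * (\<sigma> h * homog n s 1 m2)) = ell (h * s)"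
    proof (rule ell_eq)
      show "\<sigma> h * homog n s 1 m2 \<in> polys_below (2 * n)"
        by (subst mult.commute, rule polys_below_mult[OF ih \<sigma>_in]) simp
      show "degree (h * s) \<le> 2 * n - 1" using hs(1) s degree_mult_le[of h s] n by simp
    qed (simp add: ev_\<sigma>[OF hs(1)] ev_homog_1[OF s])
    moreover have "L (l1 * (\<sigma> h * homog n s 1 m2)) = 0"
      using N_D(2)[OF hs(2) hom] by (simp add: mult.assoc)
    ultimately show ?thesis by simp
  qed
  \<comment> \<open>The cofactor may exceed degree \<open>n\<close>; it is cut there, and the high
    part joins \<open>G\<close> inside \<open>M\<close>.\<close>
  have ell_G: "ell (G * q) = 0" if q: "degree G + degree q \<le> 2 * n - 1" for q
  proof -
    have "degree q \<le> n + (k - degree G)" using q dG n by simp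
    then obtain lo hi where lh: "q = lo + Polynomial.monom 1 n * hi" "degree lo \<le> n" "degree hi \<le> k - degree G"
      by (rule poly_split_at)
    have "G * hi \<in> M" using lh(3) dG by (intro M_mult[OF G(1)]) simp
    then have "ell ((G * hi) * Polynomial.monom 1 n) = 0" by (intro ell_M) (auto simp: degree_monom_eq)
    moreover have "ell (G * lo) = 0" using G(1) lh(2) by (rule ell_M)
    moreover have "G * q = G * lo + (G * hi) * Polynomial.monom 1 n" by (simp add: lh(1) algebra_simps)
    ultimately show ?thesis by (simp add: ell_add)
  qed
  obtain \<kappa> where \<kappa>: "degree \<kappa> \<le> 1" "\<forall>z. ev l2 z = 0 \<longrightarrow> ev l1 z = poly \<kappa> (ev m2 z)"
    using sw.restrict1[of l1 1] line_in(1) by (auto simp: numeral_2_eq_2)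
  \<comment> \<open>In the square of \<open>l1 * \<sigma> B\<close> one factor \<open>l1\<close> is
    spent on \<open>ell\<close>; the other becomes the weight \<open>\<kappa>\<close>, the
    restriction of \<open>l1\<close> to the second line.\<close>
  have ell_sq: "ell (\<kappa> * B^2) \<ge> 0" "ell (\<kappa> * B^2) = 0 \<Longrightarrow> B \<in> M" if B: "degree B \<le> k" for B
  proof -
    have "L (l1 * (l1 * \<sigma> B * \<sigma> B)) = ell (\<kappa> * B^2)"
    proof (rule ell_eq)
      show "l1 * \<sigma> B * \<sigma> B \<in> polys_below (2 * n)"
        by (rule polys_below_mult[OF l1_in[OF \<sigma>_in] \<sigma>_in]) simp
      have "degree (\<kappa> * B^2) \<le> 1 + 2 * k"
        using \<kappa>(1) B degree_mult_le[of \<kappa> "B^2"] degree_power_le[of B 2] by linarith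
      then show "degree (\<kappa> * B^2) \<le> 2 * n - 1" by (simp add: n)
    qed (use \<kappa>(2) in \<open>auto simp: ev_\<sigma>[OF B] power2_eq_square\<close>)
    then have eq: "ell (\<kappa> * B^2) = L ((l1 * \<sigma> B) * (l1 * \<sigma> B))" by (simp add: mult_ac)
    show "ell (\<kappa> * B^2) \<ge> 0" unfolding eq by (rule psd[OF l1\<sigma>_in])
    show "B \<in> M" if "ell (\<kappa> * B^2) = 0"
      using null_square_in_N[OF l1\<sigma>_in] that B by (simp add: eq M_def)
  qed
  have min_contra: False if "B \<noteq> 0" "degree B < degree G" "ell (\<kappa> * B^2) = 0" for B
    using ell_sq(2)[of B] Gmin[of B] that dG by simp
  have deg_factor: "degree G = degree u + degree B" "B \<noteq> 0" if "G = u * B" for u B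
    using that G(2) by (auto simp: degree_mult_eq)
  \<comment> \<open>minimality of \<open>G\<close> makes \<open>\<kappa> G\<close> a product of distinct real linear factors\<close>
  have simple: "\<not> [:-r, 1:]^2 dvd G" for r
  proof
    assume "[:-r, 1:]^2 dvd G"
    then obtain B where B: "G = [:-r, 1:]^2 * B" by (rule dvdE)
    define u where "u = [:-r, 1:]"
    have du: "degree u = 1" "u \<noteq> 0" by (simp_all add: u_def)
    have G': "G = u * (u * B)" by (simp add: B u_def power2_eq_square mult.assoc del: mult_pCons_left)
    have dB: "degree G = Suc (degree (u * B))" "u * B \<noteq> 0" "degree (u * B) = Suc (degree B)" "B \<noteq> 0"
      using deg_factor[OF G'] du by (auto simp: degree_mult_eq)
    have "degree (\<kappa> * B) \<le> 1 + degree B" using \<kappa>(1) degree_mult_le[of \<kappa> B] by linarith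
    then have "ell (G * (\<kappa> * B)) = 0" using dB dG n by (intro ell_G) simp
    \<comment> \<open>A double root would make \<open>u * B\<close>, of smaller degree than
      \<open>G\<close>, a null vector of the weighted form.\<close>
    moreover have "G * (\<kappa> * B) = \<kappa> * (u * B)^2" by (simp add: G' power2_eq_square mult_ac)
    ultimately show False using min_contra[of "u * B"] dB by simp
  qed
  have \<kappa>G: "poly \<kappa> r \<noteq> 0" if r: "poly G r = 0" for r
  proof
    assume "poly \<kappa> r = 0"
    define u where "u = [:-r, 1:]"
    have du: "degree u = 1" "u \<noteq> 0" by (simp_all add: u_def)
    obtain B where B: "G = u * B" using r by (auto simp: poly_eq_0_iff_dvd u_def elim: dvdE)
    obtain \<kappa>' where \<kappa>': "\<kappa> = u * \<kappa>'" using \<open>poly \<kappa> r = 0\<close> by (auto simp: poly_eq_0_iff_dvd u_def elim: dvdE)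
    have "degree \<kappa>' = 0" using \<kappa>(1) du by (cases "\<kappa>' = 0") (auto simp: \<kappa>' degree_mult_eq)
    then have "degree (\<kappa>' * B) \<le> degree B" using degree_mult_le[of \<kappa>' B] by simp
    then have "ell (G * (\<kappa>' * B)) = 0" using deg_factor[OF B] du dG n by (intro ell_G) simp
    moreover have "G * (\<kappa>' * B) = \<kappa> * B^2" by (simp add: B \<kappa>' power2_eq_square mult_ac)
    ultimately show False using min_contra[of B] deg_factor[OF B] du by simp
  qed
  have real: "\<not> [:a^2 + b^2, -2 * a, 1:] dvd G" if b: "b \<noteq> 0" for a b
  proof
    assume "[:a^2 + b^2, -2 * a, 1:] dvd G"
    then obtain B where B: "G = [:a^2 + b^2, -2 * a, 1:] * B" by (rule dvdE)
    define u where "u = [:-a, 1:]"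
    have Q: "[:a^2 + b^2, -2 * a, 1:] = u^2 + [:b^2:]" by (simp add: u_def power2_eq_square)
    have dB: "degree G = degree B + 2" "B \<noteq> 0" using deg_factor[OF B] by simp_all
    have duB: "degree (u * B) \<le> Suc (degree B)" using degree_mult_le[of u B] by (simp add: u_def)
    have "degree (\<kappa> * B) \<le> 1 + degree B" using \<kappa>(1) degree_mult_le[of \<kappa> B] by linarith
    then have 0: "ell (G * (\<kappa> * B)) = 0" using dB dG n by (intro ell_G) simp
    have expand: "(u^2 + v) * B * (\<kappa> * B) = \<kappa> * (u * B)^2 + v * (\<kappa> * B^2)" for v
      by (simp add: power2_eq_square algebra_simps)
    \<comment> \<open>Under \<open>ell\<close> the left side is zero and both terms on the right are
      nonnegative, so \<open>B\<close> is a null vector of too small degree.\<close>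
    have "G * (\<kappa> * B) = \<kappa> * (u * B)^2 + [:b^2:] * (\<kappa> * B^2)"
      unfolding B Q by (rule expand)
    then have "ell (\<kappa> * (u * B)^2) + b^2 * ell (\<kappa> * B^2) = 0"
      using 0 by (simp only: ell_add ell_smult)
    moreover have "ell (\<kappa> * (u * B)^2) \<ge> 0" "ell (\<kappa> * B^2) \<ge> 0" using duB dB dG by (intro ell_sq; simp)+
    ultimately have "b^2 * ell (\<kappa> * B^2) \<le> 0" by linarith
    then have "ell (\<kappa> * B^2) = 0" using \<open>ell (\<kappa> * B^2) \<ge> 0\<close> b by (simp add: mult_le_0_iff)
    then show False using min_contra[of B] dB by simp
  qed
  define S where "S = {r. poly G r = 0}"
  have S: "finite S" "card S \<le> Suc k"
    using poly_roots_finite[OF G(2)] card_poly_roots_bound[OF G(2)] dG by (simp_all add: S_def)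
  have SV: "sw.pt1 r \<in> V" if r: "r \<in> S" for r
  proof -
    have "ev p (sw.pt1 r) = 0" if p: "p \<in> N" for p
    proof -
      obtain h where h: "h \<in> M" "\<forall>z. ev l2 z = 0 \<longrightarrow> ev p z = ev l1 z * poly h (ev m2 z)" using N_M[OF p] by blast
      have "poly h r = 0" using G_dvd[OF h(1)] r by (auto simp: S_def elim: dvdE)
      then show ?thesis using h(2) sw.pt1[of r] by (metis mult_zero_right)
    qed
    then show ?thesis by (simp add: V_def)
  qed
  show ?thesis
  proof (rule sos_on_varietyI)
    fix f assume f: "f \<in> polys_upto (2 * n)" "\<And>z. z \<in> V \<Longrightarrow> ev f z \<ge> 0"
    obtain a1 a2 where a: "degree a1 \<le> n" "degree a2 \<le> n"
      "\<And>z. ev l1 z = 0 \<Longrightarrow> ev f z = poly a1 (ev m1 z) ^ 2 + poly a2 (ev m1 z) ^ 2"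
      using square_split_line1[OF f(1)] f(2) onV1 by metis
    define A where "A a = homog n a 1 m1" for a
    have A_in: "A a \<in> polys_upto n" for a unfolding A_def by (rule homog_1_in[OF line_in(2)])
    \<comment> \<open>Adding \<open>l1 * \<sigma> b\<close> does not change the values on the first
      line and adjusts those at the roots of \<open>G\<close> arbitrarily, because
      \<open>\<kappa>\<close> is nonzero there.\<close>
    have correct: "\<exists>b. degree b \<le> k \<and> (\<forall>r\<in>S. ev (A a) (sw.pt1 r) + poly \<kappa> r * poly b r = y r)" for a and y :: "real \<Rightarrow> real"
    proof -
      obtain b where b: "degree b \<le> k" "\<forall>r\<in>S. poly b r = (y r - ev (A a) (sw.pt1 r)) / poly \<kappa> r"
        using poly_interpolation[OF S, of "\<lambda>r. (y r - ev (A a) (sw.pt1 r)) / poly \<kappa> r"] by blast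
      have "ev (A a) (sw.pt1 r) + poly \<kappa> r * poly b r = y r" if "r \<in> S" for r
        using b(2) that \<kappa>G[of r] by (auto simp: S_def)
      then show ?thesis using b(1) by blast
    qed
    \<comment> \<open>At the roots of \<open>G\<close> the first square carries the whole value of
      \<open>f\<close>; the second is made zero.\<close>
    obtain b1 where b1: "degree b1 \<le> k"
      "\<forall>r\<in>S. ev (A a1) (sw.pt1 r) + poly \<kappa> r * poly b1 r = sqrt (ev f (sw.pt1 r))"
      using correct[of a1 "\<lambda>r. sqrt (ev f (sw.pt1 r))"] by blast
    obtain b2 where b2: "degree b2 \<le> k" "\<forall>r\<in>S. ev (A a2) (sw.pt1 r) + poly \<kappa> r * poly b2 r = 0"
      using correct[of a2 "\<lambda>_. 0"] by blast
    define F1 where "F1 = A a1 + l1 * \<sigma> b1"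
    define F2 where "F2 = A a2 + l1 * \<sigma> b2"
    have F_in: "F1 \<in> polys_upto n" "F2 \<in> polys_upto n"
      using A_in l1\<sigma>_in by (auto simp: F1_def F2_def polys_upto_eq)
    define w where "w = f - (F1 * F1 + F2 * F2)"
    have w_in: "w \<in> polys_upto (2 * n)"
      using f(1) prod_in[OF F_in(1) F_in(1)] prod_in[OF F_in(2) F_in(2)] by (auto simp: w_def polys_upto_eq)
    have w1: "ev w z = 0" if z: "ev l1 z = 0" for z
      using z a(3)[OF z] by (simp add: w_def F1_def F2_def A_def ev_homog_1[OF a(1)] ev_homog_1[OF a(2)] power2_eq_square)
    have w2: "ev w (sw.pt1 r) = 0" if r: "r \<in> S" for r
    proof -
      have l1r: "ev l1 (sw.pt1 r) = poly \<kappa> r" using \<kappa>(2) sw.pt1[of r] by metis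
      have "ev F1 (sw.pt1 r) = sqrt (ev f (sw.pt1 r))" "ev F2 (sw.pt1 r) = 0"
        using b1(2) b2(2) r by (simp_all add: F1_def F2_def l1r ev_\<sigma>[OF b1(1)] ev_\<sigma>[OF b2(1)] sw.pt1)
      then show ?thesis using f(2)[OF SV[OF r]] by (simp add: w_def)
    qed
    obtain q where q: "q \<in> polys_below (2 * n)" "w = l1 * q"
      using line_vanishing[OF fr1 _ infinite_UNIV_char_0[where 'a = real], of w "2 * n"] w_in w1
      by (auto simp: polys_upto_eq)
    obtain h where h: "degree h \<le> 2 * n - 1" "\<forall>z. ev l2 z = 0 \<longrightarrow> ev q z = poly h (ev m2 z)"
      using sw.restrict1[of q "2 * n - 1"] q(1) n2 by auto
    have hr: "poly h r = 0" if r: "poly G r = 0" for r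
    proof -
      have "ev l1 (sw.pt1 r) = poly \<kappa> r" using \<kappa>(2) sw.pt1[of r] by metis
      moreover have "ev q (sw.pt1 r) = poly h r" using h(2) sw.pt1[of r] by metis
      ultimately show ?thesis using w2[of r] r \<kappa>G[OF r] by (simp add: S_def q(2))
    qed
    \<comment> \<open>With simple real roots, vanishing at the roots is divisibility by
      \<open>G\<close>, and \<open>ell\<close> annihilates such multiples.\<close>
    have "G dvd h" by (rule real_rooted_dvd[OF G(2) simple real hr])
    then obtain s where s: "h = G * s" by (rule dvdE)
    have "ell h = 0"
    proof (cases "s = 0")
      case True
      then show ?thesis using ell_G[of 0] dG n s by simp
    next
      case False
      then have "degree G + degree s \<le> 2 * n - 1" using h(1) G(2) by (simp add: s degree_mult_eq)
      then show ?thesis unfolding s by (rule ell_G)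
    qed
    moreover have "L (l1 * q) = ell h" using q(1) h by (intro ell_eq) auto
    ultimately have Lw: "L w = 0" by (simp add: q(2))
    have "ev w z = 0" if z: "z \<in> V" for z
    proof (cases "ev l1 z = 0")
      case False
      then have z2: "ev l2 z = 0" using V_lines z by blast
      \<comment> \<open>This kernel element forces every point of \<open>V\<close> off the first
        line to sit at a root of \<open>G\<close>.\<close>
      have "l1 * \<sigma> G \<in> N" using G(1) by (simp add: M_def)
      then have "ev (l1 * \<sigma> G) z = 0" using z by (rule N_D(3))
      then have "ev m2 z \<in> S" using False by (simp add: ev_\<sigma>[OF dG] S_def)
      then show ?thesis using w2 sw.pt1_m1[OF z2] by metis
    qed (rule w1)
    moreover have "f - (\<Sum>g\<leftarrow>[F1, F2]. g * g) = w" by (simp add: w_def)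
    ultimately show "\<exists>gs. set gs \<subseteq> polys_upto n \<and> L (f - (\<Sum>g\<leftarrow>gs. g * g)) = 0 \<and>
        (\<forall>z\<in>V. ev (f - (\<Sum>g\<leftarrow>gs. g * g)) z = 0)"
      using F_in Lw by (metis (no_types, lifting) empty_set empty_subsetI insert_subset list.simps(15))
  qed
qed

section \<open>Finite varieties on two lines\<close>

lemma card_line1:
  assumes fin: "finite V"
  shows "card (V \<inter> {z. ev l1 z = 0}) \<le> n"
proof -
  have "\<not> {z. ev l1 z = 0} \<subseteq> V" using fin infinite_line1 finite_subset by blast
  \<comment> \<open>A kernel element that survives on the line restricts to a nonzero polynomial of
    degree at most \<open>n\<close>.\<close>
  then obtain p z where p: "p \<in> N" "ev l1 z = 0" "ev p z \<noteq> 0" by (auto simp: V_def)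
  obtain g where g: "degree g \<le> n" "\<forall>z. ev l1 z = 0 \<longrightarrow> ev p z = poly g (ev m1 z)"
    using restrict1[of p n] N_D(1)[OF p(1)] by (auto simp: polys_upto_eq)
  have g0: "g \<noteq> 0" using g(2) p(2,3) by (metis poly_0)
  have "ev m1 ` (V \<inter> {z. ev l1 z = 0}) \<subseteq> {t. poly g t = 0}"
  proof (rule subsetI, elim imageE IntE CollectE, intro CollectI)
    fix t z assume t: "t = ev m1 z" "z \<in> V" "ev l1 z = 0"
    then have "ev p z = poly g (ev m1 z)" using g(2) by blast
    then show "poly g t = 0" using t N_D(3)[OF p(1), of z] by simp
  qed
  then have "card (ev m1 ` (V \<inter> {z. ev l1 z = 0})) \<le> card {t. poly g t = 0}"
    using poly_roots_finite[OF g0] by (intro card_mono)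
  moreover have "card (ev m1 ` (V \<inter> {z. ev l1 z = 0})) = card (V \<inter> {z. ev l1 z = 0})"
    using inj_m1 by (intro card_image) (metis Int_lower2 inj_on_subset)
  ultimately show ?thesis using card_poly_roots_bound[OF g0] g(1) by linarith
qed

text \<open>The factor \<open>l2\<close> makes the solution vanish on the second line, so the lines
  can be interpolated independently. It costs one degree, and the remaining \<open>n - 1\<close>
  still serves \<open>n\<close> nodes.\<close>

lemma interpolation_line1:
  assumes fin: "finite W" "card W \<le> n" and W: "\<And>v. v \<in> W \<Longrightarrow> ev l1 v = 0 \<and> ev l2 v \<noteq> 0"
  shows "\<exists>h\<in>polys_below n. \<forall>v\<in>W. ev (l2 * h) v = y v"
proof -
  obtain k where n: "n = Suc k" using n1 by (cases n) auto
  have "card (ev m1 ` W) \<le> Suc k" using card_image_le[OF fin(1), of "ev m1"] fin(2) n by simp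
  then obtain b where b: "degree b \<le> k" "\<forall>r\<in>ev m1 ` W. poly b r = y (pt1 r) / ev l2 (pt1 r)"
    using poly_interpolation[of "ev m1 ` W" k "\<lambda>r. y (pt1 r) / ev l2 (pt1 r)"] fin(1) by blast
  have "ev (l2 * homog k b 1 m1) v = y v" if v: "v \<in> W" for v
  proof -
    have "poly b (ev m1 v) = y v / ev l2 v" using b(2) v W[OF v] by (simp add: pt1_m1)
    then show ?thesis using W[OF v] by (simp add: ev_homog_1[OF b(1)])
  qed
  moreover have "homog k b 1 m1 \<in> polys_below n"
    using homog_1_in[OF line_in(2)] n by (simp add: polys_upto_eq)
  ultimately show ?thesis by blast
qed

text \<open>\<open>F0\<close> does not vanish at the common point of the lines; it is needed when the line
  \<open>l\<^sub>1 = 0\<close> carries the maximal number \<open>n\<close> of points of the variety.\<close>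

lemma vanishing_line1:
  assumes fin: "finite V"
    and inN: "\<And>p. p \<in> polys_upto n \<Longrightarrow> (\<And>v. v \<in> V \<Longrightarrow> ev p v = 0) \<Longrightarrow> p \<in> N"
    and F0: "(\<And>v. v \<in> V \<Longrightarrow> \<not> (ev l1 v = 0 \<and> ev l2 v = 0)) \<Longrightarrow>
      \<exists>k1\<in>polys_below n. \<exists>k2\<in>polys_below n. E ^ n + l1 * k1 + l2 * k2 \<in> N"
    and y: "y \<in> polys_below (2 * n)" "\<And>v. v \<in> V \<Longrightarrow> ev l1 v = 0 \<Longrightarrow> ev l2 v \<noteq> 0 \<Longrightarrow> ev y v = 0"
  shows "L (l2 * y) = 0"
proof -
  obtain k where n: "n = Suc k" using n1 by (cases n) auto
  have n2: "2 * n = Suc (2 * n - 1)" using n by simp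
  have ih: "homog j h 1 m1 \<in> polys_below (Suc j)" for j h
    using homog_1_in[OF line_in(2)] by (simp add: polys_upto_eq)
  have ihk: "l2 * homog k h 1 m1 \<in> polys_upto n" for h
    using polys_below_affine_mult[OF line_in(3) ih] by (simp add: polys_upto_eq n)
  have l2y: "l2 * y \<in> polys_upto (2 * n)"
    using polys_below_affine_mult[OF line_in(3) y(1)] by (simp add: polys_upto_eq)
  obtain g where g: "degree g \<le> 2 * n - 1" "\<forall>z. ev l1 z = 0 \<longrightarrow> ev y z = poly g (ev m1 z)"
    using restrict1[of y "2 * n - 1"] y(1) n2 by auto
  define W where "W = {v \<in> V. ev l1 v = 0 \<and> ev l2 v \<noteq> 0}"
  have finW: "finite W" using fin by (simp add: W_def)
  define S where "S = ev m1 ` W"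
  have finS: "finite S" using finW by (simp add: S_def)
  have "inj_on (ev m1) W" by (rule inj_on_subset[OF inj_m1]) (auto simp: W_def)
  then have cS: "card S = card W" unfolding S_def by (rule card_image)
  have WV: "W \<subseteq> V \<inter> {z. ev l1 z = 0}" by (auto simp: W_def)
  have cW: "card W \<le> card (V \<inter> {z. ev l1 z = 0})" using fin by (intro card_mono WV) auto
  have cWn: "card W \<le> n" using cW card_line1[OF fin] by simp
  have "poly g t = 0" if t: "t \<in> S" for t
  proof -
    obtain v where v: "v \<in> V" "ev l1 v = 0" "ev l2 v \<noteq> 0" "t = ev m1 v" using t by (auto simp: S_def W_def)
    then have "ev y v = poly g (ev m1 v)" using g(2) by blast
    then show ?thesis using v y(2) by simp
  qed
  then have "root_poly S dvd g" using finS by (intro root_poly_dvd)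
  then obtain q where q: "g = root_poly S * q" by (rule dvdE)
  have dq: "degree q \<le> 2 * k + 1 - card W"
  proof (cases "q = 0")
    case False
    then have "degree g = card W + degree q" by (simp add: q degree_mult_eq cS)
    then show ?thesis using g(1) n by simp
  qed simp
  have PN: "l2 * homog k (root_poly S * h) 1 m1 \<in> N" if "degree (root_poly S * h) \<le> k" for h
  proof (rule inN[OF ihk])
    fix v assume v: "v \<in> V"
    show "ev (l2 * homog k (root_poly S * h) 1 m1) v = 0"
    proof (cases "ev l1 v = 0 \<and> ev l2 v \<noteq> 0")
      case True
      then have "ev m1 v \<in> S" using v by (auto simp: S_def W_def)
      then show ?thesis using finS by (simp add: ev_homog_1[OF that])
    next
      case False
      then have "ev l2 v = 0" using V_lines v by blast
      then show ?thesis by simp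
    qed
  qed
  \<comment> \<open>With at most \<open>n - 1\<close> points, \<open>l2\<close> times the root
    polynomial lies in the kernel and the cofactor is split as before. With \<open>n\<close> points
    that product has degree \<open>n + 1\<close>, so a kernel element that is nonzero at the common
    point takes its place.\<close>
  show ?thesis
  proof (cases "card W \<le> k")
    case True
    have "degree q \<le> n + (k - card W)" using dq True n by simp
    then obtain lo hi where lh: "q = lo + Polynomial.monom 1 n * hi" "degree lo \<le> n" "degree hi \<le> k - card W"
      by (rule poly_split_at)
    have d1: "degree (root_poly S * 1) \<le> k" using True cS by simp
    have d2: "degree (root_poly S * hi) \<le> k"
      using degree_mult_le[of "root_poly S" hi] lh(3) True cS by simp
    let ?P1 = "l2 * homog k (root_poly S * 1) 1 m1" and ?P2 = "l2 * homog k (root_poly S * hi) 1 m1"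
    let ?Q1 = "homog n lo 1 m1" and ?Q2 = "homog n (Polynomial.monom 1 n) 1 m1"
    have dm: "degree (Polynomial.monom (1::real) n) \<le> n" by (simp add: degree_monom_eq)
    have Q: "?Q1 \<in> polys_upto n" "?Q2 \<in> polys_upto n" using ih by (simp_all add: polys_upto_eq)
    have "L (l2 * y - (?P1 * ?Q1 + ?P2 * ?Q2)) = 0"
    proof (rule L_zero_on_lines)
      show "l2 * y - (?P1 * ?Q1 + ?P2 * ?Q2) \<in> polys_upto (2 * n)"
        using l2y prod_in[OF ihk Q(1)] prod_in[OF ihk Q(2)] unfolding polys_upto_eq
        by (intro polys_below_diff polys_below_add)
      fix z assume z: "ev l1 z = 0 \<or> ev l2 z = 0"
      show "ev (l2 * y - (?P1 * ?Q1 + ?P2 * ?Q2)) z = 0"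
      proof (cases "ev l2 z = 0")
        case False
        then have "ev y z = poly g (ev m1 z)" using z g(2) by blast
        then show ?thesis
          unfolding ev_simps ev_homog_1[OF d1] ev_homog_1[OF d2] ev_homog_1[OF lh(2)] ev_homog_1[OF dm]
          by (simp add: q lh(1) algebra_simps)
      qed simp
    qed
    then show ?thesis using N_D(2)[OF PN[OF d1] Q(1)] N_D(2)[OF PN[OF d2] Q(2)] by (simp only: L_simps)
  next
    case False
    then have cWn: "card W = n" using cWn n by simp
    then have "W = V \<inter> {z. ev l1 z = 0}"
      using fin card_line1[OF fin] cW by (intro card_subset_eq WV) auto
    then have "\<not> (ev l1 v = 0 \<and> ev l2 v = 0)" if "v \<in> V" for v using that unfolding W_def by blast
    then obtain k1 k2 where F: "E ^ n + l1 * k1 + l2 * k2 \<in> N" and k12: "k1 \<in> polys_below n" "k2 \<in> polys_below n" using F0 by blast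
    define F where "F = E ^ n + l1 * k1 + l2 * k2"
    obtain \<phi> where \<phi>: "degree \<phi> \<le> n" "\<forall>z. ev l1 z = 0 \<longrightarrow> ev F z = poly \<phi> (ev m1 z)"
      using restrict1[of F n] N_D(1)[OF F] by (auto simp: polys_upto_eq F_def)
    \<comment> \<open>\<open>F\<close> has coefficient 1 at the common point, so by
      \<open>glue1\<close> it cannot vanish along the first line.\<close>
    have \<phi>0: "\<phi> \<noteq> 0"
    proof
      assume "\<phi> = 0"
      have "1 * ev E z ^ n + ev l2 z * ev k2 z = 0" if z: "ev l1 z = 0" for z
      proof -
        have "ev F z = 0" using \<phi>(2) z \<open>\<phi> = 0\<close> by (metis poly_0)
        then show ?thesis using z by (simp add: F_def)
      qed
      then have "(1::real) = 0" by (rule glue1[OF k12(2)])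
      then show False by simp
    qed
    have "poly \<phi> t = 0" if t: "t \<in> S" for t
    proof -
      obtain v where v: "v \<in> V" "ev l1 v = 0" "t = ev m1 v" using t by (auto simp: S_def W_def)
      then have "ev F v = poly \<phi> (ev m1 v)" using \<phi>(2) by blast
      then show ?thesis using v N_D(3)[OF F v(1)] by (simp add: F_def)
    qed
    then have "root_poly S dvd \<phi>" using finS by (intro root_poly_dvd)
    then obtain \<omega> where \<omega>: "\<phi> = root_poly S * \<omega>" by (rule dvdE)
    then have "\<omega> \<noteq> 0" using \<phi>0 by auto
    then have "degree \<phi> = n + degree \<omega>" using cWn cS by (simp add: \<omega> degree_mult_eq)
    \<comment> \<open>A polynomial of degree at most \<open>n\<close> with these \<open>n\<close>
      roots is a constant multiple of the root polynomial.\<close>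
    then obtain w where w: "\<omega> = [:w:]" "w \<noteq> 0"
      using \<phi>(1) \<open>\<omega> \<noteq> 0\<close> by (metis add_le_same_cancel1 degree_eq_zeroE le_zero_eq pCons_0_0)
    have dqk: "degree q \<le> k" using dq cWn n by simp
    have "L (cst w * (l2 * y) - F * (l2 * homog k q 1 m1)) = 0"
    proof (rule L_zero_on_lines)
      show "cst w * (l2 * y) - F * (l2 * homog k q 1 m1) \<in> polys_upto (2 * n)"
        using l2y prod_in[OF N_D(1)[OF F] ihk] unfolding polys_upto_eq F_def
        by (intro polys_below_diff polys_below_cmult)
      fix z assume z: "ev l1 z = 0 \<or> ev l2 z = 0"
      show "ev (cst w * (l2 * y) - F * (l2 * homog k q 1 m1)) z = 0"
      proof (cases "ev l2 z = 0")
        case False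
        then have "ev y z = poly g (ev m1 z)" "ev F z = poly \<phi> (ev m1 z)" using z g(2) \<phi>(2) by blast+
        then show ?thesis unfolding ev_simps ev_homog_1[OF dqk] by (simp add: q \<omega> w(1))
      qed simp
    qed
    moreover have "L (F * (l2 * homog k q 1 m1)) = 0" unfolding F_def by (rule N_D(2)[OF F ihk])
    ultimately show ?thesis using w(2) by (simp add: L_simps)
  qed
qed

text \<open>Both requirements of \<open>sos_on_finite_variety\<close>, a dual family and
  annihilation of what vanishes on \<open>V\<close>, are met line by line. Only the term with a
  power of \<open>E\<close> links the lines; its treatment depends on whether the common point
  belongs to \<open>V\<close>.\<close>

lemma sos_on_finite_lines:
  assumes fin: "finite V"
  shows sos_on_variety
proof -
  interpret sw: two_lines n L N V l2 l1 m2 m1 E by (rule swap)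
  define W1 where "W1 = {v \<in> V. ev l1 v = 0 \<and> ev l2 v \<noteq> 0}"
  define W2 where "W2 = {v \<in> V. ev l2 v = 0 \<and> ev l1 v \<noteq> 0}"
  have W_fin: "finite W1" "finite W2" using fin by (simp_all add: W1_def W2_def)
  have "card W1 \<le> card (V \<inter> {z. ev l1 z = 0})" "card W2 \<le> card (V \<inter> {z. ev l2 z = 0})"
    using fin by (auto simp: W1_def W2_def intro!: card_mono)
  then have W_card: "card W1 \<le> n" "card W2 \<le> n" using card_line1[OF fin] sw.card_line1[OF fin] by simp_all
  have V_cases: "v \<in> W1 \<or> v \<in> W2 \<or> (ev l1 v = 0 \<and> ev l2 v = 0)" if "v \<in> V" for v
    using that V_lines unfolding W1_def W2_def by blast
  have En: "E ^ n \<in> polys_below (Suc n)" using E_in by (intro polys_below_affine_power) auto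
  have l_in: "l1 * h \<in> polys_below (Suc j)" "l2 * h \<in> polys_below (Suc j)" if "h \<in> polys_below j" for h j
    using that line_in by (auto intro: polys_below_affine_mult)
  have interp: "\<exists>h1\<in>polys_below n. \<exists>h2\<in>polys_below n. \<forall>v\<in>W1 \<union> W2. ev (l1 * h1 + l2 * h2) v = y v" for y :: "real \<times> real \<Rightarrow> real"
  proof -
    obtain h2 where "h2 \<in> polys_below n" "\<forall>v\<in>W1. ev (l2 * h2) v = y v"
      using interpolation_line1[OF W_fin(1) W_card(1), of y] by (auto simp: W1_def)
    moreover obtain h1 where "h1 \<in> polys_below n" "\<forall>v\<in>W2. ev (l1 * h1) v = y v"
      using sw.interpolation_line1[OF W_fin(2) W_card(2), of y] by (auto simp: W2_def)
    ultimately show ?thesis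
      by (intro bexI[of _ h1] bexI[of _ h2]) (auto simp: W1_def W2_def)
  qed
  have "\<exists>l\<in>polys_upto n. \<forall>u\<in>V. ev l u = (if u = v then 1 else 0)" if v: "v \<in> V" for v
  proof (cases "ev l1 v = 0 \<and> ev l2 v = 0")
    case False
    obtain h1 h2 where h: "h1 \<in> polys_below n" "h2 \<in> polys_below n"
      "\<forall>u\<in>W1 \<union> W2. ev (l1 * h1 + l2 * h2) u = (if u = v then 1 else 0)"
      using interp[of "\<lambda>u. if u = v then 1 else 0"] by blast
    have "ev (l1 * h1 + l2 * h2) u = (if u = v then 1 else 0)" if u: "u \<in> V" for u
    proof (cases "u \<in> W1 \<union> W2")
      case True
      then show ?thesis using h(3) by blast
    next
      case False
      then have "ev l1 u = 0 \<and> ev l2 u = 0" using V_cases[OF u] by blast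
      then show ?thesis using \<open>\<not> (ev l1 v = 0 \<and> ev l2 v = 0)\<close> by auto
    qed
    moreover have "l1 * h1 + l2 * h2 \<in> polys_upto n" using h l_in by (auto simp: polys_upto_eq)
    ultimately show ?thesis by blast
  next
    case True
    then have Ev: "ev E v \<noteq> 0" using E_glue by blast
    \<comment> \<open>The normalised power of \<open>E\<close> is 1 at the common point
      \<open>v\<close>; the interpolated part vanishes there and cancels it at all other
      points.\<close>
    obtain h1 h2 where h: "h1 \<in> polys_below n" "h2 \<in> polys_below n"
      "\<forall>u\<in>W1 \<union> W2. ev (l1 * h1 + l2 * h2) u = - ((ev E u / ev E v) ^ n)"
      using interp[of "\<lambda>u. - ((ev E u / ev E v) ^ n)"] by blast
    let ?l = "cst ((1 / ev E v) ^ n) * E ^ n + (l1 * h1 + l2 * h2)"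
    have "ev ?l u = (if u = v then 1 else 0)" if u: "u \<in> V" for u
    proof (cases "u = v")
      case True
      then show ?thesis using Ev \<open>ev l1 v = 0 \<and> ev l2 v = 0\<close> by (simp flip: power_mult_distrib)
    next
      case False
      then have "u \<in> W1 \<union> W2" using V_cases[OF u] True glue_unique by blast
      then have "ev (l1 * h1 + l2 * h2) u = - ((ev E u / ev E v) ^ n)" using h(3) by blast
      then show ?thesis using False by (simp add: power_divide)
    qed
    moreover have "?l \<in> polys_upto n" using h l_in En unfolding polys_upto_eq by (intro polys_below_add polys_below_cmult) auto
    ultimately show ?thesis by blast
  qed
  then obtain l where l: "\<And>v. v \<in> V \<Longrightarrow> l v \<in> polys_upto n"
    "\<And>u v. u \<in> V \<Longrightarrow> v \<in> V \<Longrightarrow> ev (l v) u = (if u = v then 1 else 0)" by metis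
  have inN: "p \<in> N" if "p \<in> polys_upto n" "\<And>v. v \<in> V \<Longrightarrow> ev p v = 0" for p
    using vanishing_in_N[OF fin, of l p] l that by auto
  \<comment> \<open>If \<open>V\<close> omits the common point, the values of \<open>E ^ n\<close>
    can be cancelled on all of \<open>V\<close> by multiples of \<open>l1\<close> and
    \<open>l2\<close>.\<close>
  have F0: "\<exists>k1\<in>polys_below n. \<exists>k2\<in>polys_below n. E ^ n + l1 * k1 + l2 * k2 \<in> N"
    if no_glue: "\<And>v. v \<in> V \<Longrightarrow> \<not> (ev l1 v = 0 \<and> ev l2 v = 0)"
  proof -
    obtain h1 h2 where h: "h1 \<in> polys_below n" "h2 \<in> polys_below n"
      "\<forall>u\<in>W1 \<union> W2. ev (l1 * h1 + l2 * h2) u = - (ev E u ^ n)"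
      using interp[of "\<lambda>u. - (ev E u ^ n)"] by blast
    have "E ^ n + (l1 * h1 + l2 * h2) \<in> N"
    proof (rule inN)
      show "E ^ n + (l1 * h1 + l2 * h2) \<in> polys_upto n"
        using h l_in En unfolding polys_upto_eq by (intro polys_below_add)
      fix v assume "v \<in> V"
      then have "v \<in> W1 \<union> W2" using V_cases no_glue by blast
      then have "ev (l1 * h1 + l2 * h2) v = - (ev E v ^ n)" using h(3) by blast
      then show "ev (E ^ n + (l1 * h1 + l2 * h2)) v = 0" by simp
    qed
    then show ?thesis using h(1,2) by (intro bexI[of _ h1] bexI[of _ h2]) (simp_all add: add.assoc)
  qed
  have F0': "\<exists>k1\<in>polys_below n. \<exists>k2\<in>polys_below n. E ^ n + l2 * k1 + l1 * k2 \<in> N"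
    if "\<And>v. v \<in> V \<Longrightarrow> \<not> (ev l2 v = 0 \<and> ev l1 v = 0)"
  proof -
    have "\<exists>k1\<in>polys_below n. \<exists>k2\<in>polys_below n. E ^ n + l1 * k1 + l2 * k2 \<in> N"
      by (rule F0) (use that in blast)
    then obtain k1 k2 where "k1 \<in> polys_below n" "k2 \<in> polys_below n" "E ^ n + l1 * k1 + l2 * k2 \<in> N" by blast
    then show ?thesis by (intro bexI[of _ k2] bexI[of _ k1]) (simp_all add: add.assoc add.commute[of "l2 * k2"])
  qed
  \<comment> \<open>Off the common point each of the two summands is alone on its line, so they can
    be annihilated separately.\<close>
  have no_E: "L (l1 * x + l2 * y) = 0"
    if xy: "x \<in> polys_below (2 * n)" "y \<in> polys_below (2 * n)" and 0: "\<And>v. v \<in> V \<Longrightarrow> ev (l1 * x + l2 * y) v = 0" for x y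
  proof -
    have "L (l2 * y) = 0"
    proof (rule vanishing_line1[OF fin inN F0 xy(2)])
      show "ev y v = 0" if "v \<in> V" "ev l1 v = 0" "ev l2 v \<noteq> 0" for v using 0[OF that(1)] that by simp
    qed
    moreover have "L (l1 * x) = 0"
    proof (rule sw.vanishing_line1[OF fin inN F0' xy(1)])
      show "ev x v = 0" if "v \<in> V" "ev l2 v = 0" "ev l1 v \<noteq> 0" for v using 0[OF that(1)] that by simp
    qed
    ultimately show ?thesis by (simp add: L_simps)
  qed
  show ?thesis
  proof (rule sos_on_finite_variety[OF fin l])
    fix f assume f: "f \<in> polys_upto (2 * n)" "\<And>v. v \<in> V \<Longrightarrow> ev f v = 0"
    obtain c x y where xy: "x \<in> polys_below (2 * n)" "y \<in> polys_below (2 * n)"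
      "f = cst c * E ^ (2 * n) + l1 * x + l2 * y"
      using glue_decomposition[of f "2 * n"] f(1) by (auto simp: polys_upto_eq)
    show "L f = 0"
    proof (cases "\<exists>v\<in>V. ev l1 v = 0 \<and> ev l2 v = 0")
      case True
      then obtain v where v: "v \<in> V" "ev l1 v = 0" "ev l2 v = 0" by blast
      have "c * ev E v ^ (2 * n) = 0" using f(2)[OF v(1)] v by (simp add: xy(3))
      then have "c = 0" using E_glue[OF v(2,3)] by simp
      then have "f = l1 * x + l2 * y" using xy(3) by simp
      then show ?thesis using no_E[OF xy(1,2)] f(2) by simp
    next
      case False
      then obtain k1 k2 where k: "k1 \<in> polys_below n" "k2 \<in> polys_below n" and F: "E ^ n + l1 * k1 + l2 * k2 \<in> N"
        using F0 by blast
      \<comment> \<open>Subtracting the multiple \<open>?F * ?e\<close> of a kernel element removes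
        the term \<open>c * E^(2n)\<close>, after which \<open>no_E\<close> applies.\<close>
      let ?F = "E ^ n + l1 * k1 + l2 * k2" and ?e = "cst c * E ^ n"
      have e: "?e \<in> polys_below (Suc n)" using En by blast
      have ek: "?e * k1 \<in> polys_below (2 * n)" "?e * k2 \<in> polys_below (2 * n)"
        using polys_below_mult[OF e] k by (auto simp: mult_2)
      have eq: "f - ?F * ?e = l1 * (x - ?e * k1) + l2 * (y - ?e * k2)"
        unfolding xy(3) mult_2 power_add by (simp add: algebra_simps)
      have "L (f - ?F * ?e) = 0" unfolding eq
      proof (rule no_E)
        show "x - ?e * k1 \<in> polys_below (2 * n)" "y - ?e * k2 \<in> polys_below (2 * n)"
          using xy ek by auto
        show "ev (l1 * (x - ?e * k1) + l2 * (y - ?e * k2)) v = 0" if "v \<in> V" for v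
          unfolding eq[symmetric] using f(2)[OF that] N_D(3)[OF F that] by (simp only: ev_simps mult_zero_left diff_0_right)
      qed
      moreover have "L (?F * ?e) = 0" using e by (intro N_D(2)[OF F]) (simp add: polys_upto_eq)
      ultimately show ?thesis by (simp only: L_simps)
    qed
  qed
qed

theorem sos_on_lines: sos_on_variety
proof (cases "finite V")
  case False
  interpret sw: two_lines n L N V l2 l1 m2 m1 E by (rule swap)
  have "V = (V \<inter> {z. ev l1 z = 0}) \<union> (V \<inter> {z. ev l2 z = 0})" using V_lines by blast
  then have "infinite (V \<inter> {z. ev l1 z = 0}) \<or> infinite (V \<inter> {z. ev l2 z = 0})"
    using False by (metis finite_Un)
  then show ?thesis
    using sos_on_both_lines sos_on_one_line sw.sos_on_one_line by blast
qed (rule sos_on_finite_lines)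

end

section \<open>Classification of the curves of degree at most two\<close>

context moment_functional
begin

text \<open>\<open>q\<close> is a combination of products of a factor of degree at most
  \<open>n - d\<close> with one of degree at most \<open>n\<close>. Recursive generation absorbs the
  first into the kernel element, which then annihilates the second.\<close>

lemma ideal_N:
  assumes P: "P \<in> N" "P \<in> polys_upto d" and d: "d \<le> n" and q: "q \<in> polys_upto (2 * n - d)"
  shows "L (P * q) = 0"
proof (rule linear_vanish_products[where T = "\<lambda>q. L (P * q)" and k = "n - d" and l = n])
  show "L (P * (p + q)) = L (P * p) + L (P * q)" for p q by (simp add: distrib_left L_simps)
  show "L (P * (p * q)) = 0" if "p \<in> polys_below (Suc (n - d))" "q \<in> polys_below (Suc n)" for p q
  proof -
    have p: "p \<in> polys_upto n" using that(1) by (auto simp: polys_upto_eq intro: polys_below_mono)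
    have "P * p \<in> polys_upto n"
      using P(2) that(1) d by (intro polys_upto_mult[of P d p "n - d"]) (auto simp: polys_upto_eq)
    then have "P * p \<in> N" using recursive P(1) p by blast
    then have "L (P * p * q) = 0" using that(2) by (intro N_D(2)) (auto simp: polys_upto_eq)
    then show ?thesis by (simp add: mult.assoc)
  qed
  show "q \<in> polys_below (Suc (n - d + n))" using q d by (simp add: polys_upto_eq mult_2)
qed

lemma sos_on_line_in_N:
  assumes N: "aff a b c \<in> N" and ab: "b \<noteq> 0 \<or> c \<noteq> 0"
  shows sos_on_variety
proof -
  have "n \<noteq> 0"
  proof
    assume "n = 0"
    then have "aff a b c \<in> polys_below 1" using N_D(1)[OF N] by (simp add: polys_upto_eq)
    then obtain d where d: "aff a b c = cst d" using bipoly_const by blast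
    from arg_cong[OF d, of "\<lambda>p. ev p (0, 0)"] arg_cong[OF d, of "\<lambda>p. ev p (1, 0)"]
      arg_cong[OF d, of "\<lambda>p. ev p (0, 1)"] show False using ab by simp
  qed
  have "b * b - c * (- c) \<noteq> 0" using ab by (simp add: sum_squares_eq_zero_iff)
  then have fr: "line_frame (aff a b c) (aff 0 (- c) b)" unfolding line_frame_def by blast
  show ?thesis
  proof (rule sos_on_line[OF fr])
    show "V \<subseteq> {z. ev (aff a b c) z = 0}" using N_D(3)[OF N] by blast
    show "L (aff a b c * q) = 0" if "q \<in> polys_below (2 * n)" for q
      using that \<open>n \<noteq> 0\<close> aff_in[of a b c]
      by (intro ideal_N[OF N, of 1]) (auto simp: polys_upto_eq numeral_2_eq_2)
  qed
qed

lemma L_mult_ideal: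
  assumes P: "P \<in> N" "P \<in> polys_upto 2" and n: "n \<ge> 2" and eq: "cst \<kappa> * P = p" and q: "q \<in> polys_below (2 * n - 1)"
  shows "L (p * q) = 0"
proof -
  have "2 * n - 1 = Suc (2 * n - 2)" using n by simp
  then have "L (P * q) = 0" using q n by (intro ideal_N[OF P]) (auto simp: polys_upto_eq)
  then show ?thesis unfolding eq[symmetric] by (simp add: mult.assoc L_simps)
qed

lemma zero_on_V:
  assumes "P \<in> N" "cst \<kappa> * P = p" "z \<in> V"
  shows "ev p z = 0"
  unfolding assms(2)[symmetric] using N_D(3)[OF assms(1,3)] by simp

text \<open>Each equation serves as a coordinate on the other line. The common point is finite, so
  with \<open>E = 1\<close> the glue coefficient is the value there.\<close>

lemma sos_on_crossing_lines:
  assumes P: "P \<in> N" "P \<in> polys_upto 2" and n: "n \<ge> 2"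
    and eq: "cst \<kappa> * P = aff p0 p1 p2 * aff q0 q1 q2" and D: "p1 * q2 - p2 * q1 \<noteq> 0"
  shows sos_on_variety
proof -
  let ?l1 = "aff p0 p1 p2" and ?l2 = "aff q0 q1 q2"
  have fr: "line_frame ?l1 ?l2" unfolding line_frame_def using D by blast
  have "q1 * p2 - q2 * p1 \<noteq> 0" using D by (simp add: mult.commute)
  then have fr': "line_frame ?l2 ?l1" unfolding line_frame_def by blast
  have D': "p0 * (q1 * 0 - q2 * 0) - p1 * (q0 * 0 - q2 * 1) + p2 * (q0 * 0 - q1 * 1) \<noteq> 0" using D by simp
  have one: "aff 1 0 0 = 1" by (simp add: aff_def cst_1)
  interpret two_lines n L N V ?l1 ?l2 ?l2 ?l1 1
  proof unfold_locales
    show "n \<ge> 1" using n by simp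
    show "line_frame ?l1 ?l2" "line_frame ?l2 ?l1" by fact+
    show "1 \<in> polys_below 2" by (simp add: numeral_2_eq_2)
    show "\<exists>p1\<in>polys_below (Suc k). \<exists>p2\<in>polys_below (Suc k). \<exists>p3\<in>polys_below (Suc k). p = ?l1 * p1 + ?l2 * p2 + 1 * p3"
      if p: "p \<in> polys_below (Suc (Suc k))" for p k
    proof (rule aff_frame[OF D'], unfold one)
      fix a0 b0 c0 a1 b1 c1 a2 b2 c2 :: real
      assume fr: "1 = cst a0 * ?l1 + cst b0 * ?l2 + cst c0 * 1"
        "vx = cst a1 * ?l1 + cst b1 * ?l2 + cst c1 * 1" "vy = cst a2 * ?l1 + cst b2 * ?l2 + cst c2 * 1"
      show ?thesis by (rule polys_below_frame_cases[OF p fr]) blast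
    qed
    obtain z where z: "ev ?l1 z = 0" "ev ?l2 z = 0" using line_frame_point[OF fr, of 0 0] by blast
    show "c = 0" if "\<And>z. ev ?l1 z = 0 \<Longrightarrow> c * ev 1 z ^ k + ev ?l2 z * ev h z = 0" for c h k
      using that[OF z(1)] z(2) by simp
    show "c = 0" if "\<And>z. ev ?l2 z = 0 \<Longrightarrow> c * ev 1 z ^ k + ev ?l1 z * ev h z = 0" for c h k
      using that[OF z(2)] z(1) by simp
    show "z = y" if "ev ?l1 z = 0" "ev ?l2 z = 0" "ev ?l1 y = 0" "ev ?l2 y = 0" for z y
      using line_frame_point[OF fr, of 0 0] that by blast
    show "V \<subseteq> {z. ev ?l1 z = 0} \<union> {z. ev ?l2 z = 0}"
      using zero_on_V[OF P(1) eq] by (auto simp del: ev_aff)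
    show "L (?l1 * (?l2 * q)) = 0" if "q \<in> polys_below (2 * n - 1)" for q
      using L_mult_ideal[OF P n eq that] by (simp add: mult.assoc)
  qed
  show ?thesis by (rule sos_on_lines)
qed

end

text \<open>On the line \<open>l'\<close> is constant, so \<open>l' * h\<close> has degree below
  \<open>k\<close> and \<open>c\<close> is the coefficient of the \<open>k\<close>-th power of the
  coordinate.\<close>

lemma parallel_glue:
  assumes fr: "line_frame l m" and const: "\<And>z. ev l z = 0 \<Longrightarrow> ev l' z = d"
    and h: "h \<in> polys_below k" and 0: "\<And>z. ev l z = 0 \<Longrightarrow> c * ev m z ^ k + ev l' z * ev h z = 0"
  shows "c = 0"
proof (cases k)
  case 0
  obtain z where "ev l z = 0" using line_frame_point[OF fr, of 0 0] by blast
  then show ?thesis using h assms(4)[of z] by (simp add: 0 polys_below_0)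
next
  case (Suc j)
  then obtain g where g: "degree g \<le> j" "\<forall>z. ev l z = 0 \<longrightarrow> ev h z = poly g (ev m z)"
    using line_restriction[OF fr, of h j] h by blast
  let ?p = "Polynomial.monom c k + [:d:] * g"
  have "poly ?p t = 0" for t
  proof -
    obtain z where z: "ev l z = 0" "ev m z = t" using line_frame_point[OF fr, of 0 t] by blast
    then have "ev h z = poly g t" using g(2) by blast
    then show ?thesis using assms(4)[OF z(1)] const[OF z(1)] z(2) by (simp add: poly_monom)
  qed
  then have "?p = 0" using poly_all_0_iff_0 by blast
  then have "coeff ?p k = 0" by simp
  then show ?thesis using g(1) Suc by (simp add: coeff_eq_0)
qed

context moment_functional
begin

text \<open>With \<open>E\<close> the coordinate along the lines, the value at their common point at
  infinity becomes a leading coefficient.\<close>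

lemma sos_on_parallel_lines:
  assumes P: "P \<in> N" "P \<in> polys_upto 2" and n: "n \<ge> 2"
    and eq: "cst \<kappa> * P = aff p0 p1 p2 * aff (s * p0 + 1) (s * p1) (s * p2)"
    and s: "s \<noteq> 0" and p: "p1 \<noteq> 0 \<or> p2 \<noteq> 0"
  shows sos_on_variety
proof -
  let ?l1 = "aff p0 p1 p2" and ?l2 = "aff (s * p0 + 1) (s * p1) (s * p2)" and ?m = "aff 0 (- p2) p1"
  have D: "p1 * p1 + p2 * p2 \<noteq> 0" using p by (simp add: sum_squares_eq_zero_iff)
  then have "p1 * p1 - p2 * (- p2) \<noteq> 0" by simp
  then have fr: "line_frame ?l1 ?m" unfolding line_frame_def by blast
  have "s * (p1 * p1 + p2 * p2) \<noteq> 0" using D s by simp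
  then have "(s * p1) * p1 - (s * p2) * (- p2) \<noteq> 0" by (simp add: algebra_simps)
  then have fr': "line_frame ?l2 ?m" unfolding line_frame_def by blast
  \<comment> \<open>The summand 1, by which the second form differs from \<open>s\<close> times the
    first, makes the three forms independent.\<close>
  have D': "p0 * ((s * p1) * p1 - (s * p2) * (- p2)) - p1 * ((s * p0 + 1) * p1 - (s * p2) * 0)
      + p2 * ((s * p0 + 1) * (- p2) - (s * p1) * 0) \<noteq> 0" (is "?D \<noteq> 0")
  proof -
    have "?D = - (p1 * p1 + p2 * p2)" by (simp add: algebra_simps)
    then show ?thesis using D by (metis neg_equal_0_iff_equal)
  qed
  have l2: "ev ?l2 z = s * ev ?l1 z + 1" for z by (simp add: algebra_simps)
  interpret two_lines n L N V ?l1 ?l2 ?m ?m ?m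
  proof unfold_locales
    show "n \<ge> 1" using n by simp
    show "line_frame ?l1 ?m" "line_frame ?l2 ?m" by fact+
    show "?m \<in> polys_below 2" by (rule aff_in)
    show "\<exists>p1\<in>polys_below (Suc k). \<exists>p2\<in>polys_below (Suc k). \<exists>p3\<in>polys_below (Suc k). p = ?l1 * p1 + ?l2 * p2 + ?m * p3"
      if p: "p \<in> polys_below (Suc (Suc k))" for p k
    proof (rule aff_frame[OF D'])
      fix a0 b0 c0 a1 b1 c1 a2 b2 c2 :: real
      assume fr: "1 = cst a0 * ?l1 + cst b0 * ?l2 + cst c0 * ?m"
        "vx = cst a1 * ?l1 + cst b1 * ?l2 + cst c1 * ?m" "vy = cst a2 * ?l1 + cst b2 * ?l2 + cst c2 * ?m"
      show ?thesis by (rule polys_below_frame_cases[OF p fr]) blast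
    qed
    show "c = 0" if "h \<in> polys_below k" "\<And>z. ev ?l1 z = 0 \<Longrightarrow> c * ev ?m z ^ k + ev ?l2 z * ev h z = 0" for c h k
      using parallel_glue[OF fr _ that(1), of ?l2 1 c] that(2) l2 by simp
    show "c = 0" if h: "h \<in> polys_below k" and 0: "\<And>z. ev ?l2 z = 0 \<Longrightarrow> c * ev ?m z ^ k + ev ?l1 z * ev h z = 0" for c h k
    proof (rule parallel_glue[OF fr' _ h])
      show "ev ?l1 z = - 1 / s" if "ev ?l2 z = 0" for z
        using that s unfolding l2 by (simp add: field_simps del: ev_aff)
    qed (rule 0)
    show "z = y" if "ev ?l1 z = 0" "ev ?l2 z = 0" for z y using that unfolding l2 by (simp del: ev_aff)
    show "V \<subseteq> {z. ev ?l1 z = 0} \<union> {z. ev ?l2 z = 0}"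
      using zero_on_V[OF P(1) eq] by (auto simp del: ev_aff)
    show "L (?l1 * (?l2 * q)) = 0" if "q \<in> polys_below (2 * n - 1)" for q
      using L_mult_ideal[OF P n eq that] by (simp add: mult.assoc)
  qed
  show ?thesis by (rule sos_on_lines)
qed

lemma quadratic_expansion:
  assumes "P \<in> polys_upto 2" and "ev P (x0, y0) = 0"
  shows "\<exists>D F. \<forall>z. ev P z = bicoeff P 0 2 * (fst z - x0)^2 + bicoeff P 1 1 * (fst z - x0) * (snd z - y0)
    + bicoeff P 2 0 * (snd z - y0)^2 + D * (fst z - x0) + F * (snd z - y0)"
proof -
  have m: "set (monomials 2) = {(0, 0), (0, 1), (1, 0), (0, 2), (1, 1), (2, 0)}"
    by (auto simp: monomials_def numeral_2_eq_2)
  define a b c d e f where "a = bicoeff P 0 0" and "b = bicoeff P 0 1" and "c = bicoeff P 1 0"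
    and "d = bicoeff P 0 2" and "e = bicoeff P 1 1" and "f = bicoeff P 2 0"
  have ev: "ev P z = a + b * fst z + c * snd z + d * (fst z)^2 + e * (snd z * fst z) + f * (snd z)^2" for z
    unfolding ev_expand[OF assms(1)] m ev_monomial case_prod_beta a_def b_def c_def d_def e_def f_def
    by simp
  have "a + b * x0 + c * y0 + d * x0^2 + e * (y0 * x0) + f * y0^2 = 0" using assms(2) unfolding ev by simp
  then have a: "a = - (b * x0 + c * y0 + d * x0^2 + e * (y0 * x0) + f * y0^2)" by simp
  show ?thesis unfolding ev d_def[symmetric] e_def[symmetric] f_def[symmetric]
    by (rule exI[of _ "b + 2 * d * x0 + e * y0"], rule exI[of _ "c + 2 * f * y0 + e * x0"])
      (simp add: a power2_eq_square algebra_simps)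
qed

text \<open>The curve is expanded at a point of \<open>V\<close>. If the gradient there is nonzero,
  the tangent \<open>l\<close> as first coordinate gives \<open>P = l * c + \<gamma> * m^2\<close>:
  a conic in the required form or, for \<open>\<gamma> = 0\<close>, a line or a pair of lines. If it
  is zero, \<open>P\<close> is a quadratic form in the displacement, and the sign of its
  discriminant decides.\<close>

theorem sos_on_quadratic_curve:
  assumes P: "P \<in> N" "P \<in> polys_upto 2" "P \<noteq> 0" and V: "V \<noteq> {}"
  shows sos_on_variety
proof -
  obtain x0 y0 where z0: "(x0, y0) \<in> V" using V by auto
  define A B C where "A = bicoeff P 0 2" and "B = bicoeff P 1 1" and "C = bicoeff P 2 0"
  obtain D F where evP: "\<And>z. ev P z = A * (fst z - x0)^2 + B * (fst z - x0) * (snd z - y0)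
    + C * (snd z - y0)^2 + D * (fst z - x0) + F * (snd z - y0)"
    using quadratic_expansion[OF P(2) N_D(3)[OF P(1) z0]] unfolding A_def B_def C_def by blast
  have deg2: "n \<ge> 2" if "A \<noteq> 0 \<or> B \<noteq> 0 \<or> C \<noteq> 0"
    using N_D(1)[OF P(1)] that unfolding A_def B_def C_def polys_upto_def total_degree_le_iff by force
  show ?thesis
  proof (cases "D = 0 \<and> F = 0")
    case False
    define \<rho> where "\<rho> = D^2 + F^2"
    have \<rho>: "\<rho> \<noteq> 0" using False by (simp add: \<rho>_def sum_power2_eq_zero_iff)
    \<comment> \<open>Coefficients of the quadratic part in the orthogonal coordinates
      \<open>D * u + F * v\<close> and \<open>D * v - F * u\<close>, whose squared length
      \<open>\<rho>\<close> causes the denominators.\<close>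
    define \<alpha> where "\<alpha> = (A * D^2 + B * D * F + C * F^2) / \<rho>^2"
    define \<beta> where "\<beta> = (2 * (C - A) * D * F + B * (D^2 - F^2)) / \<rho>^2"
    define \<gamma> where "\<gamma> = (A * F^2 - B * D * F + C * D^2) / \<rho>^2"
    define l0 where "l0 = - (D * x0 + F * y0)"
    define m0 where "m0 = F * x0 - D * y0"
    let ?l = "aff l0 D F" and ?m = "aff m0 (- F) D"
    let ?c = "aff (\<alpha> * l0 + \<beta> * m0 + 1) (\<alpha> * D - \<beta> * F) (\<alpha> * F + \<beta> * D)"
    have P_eq: "ev P z = ev ?l z * ev ?c z + \<gamma> * ev ?m z ^ 2" for z
    proof -
      define u v where "u = fst z - x0" and "v = snd z - y0"
      define l m where "l = D * u + F * v" and "m = D * v - F * u"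
      have lm: "ev ?l z = l" "ev ?m z = m" "ev ?c z = \<alpha> * l + \<beta> * m + 1"
        by (simp_all add: l_def m_def u_def v_def l0_def m0_def algebra_simps)
      have "\<rho>^2 * (\<alpha> * l^2 + \<beta> * l * m + \<gamma> * m^2)
          = (\<rho>^2 * \<alpha>) * l^2 + (\<rho>^2 * \<beta>) * l * m + (\<rho>^2 * \<gamma>) * m^2" by (simp add: algebra_simps)
      also have "\<dots> = (A * D^2 + B * D * F + C * F^2) * l^2 + (2 * (C - A) * D * F + B * (D^2 - F^2)) * l * m
          + (A * F^2 - B * D * F + C * D^2) * m^2" using \<rho> by (simp add: \<alpha>_def \<beta>_def \<gamma>_def)
      also have "\<dots> = \<rho>^2 * (A * u^2 + B * u * v + C * v^2)"
        unfolding l_def m_def \<rho>_def by (simp add: power2_eq_square algebra_simps)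
      finally have "\<alpha> * l^2 + \<beta> * l * m + \<gamma> * m^2 = A * u^2 + B * u * v + C * v^2" using \<rho> by simp
      then show ?thesis
        unfolding evP lm u_def[symmetric] v_def[symmetric] by (simp add: l_def power2_eq_square algebra_simps)
    qed
    show ?thesis
    proof (cases "\<gamma> = 0")
      case \<gamma>: False
      then have "A \<noteq> 0 \<or> B \<noteq> 0 \<or> C \<noteq> 0" by (auto simp: \<gamma>_def)
      then have n: "n \<ge> 2" by (rule deg2)
      \<comment> \<open>This factor turns \<open>l * c + \<gamma> * m^2\<close> into the form
        \<open>a * c - m * m\<close>.\<close>
      define g where "g = - 1 / \<gamma>"
      let ?a = "aff (g * l0) (g * D) (g * F)"
      have eq: "cst g * P = ?a * ?c - ?m * ?m"
      proof (rule ev_ext)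
        fix z
        have "ev ?a z = g * ev ?l z" by (simp add: algebra_simps)
        moreover have "g * \<gamma> = -1" using \<gamma> by (simp add: g_def)
        then have "g * (\<gamma> * ev ?m z ^ 2) = - (ev ?m z * ev ?m z)"
          by (simp only: mult.assoc[symmetric] power2_eq_square mult_minus_left mult_1_left)
        ultimately show "ev (cst g * P) z = ev (?a * ?c - ?m * ?m) z"
          unfolding ev_simps P_eq by (simp only: distrib_left mult.assoc diff_conv_add_uminus)
      qed
      show ?thesis
      proof (rule sos_on_conic[OF _ refl refl refl])
        have "(g * l0) * ((- F) * (\<alpha> * F + \<beta> * D) - D * (\<alpha> * D - \<beta> * F)) -
            (g * D) * (m0 * (\<alpha> * F + \<beta> * D) - D * (\<alpha> * l0 + \<beta> * m0 + 1)) +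
            (g * F) * (m0 * (\<alpha> * D - \<beta> * F) - (- F) * (\<alpha> * l0 + \<beta> * m0 + 1)) = g * \<rho>"
          by (simp add: \<rho>_def power2_eq_square algebra_simps)
        then show "(g * l0) * ((- F) * (\<alpha> * F + \<beta> * D) - D * (\<alpha> * D - \<beta> * F)) -
            (g * D) * (m0 * (\<alpha> * F + \<beta> * D) - D * (\<alpha> * l0 + \<beta> * m0 + 1)) +
            (g * F) * (m0 * (\<alpha> * D - \<beta> * F) - (- F) * (\<alpha> * l0 + \<beta> * m0 + 1)) \<noteq> 0"
          using \<rho> \<gamma> by (simp add: g_def)
        show "n \<ge> 1" using n by simp
        show "V \<subseteq> {z. ev (?a * ?c - ?m * ?m) z = 0}"
          using zero_on_V[OF P(1) eq] by blast
        show "L ((?a * ?c - ?m * ?m) * q) = 0" if "q \<in> polys_below (2 * n - 1)" for q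
          using L_mult_ideal[OF P(1,2) n eq that] .
      qed
    next
      case \<gamma>: True
      have eq: "cst 1 * P = ?l * ?c"
        by (rule ev_ext) (simp only: ev_simps P_eq \<gamma> mult_zero_left mult_1_left add_0_right)
      \<comment> \<open>The second factor is \<open>\<alpha> * l + \<beta> * m + 1\<close>: a
        constant, a parallel of \<open>l\<close>, or for \<open>\<beta> \<noteq> 0\<close> a line
        crossing it.\<close>
      show ?thesis
      proof (cases "\<alpha> = 0 \<and> \<beta> = 0")
        case True
        then have "P = ?l" using eq by (simp add: cst_1 aff_def)
        then show ?thesis using P(1) False by (intro sos_on_line_in_N) auto
      next
        case nz: False
        then have "A \<noteq> 0 \<or> B \<noteq> 0 \<or> C \<noteq> 0" by (auto simp: \<alpha>_def \<beta>_def)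
        then have n: "n \<ge> 2" by (rule deg2)
        show ?thesis
        proof (cases "\<beta> = 0")
          case True
          then have "cst 1 * P = ?l * aff (\<alpha> * l0 + 1) (\<alpha> * D) (\<alpha> * F)" using eq by simp
          then show ?thesis
            by (rule sos_on_parallel_lines[OF P(1,2) n]) (use nz True False in auto)
        next
          case \<beta>: False
          have "D * (\<alpha> * F + \<beta> * D) - F * (\<alpha> * D - \<beta> * F) = \<beta> * \<rho>"
            by (simp add: \<rho>_def power2_eq_square algebra_simps)
          then show ?thesis using \<beta> \<rho> by (intro sos_on_crossing_lines[OF P(1,2) n eq]) simp
        qed
      qed
    qed
  next
    case True
    then have evP: "ev P z = A * (fst z - x0)^2 + B * (fst z - x0) * (snd z - y0) + C * (snd z - y0)^2" for z
      using evP by simp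
    have nz: "A \<noteq> 0 \<or> B \<noteq> 0 \<or> C \<noteq> 0"
    proof (rule ccontr)
      assume "\<not> ?thesis"
      then have "P = 0" by (intro ev_ext) (simp add: evP)
      then show False using P(3) by simp
    qed
    then have n: "n \<ge> 2" by (rule deg2)
    have n1: "aff p q r \<in> polys_upto n" for p q r
      using aff_in[of p q r] n by (auto simp: polys_upto_eq intro: polys_below_mono)
    define \<Delta> where "\<Delta> = B^2 - 4 * A * C"
    consider "\<Delta> > 0" "A \<noteq> 0" | "\<Delta> > 0" "A = 0" | "\<Delta> \<le> 0" "A \<noteq> 0" | "\<Delta> \<le> 0" "A = 0" by linarith
    then show ?thesis
    proof cases
      case 1
      \<comment> \<open>Completing the square writes \<open>4 * A\<close> times the form as a
        difference of squares \<open>(2 * A * u + B * v)^2 - r^2 * v^2\<close>.\<close>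
      define r where "r = sqrt \<Delta>"
      have r: "r^2 = B^2 - 4 * A * C" "r \<noteq> 0" using 1 by (simp_all add: r_def \<Delta>_def)
      have eq: "cst (4 * A) * P = aff (- (2 * A * x0 + (B + r) * y0)) (2 * A) (B + r)
          * aff (- (2 * A * x0 + (B - r) * y0)) (2 * A) (B - r)"
      proof (rule ev_ext)
        fix z
        define u v where "u = fst z - x0" and "v = snd z - y0"
        have "4 * A * (A * u^2 + B * u * v + C * v^2) = (2 * A * u + B * v)^2 - (B^2 - 4 * A * C) * v^2"
          by (simp add: power2_eq_square algebra_simps)
        also have "\<dots> = (2 * A * u + (B + r) * v) * (2 * A * u + (B - r) * v)"
          unfolding r(1)[symmetric] by (simp add: power2_eq_square algebra_simps)
        finally show "ev (cst (4 * A) * P) z = ev (aff (- (2 * A * x0 + (B + r) * y0)) (2 * A) (B + r)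
          * aff (- (2 * A * x0 + (B - r) * y0)) (2 * A) (B - r)) z"
          unfolding ev_simps evP ev_aff u_def v_def by (simp add: algebra_simps)
      qed
      have "2 * A * (B - r) - (B + r) * (2 * A) = - (4 * A * r)" by (simp add: algebra_simps)
      then show ?thesis using 1 r(2) by (intro sos_on_crossing_lines[OF P(1,2) n eq]) simp
    next
      case 2
      then have B: "B \<noteq> 0" by (auto simp: \<Delta>_def)
      have eq: "cst 1 * P = aff (- y0) 0 1 * aff (- (B * x0 + C * y0)) B C"
        by (rule ev_ext, simp only: ev_simps evP ev_aff) (simp add: 2 power2_eq_square algebra_simps)
      show ?thesis by (rule sos_on_crossing_lines[OF P(1,2) n eq]) (use B in simp)
    next
      case 3
      \<comment> \<open>A semidefinite form is, up to a factor, a sum of nonnegative multiples of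
        squares. Since \<open>L P = 0\<close>, the square of \<open>?l\<close> is annihilated too,
        and this line in the kernel takes over the role of \<open>P\<close>.\<close>
      let ?l = "aff (- (2 * A * x0 + B * y0)) (2 * A) B" and ?v = "aff (- y0) 0 1"
      have eq: "cst (4 * A) * P = ?l * ?l + cst (- \<Delta>) * (?v * ?v)"
        by (rule ev_ext, simp only: ev_simps evP ev_aff) (simp add: \<Delta>_def power2_eq_square algebra_simps)
      have "L P = 0" using N_D(2)[OF P(1), of 1] by (simp add: polys_upto_eq)
      then have "L (?l * ?l) + (- \<Delta>) * L (?v * ?v) = 0"
        using arg_cong[OF eq, of L] by (simp only: L_simps mult_zero_right)
      moreover have "L (?l * ?l) \<ge> 0" "(- \<Delta>) * L (?v * ?v) \<ge> 0"
        using psd[OF n1] 3 by (auto intro: mult_nonpos_nonneg)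
      ultimately have "L (?l * ?l) = 0" by linarith
      then have "?l \<in> N" by (rule null_square_in_N[OF n1])
      then show ?thesis using 3 by (intro sos_on_line_in_N) auto
    next
      case 4
      then have C: "B = 0" "C \<noteq> 0" using nz by (auto simp: \<Delta>_def)
      let ?v = "aff (- y0) 0 1"
      have "cst (1 / C) * P = ?v * ?v"
        by (rule ev_ext, simp only: ev_simps evP ev_aff) (simp add: 4 C power2_eq_square)
      moreover have "L P = 0" using N_D(2)[OF P(1), of 1] by (simp add: polys_upto_eq)
      ultimately have "L (?v * ?v) = 0" by (metis L_simps(2) mult_zero_right)
      then have "?v \<in> N" by (rule null_square_in_N[OF n1])
      then show ?thesis by (intro sos_on_line_in_N) auto
    qed
  qed
qed

end

text \<open>\<open>card\<close> of an infinite set is 0, so an infinite variety, for which the rank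
  inequality holds trivially, appears as a separate disjunct.\<close>

theorem theorem1p2:
  fixes P :: bipoly
  assumes "P \<noteq> 0" and "total_degree P \<le> 2"
  shows "\<forall>n \<ge> total_degree P. \<forall>\<beta> :: nat \<Rightarrow> nat \<Rightarrow> real. \<beta> 0 0 > 0 \<longrightarrow>
    ((\<exists>\<mu>. representing_measure n \<beta> \<mu> \<and> measure_support \<mu> \<subseteq> zero_set P) \<longleftrightarrow>
      positive_semidefinite (moment_matrix n \<beta>) \<and>
      recursively_generated n \<beta> \<and>
      column_relation n \<beta> P \<and>
      (infinite (moment_variety n \<beta>) \<or> moment_rank n \<beta> \<le> card (moment_variety n \<beta>)))"
proof (intro allI impI iffI)
  fix n and \<beta> :: "nat \<Rightarrow> nat \<Rightarrow> real"
  assume "total_degree P \<le> n"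
  then have P: "P \<in> polys_upto n" by (simp add: polys_upto_def)
  assume "\<exists>\<mu>. representing_measure n \<beta> \<mu> \<and> measure_support \<mu> \<subseteq> zero_set P"
  then show "positive_semidefinite (moment_matrix n \<beta>) \<and> recursively_generated n \<beta> \<and>
      column_relation n \<beta> P \<and>
      (infinite (moment_variety n \<beta>) \<or> moment_rank n \<beta> \<le> card (moment_variety n \<beta>))"
    using representing_measure_imp[OF _ _ P] by blast
next
  fix n and \<beta> :: "nat \<Rightarrow> nat \<Rightarrow> real"
  assume "total_degree P \<le> n" and pos: "\<beta> 0 0 > 0"
  then have P: "P \<in> polys_upto n" by (simp add: polys_upto_def)
  assume H: "positive_semidefinite (moment_matrix n \<beta>) \<and> recursively_generated n \<beta> \<and>
      column_relation n \<beta> P \<and>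
      (infinite (moment_variety n \<beta>) \<or> moment_rank n \<beta> \<le> card (moment_variety n \<beta>))"
  define L where "L = riesz n \<beta>"
  define N where "N = {p \<in> polys_upto n. \<forall>q\<in>polys_upto n. L (p * q) = 0}"
  define V where "V = moment_variety n \<beta>"
  have N_iff: "p \<in> N \<longleftrightarrow> p \<in> polys_upto n \<and> column_relation n \<beta> p" for p
    using column_relation_iff by (auto simp: N_def L_def)
  have V_eq: "V = {z. \<forall>p\<in>N. ev p z = 0}"
    unfolding V_def moment_variety_def zero_set_eq using N_iff by blast
  interpret moment_functional n L N V
  proof
    show "linear_functional L" unfolding L_def by (rule linear_riesz)
    show "L (p * p) \<ge> 0" if "p \<in> polys_upto n" for p
      using H that unfolding positive_semidefinite_iff L_def by blast
    show "p * q \<in> N" if "p \<in> N" "q \<in> polys_upto n" "p * q \<in> polys_upto n" for p q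
      using H that unfolding recursively_generated_def N_iff by blast
    show "g \<in> N" if "finite V" "\<forall>v\<in>V. l v \<in> polys_upto n"
      "\<forall>u\<in>V. \<forall>v\<in>V. ev (l v) u = (if u = v then 1 else 0)" "g \<in> polys_upto n" "\<forall>v\<in>V. ev g v = 0" for l g
      using vanishing_imp_column_relation[of V n \<beta> l g] that H by (auto simp: N_iff V_def)
  qed (fact N_def V_eq)+
  have PN: "P \<in> N" using P H by (simp add: N_iff)
  \<comment> \<open>For an empty variety the empty dual family would put the constant 1 into the
    kernel, and then \<open>\<beta> 0 0\<close>, the value of \<open>L\<close> at 1, would be
    zero.\<close>
  have "V \<noteq> {}"
  proof
    assume "V = {}"
    then have "1 \<in> N" using vanishing_in_N[of "\<lambda>_. 0" 1] by (simp add: polys_upto_eq)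
    then have "L (1 * 1) = 0" by (rule N_D(2)) (simp add: polys_upto_eq)
    moreover have "L 1 = \<beta> 0 0"
      using riesz_monomial[of "(0, 0)" n \<beta>] by (simp add: L_def monomial_def)
    ultimately show False using pos by simp
  qed
  then have sos_on_variety
    using sos_on_quadratic_curve[OF PN _ assms(1)] assms(2) by (simp add: polys_upto_def)
  then obtain xs where "\<forall>(w, z)\<in>set xs. w \<ge> 0 \<and> z \<in> V"
    "\<forall>f\<in>polys_upto (2 * n). L f = (\<Sum>(w, z)\<leftarrow>xs. w * ev f z)"
    using sos_on_variety_imp_atomic by blast
  then obtain \<mu> where "representing_measure n \<beta> \<mu>" "measure_support \<mu> \<subseteq> V"
    using atomic_representing_measure[of xs V n \<beta>] unfolding L_def by blast
  moreover have "V \<subseteq> zero_set P" using N_D(3)[OF PN] by (auto simp: zero_set_eq)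
  ultimately show "\<exists>\<mu>. representing_measure n \<beta> \<mu> \<and> measure_support \<mu> \<subseteq> zero_set P" by blast
qed

end
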